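(* Let $p$ be a prime, let $G$ be a nontrivial finite $p$-group, and let $n\ge 1$ be an integer. The following are equivalent: (1) $G$ is a nested GVZ-group and $|\mathrm{cd}(G)|=n$. (2) $\upsilon_n=G$ and $\upsilon_{n-1}=[G,G]$. (3) $\epsilon_{n+1}=1$ and $\epsilon_n=Z(G)$. Moreover, in the event that $G$ is a nested GVZ-group with chain of centers $G=X_0>X_1>\dotsb>X_m>1$, we have $\upsilon_i=[G,X_{m-i}]$ and $\epsilon_{i+1}=X_i$ for each $1\le i\le m$.
   Context: All groups are finite and characters are complex; $\mathrm{Irr}(G)$ is the set of irreducible characters of $G$, $\mathrm{cd}(G)=\{\chi(1):\chi\in\mathrm{Irr}(G)\}$, and $Z(G)$ is the center of $G$. For a normal subgroup $N\lhd G$, let $\mathrm{Irr}(G\mid N)=\{\chi\in\mathrm{Irr}(G): N\nleq\ker(\chi)\}$, and let $V(G\mid N)$ be the subgroup of $G$ generated by all $g\in G$ such that $\chi(g)\neq 0$ for some $\chi\in\mathrm{Irr}(G\mid N)$; in particular $V(G\mid 1)=1$. For $N\lhd G$, let $U(G\mid N)=\prod H$, the product of all normal subgroups $H\lhd G$ satisfying $V(G\mid H)\le N$. Put $U(G)=U(G\mid Z(G))$. Define normal subgroups $1=\upsilon_0\le\upsilon_1\le\dotsb$ of $G$ by $\upsilon_0=1$ and $\upsilon_{i+1}/\upsilon_i=U(G/\upsilon_i)$ for $i\ge 0$. Define normal subgroups $G=\epsilon_1\ge\epsilon_2\ge\dotsb$ of $G$ by $\epsilon_1=G$ and $\epsilon_{i+1}=V(G\mid[\epsilon_i,G])$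 for $i\ge 1$. For $\chi\in\mathrm{Irr}(G)$, $Z(\chi)=\{g\in G:|\chi(g)|=\chi(1)\}$ is the center of $\chi$, and $V(\chi)$ is the subgroup generated by all $g\in G$ with $\chi(g)\ne 0$. $G$ is a GVZ-group if $V(\chi)=Z(\chi)$ for all $\chi\in\mathrm{Irr}(G)$ (i.e. every $\chi\in\mathrm{Irr}(G)$ vanishes on $G\setminus Z(\chi)$). $G$ is nested if the set $\{Z(\chi):\chi\in\mathrm{Irr}(G)\}$ is a chain under inclusion; in that case this set, listed as $G=X_0>X_1>\dotsb>X_m$, is called the chain of centers for $G$. A nested GVZ-group is a group that is both nested and a GVZ-group. *)

theory Defs
  imports
    "Jordan_Normal_Form.VS_Connect"
    "HOL-Algebra.Generated_Groups"
begin

section \<open>Complex irreducible characters\<close>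

definition GL :: "nat \<Rightarrow> complex mat monoid" where
  "GL d = units_of (ring_mat TYPE(complex) d ())"

definition mat_trace :: "complex mat \<Rightarrow> complex" where
  "mat_trace A = (\<Sum>i<dim_row A. A $$ (i, i))"

definition irreducible_rep ::
    "('a, 'b) monoid_scheme \<Rightarrow> nat \<Rightarrow> ('a \<Rightarrow> complex mat) \<Rightarrow> bool" where
  "irreducible_rep G d \<rho> \<longleftrightarrow>
     \<rho> \<in> hom G (GL d) \<and> 0 < d \<and>
     (\<forall>W. VectorSpace.subspace class_ring W (module_vec TYPE(complex) d) \<and>
          (\<forall>g\<in>carrier G. \<forall>w\<in>W. \<rho> g *\<^sub>v w \<in> W)
        \<longrightarrow> W = {0\<^sub>v d} \<or> W = carrier_vec d)"

text \<open>Characters are functions on the carrier; they are made \<open>undefined\<close> outside it,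
  so that equality of characters is equality on the group.\<close>

definition Irr :: "('a, 'b) monoid_scheme \<Rightarrow> ('a \<Rightarrow> complex) set" where
  "Irr G = {restrict (\<lambda>g. mat_trace (\<rho> g)) (carrier G) | d \<rho>. irreducible_rep G d \<rho>}"

definition cd :: "('a, 'b) monoid_scheme \<Rightarrow> complex set" where
  "cd G = (\<lambda>\<chi>. \<chi> \<one>\<^bsub>G\<^esub>) ` Irr G"

definition char_ker :: "('a, 'b) monoid_scheme \<Rightarrow> ('a \<Rightarrow> complex) \<Rightarrow> 'a set" where
  "char_ker G \<chi> = {g \<in> carrier G. \<chi> g = \<chi> \<one>\<^bsub>G\<^esub>}"

definition char_center :: "('a, 'b) monoid_scheme \<Rightarrow> ('a \<Rightarrow> complex) \<Rightarrow> 'a set" where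
  "char_center G \<chi> = {g \<in> carrier G. complex_of_real (cmod (\<chi> g)) = \<chi> \<one>\<^bsub>G\<^esub>}"

definition char_van :: "('a, 'b) monoid_scheme \<Rightarrow> ('a \<Rightarrow> complex) \<Rightarrow> 'a set" where
  "char_van G \<chi> = generate G {g \<in> carrier G. \<chi> g \<noteq> 0}"

definition Irr_over :: "('a, 'b) monoid_scheme \<Rightarrow> 'a set \<Rightarrow> ('a \<Rightarrow> complex) set" where
  "Irr_over G N = {\<chi> \<in> Irr G. \<not> N \<subseteq> char_ker G \<chi>}"


section \<open>The subgroups \<open>V(G | N)\<close> and \<open>U(G | N)\<close> and the two series\<close>

definition group_center :: "('a, 'b) monoid_scheme \<Rightarrow> 'a set" where
  "group_center G = {z \<in> carrier G. \<forall>g\<in>carrier G. z \<otimes>\<^bsub>G\<^esub> g = g \<otimes>\<^bsub>G\<^esub> z}"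

text \<open>The commutator convention is that of \<^const>\<open>derived\<close>.\<close>

definition commutator_subgroup ::
    "('a, 'b) monoid_scheme \<Rightarrow> 'a set \<Rightarrow> 'a set \<Rightarrow> 'a set" where
  "commutator_subgroup G A B =
     generate G (\<Union>a\<in>A. \<Union>b\<in>B. {a \<otimes>\<^bsub>G\<^esub> b \<otimes>\<^bsub>G\<^esub> inv\<^bsub>G\<^esub> a \<otimes>\<^bsub>G\<^esub> inv\<^bsub>G\<^esub> b})"

lemma commutator_subgroup_self: "commutator_subgroup G H H = derived G H"
  by (simp add: commutator_subgroup_def derived_def)

definition V_sub :: "('a, 'b) monoid_scheme \<Rightarrow> 'a set \<Rightarrow> 'a set" where
  "V_sub G N = generate G {g \<in> carrier G. \<exists>\<chi>\<in>Irr_over G N. \<chi> g \<noteq> 0}"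

text \<open>The product of a family of normal subgroups is the subgroup generated by its union.\<close>

definition U_sub :: "('a, 'b) monoid_scheme \<Rightarrow> 'a set \<Rightarrow> 'a set" where
  "U_sub G N = generate G (\<Union>{H. H \<lhd> G \<and> V_sub G H \<subseteq> N})"

text \<open>The defining equation \<open>\<upsilon>\<^bsub>i+1\<^esub> / \<upsilon>\<^bsub>i\<^esub> = U(G / \<upsilon>\<^bsub>i\<^esub>)\<close> is read as: \<open>\<upsilon>\<^bsub>i+1\<^esub>\<close> is the full
  preimage in \<open>G\<close> of \<open>U(G / \<upsilon>\<^bsub>i\<^esub>)\<close>, where \<open>U(K) = U(K | Z(K))\<close>.\<close>

primrec upsilon :: "('a, 'b) monoid_scheme \<Rightarrow> nat \<Rightarrow> 'a set" where
  "upsilon G 0 = {\<one>\<^bsub>G\<^esub>}"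
| "upsilon G (Suc i) =
     {g \<in> carrier G. upsilon G i #>\<^bsub>G\<^esub> g
        \<in> U_sub (G Mod upsilon G i) (group_center (G Mod upsilon G i))}"

text \<open>The series \<open>\<epsilon>\<close> starts at index 1; the value at index 0 is a dummy.\<close>

fun epsilon :: "('a, 'b) monoid_scheme \<Rightarrow> nat \<Rightarrow> 'a set" where
  "epsilon G 0 = carrier G"
| "epsilon G (Suc 0) = carrier G"
| "epsilon G (Suc (Suc i)) =
     V_sub G (commutator_subgroup G (epsilon G (Suc i)) (carrier G))"


section \<open>Nested GVZ-groups\<close>

definition GVZ_group :: "('a, 'b) monoid_scheme \<Rightarrow> bool" where
  "GVZ_group G \<longleftrightarrow> (\<forall>\<chi>\<in>Irr G. char_van G \<chi> = char_center G \<chi>)"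

definition char_centers :: "('a, 'b) monoid_scheme \<Rightarrow> 'a set set" where
  "char_centers G = char_center G ` Irr G"

definition nested_group :: "('a, 'b) monoid_scheme \<Rightarrow> bool" where
  "nested_group G \<longleftrightarrow> chain\<^sub>\<subseteq> (char_centers G)"

definition nested_GVZ_group :: "('a, 'b) monoid_scheme \<Rightarrow> bool" where
  "nested_GVZ_group G \<longleftrightarrow> nested_group G \<and> GVZ_group G"

definition chain_of_centers ::
    "('a, 'b) monoid_scheme \<Rightarrow> (nat \<Rightarrow> 'a set) \<Rightarrow> nat \<Rightarrow> bool" where
  "chain_of_centers G C m \<longleftrightarrow>
     C 0 = carrier G \<and> (\<forall>i<m. C (Suc i) \<subset> C i) \<and> C ` {..m} = char_centers G"

definition finite_p_group :: "nat \<Rightarrow> ('a, 'b) monoid_scheme \<Rightarrow> bool" where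
  "finite_p_group p G \<longleftrightarrow> group G \<and> finite (carrier G) \<and> (\<exists>k. Coset.order G = p ^ k)"

end

theory Submission
  imports Defs "Jordan_Normal_Form.Spectral_Radius" "HOL-Algebra.Multiplicative_Group"
begin

text \<open>
  Write \<open>[g, G]\<close> for the normal subgroup generated by the commutators of \<open>g\<close> with all elements, so that the
  class of \<open>g\<close> is contained in \<open>g[g, G]\<close>. Say that the class of \<open>g\<close> absorbs a normal subgroup \<open>N\<close>
  if it contains \<open>gN\<close>. Everything in the theorem except \<open>cd(G)\<close> turns into a statement about these
  two notions, and there the proof is short.

  The bridge is the equivalence that every \<open>\<chi> \<in> Irr(G | N)\<close> vanishes at \<open>g\<close> iff the class of \<open>g\<close> absorbs \<open>N\<close>
  (\<open>Irr_over_vanishes_if_absorbs\<close>, \<open>absorbs_if_Irr_over_vanishes\<close>). It rests on Schur's lemma and on the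
  decomposition of the regular character into irreducible ones. Consequently
  \<open>V(G | N)\<close> is generated by the elements whose class does not absorb \<open>N\<close> (\<open>V_sub_eq\<close>), and \<open>U(G)\<close> consists of all
  \<open>u\<close> such that \<open>gu\<close> is conjugate to \<open>g\<close> for every noncentral \<open>g\<close> (\<open>U_sub_center_eq\<close>). Since
  \<open>Z(\<chi>) / ker \<chi>\<close> is the centre of \<open>G / ker \<chi>\<close>, an element \<open>g\<close> lies in \<open>Z(\<chi>)\<close> iff \<open>[g, G] \<le> ker \<chi>\<close>.
  Hence \<open>G\<close> is a GVZ-group iff every class is the full coset \<open>g[g, G]\<close>, and \<open>G\<close> is nested iff
  the subgroups \<open>[g, G]\<close> form a chain (\<open>nested_GVZ_iff\<close>).

  Let \<open>G\<close> be such a group, with \<open>D\<^bsub>0\<^esub> < \<dots> < D\<^bsub>m\<^esub>\<close> the distinct subgroups \<open>[g, G]\<close>; then \<open>D\<^bsub>0\<^esub> = 1\<close> and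
  \<open>D\<^bsub>m\<^esub> = [G, G]\<close>. The centres of the irreducible characters are the subgroups \<open>{g. [g, G] \<le> D\<^bsub>j\<^esub>}\<close>,
  so \<open>X\<^bsub>m-j\<^esub>\<close> is this subgroup and \<open>[G, X\<^bsub>m-j\<^esub>] = D\<^bsub>j\<^esub>\<close>. The class of \<open>g\<close> absorbs \<open>D\<^bsub>j\<^esub>\<close> iff \<open>D\<^bsub>j\<^esub> \<le> [g, G]\<close>, and
  this determines both series: \<open>\<upsilon>\<^bsub>i\<^esub> = D\<^bsub>i\<^esub>\<close> and \<open>\<epsilon>\<^bsub>i+1\<^esub> = X\<^bsub>i\<^esub>\<close> for \<open>i \<le> m\<close>, followed by \<open>\<upsilon>\<^bsub>m+1\<^esub> = G\<close> and
  \<open>\<epsilon>\<^bsub>m+2\<^esub> = 1\<close> (\<open>upsilon_eq\<close>, \<open>epsilon_eq\<close>). As \<open>\<chi>(1)\<^sup>2 = |G : Z(\<chi>)|\<close>, there are \<open>m + 1\<close> character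
  degrees (\<open>card_cd\<close>). Moreover \<open>[G, G] \<noteq> G\<close> and \<open>Z(G) \<noteq> 1\<close>, because a class containing \<open>gg\<inverse>\<close> is
  trivial; so the positions of \<open>[G, G]\<close> and \<open>Z(G)\<close> in the series determine \<open>m\<close>.

  Conversely, suppose that one of the series reaches \<open>[G, G]\<close> or \<open>1\<close>, respectively. For each \<open>g\<close>, follow the series to
  the step at which \<open>g\<close> becomes central modulo \<open>\<upsilon>\<^bsub>i\<^esub>\<close>, or at which \<open>g\<close> leaves \<open>\<epsilon>\<^bsub>i\<^esub>\<close>. The definition of the
  series makes the class of \<open>g\<close> absorb \<open>\<upsilon>\<^bsub>i\<^esub>\<close>, or \<open>[\<epsilon>\<^bsub>i\<^esub>, G]\<close>, and this subgroup then equals \<open>[g, G]\<close>. So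
  the classes are full cosets, and the subgroups \<open>[g, G]\<close> are members of a chain
  (\<open>nested_GVZ_if_upsilon\<close>, \<open>nested_GVZ_if_epsilon\<close>).
\<close>


section \<open>Matrix representations and Schur's lemma\<close>

text \<open>Homomorphisms into \<open>GL d\<close> without the record of units; invertibility of \<open>\<rho> g\<close> follows from
  the multiplicativity.\<close>
definition matrix_rep :: "('a, 'b) monoid_scheme \<Rightarrow> nat \<Rightarrow> ('a \<Rightarrow> complex mat) \<Rightarrow> bool" where
  "matrix_rep G d \<rho> \<longleftrightarrow> (\<forall>g\<in>carrier G. \<rho> g \<in> carrier_mat d d) \<and> \<rho> \<one>\<^bsub>G\<^esub> = 1\<^sub>m d \<and>
     (\<forall>g\<in>carrier G. \<forall>h\<in>carrier G. \<rho> (g \<otimes>\<^bsub>G\<^esub> h) = \<rho> g * \<rho> h)"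

lemma (in group) hom_GL_iff: "\<rho> \<in> hom G (GL d) \<longleftrightarrow> matrix_rep G d \<rho>"
proof
  interpret R: ring "ring_mat TYPE(complex) d ()" by (rule ring_mat)
  interpret U: group "GL d" unfolding GL_def by (rule R.units_group)
  assume h: "\<rho> \<in> hom G (GL d)"
  interpret H: group_hom G "GL d" \<rho>
    using h by (simp add: group_hom_def group_hom_axioms_def U.is_group is_group)
  have "\<rho> \<one> = 1\<^sub>m d"
    using H.hom_one by (simp add: GL_def units_of_def ring_mat_simps)
  moreover have "\<rho> g \<in> carrier_mat d d" if "g \<in> carrier G" for g
    using H.hom_closed[OF that] by (auto simp: GL_def units_of_def Units_def ring_mat_simps)
  moreover have "\<rho> (g \<otimes> k) = \<rho> g * \<rho> k" if "g \<in> carrier G" "k \<in> carrier G" for g k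
    using H.hom_mult[OF that] by (simp add: GL_def units_of_def ring_mat_simps)
  ultimately show "matrix_rep G d \<rho>" by (simp add: matrix_rep_def)
next
  assume m: "matrix_rep G d \<rho>"
  have "\<rho> g \<in> carrier (GL d)" if g: "g \<in> carrier G" for g
  proof -
    have "\<rho> (inv g) * \<rho> g = 1\<^sub>m d" "\<rho> g * \<rho> (inv g) = 1\<^sub>m d"
      using m g unfolding matrix_rep_def by (metis inv_closed l_inv r_inv)+
    then show ?thesis using m g
      by (auto simp: GL_def units_of_def Units_def ring_mat_simps matrix_rep_def
          intro!: bexI[of _ "\<rho> (inv g)"])
  qed
  with m show "\<rho> \<in> hom G (GL d)"
    by (auto simp: hom_def matrix_rep_def GL_def units_of_def ring_mat_simps)
qed

lemma subspace_carrier_vec_iff: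
  "VectorSpace.subspace class_ring W (module_vec TYPE(complex) d) \<longleftrightarrow>
     W \<subseteq> carrier_vec d \<and> 0\<^sub>v d \<in> W \<and> (\<forall>v\<in>W. \<forall>w\<in>W. v + w \<in> W) \<and> (\<forall>c. \<forall>v\<in>W. c \<cdot>\<^sub>v v \<in> W)"
  unfolding VectorSpace.subspace_def LinearCombinations.submodule_def
  using vec_vs[where 'a=complex, of d] vec_module[where 'a=complex, of d]
  by (auto simp: module_vec_simps class_ring_simps)

text \<open>Matrices of varying dimension form no additive monoid type, so their finite sums are taken
  entrywise with the dimension given explicitly.\<close>
definition msum :: "nat \<Rightarrow> 'i set \<Rightarrow> ('i \<Rightarrow> complex mat) \<Rightarrow> complex mat" where
  "msum d I M = mat d d (\<lambda>(i, j). \<Sum>x\<in>I. M x $$ (i, j))"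

lemma msum_carrier [simp]: "msum d I M \<in> carrier_mat d d"
  and msum_dim [simp]: "dim_row (msum d I M) = d" "dim_col (msum d I M) = d"
  and msum_index: "i < d \<Longrightarrow> j < d \<Longrightarrow> msum d I M $$ (i, j) = (\<Sum>x\<in>I. M x $$ (i, j))"
  by (auto simp: msum_def)

lemma msum_cong: "(\<And>x. x \<in> I \<Longrightarrow> M x = N x) \<Longrightarrow> msum d I M = msum d I N"
  by (simp add: msum_def)

lemma msum_reindex: "bij_betw f I J \<Longrightarrow> msum d J M = msum d I (\<lambda>x. M (f x))"
  by (rule eq_matI) (auto simp: msum_index sum.reindex_bij_betw[of f I J "\<lambda>x. M x $$ (_, _)"])

lemma mult_mat_index:
  "A \<in> carrier_mat d d \<Longrightarrow> B \<in> carrier_mat d d \<Longrightarrow> i < d \<Longrightarrow> j < d \<Longrightarrow>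
   (A * B) $$ (i, j) = (\<Sum>l<d. A $$ (i, l) * B $$ (l, j))" for A B :: "'a :: semiring_0 mat"
  by (auto simp: scalar_prod_def lessThan_atLeast0 intro!: sum.cong)

lemma mult_msum:
  assumes "A \<in> carrier_mat d d" "\<And>x. x \<in> I \<Longrightarrow> M x \<in> carrier_mat d d"
  shows "A * msum d I M = msum d I (\<lambda>x. A * M x)"
proof (rule eq_matI)
  fix i j assume "i < dim_row (msum d I (\<lambda>x. A * M x))" "j < dim_col (msum d I (\<lambda>x. A * M x))"
  then have ij: "i < d" "j < d" by auto
  have "(A * msum d I M) $$ (i, j) = (\<Sum>l<d. \<Sum>x\<in>I. A $$ (i, l) * M x $$ (l, j))"
    using assms ij by (simp add: mult_mat_index[of _ d] msum_index sum_distrib_left del: index_mult_mat(1))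
  also have "\<dots> = (\<Sum>x\<in>I. \<Sum>l<d. A $$ (i, l) * M x $$ (l, j))" by (rule sum.swap)
  also have "\<dots> = msum d I (\<lambda>x. A * M x) $$ (i, j)"
    using assms ij by (simp add: msum_index mult_mat_index[of _ d] del: index_mult_mat(1))
  finally show "(A * msum d I M) $$ (i, j) = msum d I (\<lambda>x. A * M x) $$ (i, j)" .
qed (use assms in auto)

lemma msum_mult:
  assumes "A \<in> carrier_mat d d" "\<And>x. x \<in> I \<Longrightarrow> M x \<in> carrier_mat d d"
  shows "msum d I M * A = msum d I (\<lambda>x. M x * A)"
proof (rule eq_matI)
  fix i j assume "i < dim_row (msum d I (\<lambda>x. M x * A))" "j < dim_col (msum d I (\<lambda>x. M x * A))"
  then have ij: "i < d" "j < d" by auto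
  have "(msum d I M * A) $$ (i, j) = (\<Sum>l<d. \<Sum>x\<in>I. M x $$ (i, l) * A $$ (l, j))"
    using assms ij by (simp add: mult_mat_index[of _ d] msum_index sum_distrib_right del: index_mult_mat(1))
  also have "\<dots> = (\<Sum>x\<in>I. \<Sum>l<d. M x $$ (i, l) * A $$ (l, j))" by (rule sum.swap)
  also have "\<dots> = msum d I (\<lambda>x. M x * A) $$ (i, j)"
    using assms ij by (simp add: msum_index mult_mat_index[of _ d] del: index_mult_mat(1))
  finally show "(msum d I M * A) $$ (i, j) = msum d I (\<lambda>x. M x * A) $$ (i, j)" .
qed (use assms in auto)

lemma mat_trace_eq: "A \<in> carrier_mat d d \<Longrightarrow> mat_trace A = (\<Sum>i<d. A $$ (i, i))"
  by (auto simp: mat_trace_def)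

lemma mat_trace_msum:
  assumes "\<And>x. x \<in> I \<Longrightarrow> M x \<in> carrier_mat d d"
  shows "mat_trace (msum d I M) = (\<Sum>x\<in>I. mat_trace (M x))"
proof -
  have "mat_trace (msum d I M) = (\<Sum>i<d. \<Sum>x\<in>I. M x $$ (i, i))"
    by (simp add: mat_trace_eq[of _ d] msum_index)
  also have "\<dots> = (\<Sum>x\<in>I. \<Sum>i<d. M x $$ (i, i))" by (rule sum.swap)
  also have "\<dots> = (\<Sum>x\<in>I. mat_trace (M x))"
    using assms by (intro sum.cong) (auto simp: mat_trace_eq[of _ d])
  finally show ?thesis .
qed

lemma mat_trace_mult_comm:
  assumes "A \<in> carrier_mat d d" "B \<in> carrier_mat d d"
  shows "mat_trace (A * B) = mat_trace (B * A)"
proof -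
  have "mat_trace (A * B) = (\<Sum>i<d. \<Sum>l<d. A $$ (i, l) * B $$ (l, i))"
    using assms by (simp add: mat_trace_eq[of _ d] mult_mat_index[of _ d] del: index_mult_mat(1))
  also have "\<dots> = (\<Sum>l<d. \<Sum>i<d. B $$ (l, i) * A $$ (i, l))"
    by (subst sum.swap) (simp add: mult.commute)
  also have "\<dots> = mat_trace (B * A)"
    using assms by (simp add: mat_trace_eq[of _ d] mult_mat_index[of _ d] del: index_mult_mat(1))
  finally show ?thesis .
qed

lemma mat_trace_similar:
  assumes "P \<in> carrier_mat d d" "Q \<in> carrier_mat d d" "A \<in> carrier_mat d d" "P * Q = 1\<^sub>m d"
  shows "mat_trace (Q * A * P) = mat_trace A"
proof -
  have "mat_trace (Q * A * P) = mat_trace (P * (Q * A))"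
    using assms by (intro mat_trace_mult_comm) auto
  also have "P * (Q * A) = A"
    using assms(4) by (simp flip: assoc_mult_mat[OF assms(1,2,3)] add: left_mult_one_mat[OF assms(3)])
  finally show ?thesis .
qed

lemma mat_trace_smult_one [simp]: "mat_trace (c \<cdot>\<^sub>m 1\<^sub>m d) = c * of_nat d"
  by (simp add: mat_trace_def)

lemma mat_trace_one [simp]: "mat_trace (1\<^sub>m d) = of_nat d"
  by (simp add: mat_trace_def)

lemma mat_eqI_vec:
  fixes A B :: "complex mat"
  assumes "A \<in> carrier_mat d d" "B \<in> carrier_mat d d"
    "\<And>v. v \<in> carrier_vec d \<Longrightarrow> A *\<^sub>v v = B *\<^sub>v v"
  shows "A = B"
proof (rule eq_matI)
  fix i j assume "i < dim_row B" "j < dim_col B"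
  then have ij: "i < d" "j < d" using assms by auto
  have "(A *\<^sub>v unit_vec d j) $ i = (B *\<^sub>v unit_vec d j) $ i" using assms(3)[of "unit_vec d j"] by simp
  then show "A $$ (i, j) = B $$ (i, j)" using assms(1,2) ij
    by (simp add: index_mult_mat_vec scalar_prod_right_unit)
qed (use assms in auto)

lemma (in group) irreducible_repD:
  assumes "irreducible_rep G d \<rho>"
  shows "matrix_rep G d \<rho>" "0 < d"
    "\<lbrakk>W \<subseteq> carrier_vec d; 0\<^sub>v d \<in> W; \<And>v w. v \<in> W \<Longrightarrow> w \<in> W \<Longrightarrow> v + w \<in> W; \<And>c v. v \<in> W \<Longrightarrow> c \<cdot>\<^sub>v v \<in> W;
      \<And>g w. g \<in> carrier G \<Longrightarrow> w \<in> W \<Longrightarrow> \<rho> g *\<^sub>v w \<in> W; w \<in> W; w \<noteq> 0\<^sub>v d\<rbrakk> \<Longrightarrow> W = carrier_vec d"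
proof -
  show "matrix_rep G d \<rho>" "0 < d" using assms by (simp_all add: irreducible_rep_def hom_GL_iff)
  assume W: "W \<subseteq> carrier_vec d" "0\<^sub>v d \<in> W" "\<And>v w. v \<in> W \<Longrightarrow> w \<in> W \<Longrightarrow> v + w \<in> W"
    "\<And>c v. v \<in> W \<Longrightarrow> c \<cdot>\<^sub>v v \<in> W" "\<And>g w. g \<in> carrier G \<Longrightarrow> w \<in> W \<Longrightarrow> \<rho> g *\<^sub>v w \<in> W"
    and w: "w \<in> W" "w \<noteq> 0\<^sub>v d"
  have "VectorSpace.subspace class_ring W (module_vec TYPE(complex) d)"
    unfolding subspace_carrier_vec_iff using W(1-4) by blast
  then have "W = {0\<^sub>v d} \<or> W = carrier_vec d"
    using assms W(5) unfolding irreducible_rep_def by blast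
  then show "W = carrier_vec d" using w by blast
qed

lemma smult_one_mult_vec:
  fixes v :: "complex vec"
  assumes v: "v \<in> carrier_vec d"
  shows "(c \<cdot>\<^sub>m 1\<^sub>m d) *\<^sub>v v = c \<cdot>\<^sub>v v"
proof (rule eq_vecI)
  fix i assume "i < dim_vec (c \<cdot>\<^sub>v v)"
  then have i: "i < d" using v by auto
  have "row (1\<^sub>m d) i \<bullet> v = v $ i" using i v by (metis index_mult_mat_vec index_one_mat(2) one_mult_mat_vec)
  moreover have "row (c \<cdot>\<^sub>m 1\<^sub>m d) i = c \<cdot>\<^sub>v row (1\<^sub>m d) i" using i by (simp only: row_smult index_one_mat)
  ultimately show "((c \<cdot>\<^sub>m 1\<^sub>m d) *\<^sub>v v) $ i = (c \<cdot>\<^sub>v v) $ i"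
    using i v by (simp add: smult_scalar_prod_distrib[of _ d])
qed (use v in auto)

text \<open>An eigenspace of an operator that commutes with the representation is an invariant subspace,
  so by irreducibility it is the whole space; eigenvalues exist over the complex numbers.\<close>
lemma (in group) schur_lemma:
  assumes irr: "irreducible_rep G d \<rho>" and T: "T \<in> carrier_mat d d"
    and comm: "\<And>g. g \<in> carrier G \<Longrightarrow> T * \<rho> g = \<rho> g * T"
  obtains c where "T = c \<cdot>\<^sub>m 1\<^sub>m d"
proof -
  note \<rho> = irreducible_repD[OF irr]
  obtain c where "eigenvalue T c"
    using spectrum_non_empty[OF T \<rho>(2)] by (auto simp: spectrum_def)
  then obtain v where v: "v \<in> carrier_vec d" "v \<noteq> 0\<^sub>v d" "T *\<^sub>v v = c \<cdot>\<^sub>v v"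
    using T by (auto simp: eigenvalue_def eigenvector_def)
  define W where "W = {v \<in> carrier_vec d. T *\<^sub>v v = c \<cdot>\<^sub>v v}"
  have "W = carrier_vec d"
  proof (rule \<rho>(3))
    show "W \<subseteq> carrier_vec d" "0\<^sub>v d \<in> W" "v \<in> W" "v \<noteq> 0\<^sub>v d" using v T by (auto simp: W_def)
    show "v + w \<in> W" if "v \<in> W" "w \<in> W" for v w
      using that T by (auto simp: W_def mult_add_distrib_mat_vec[OF T] smult_add_distrib_vec)
    show "k \<cdot>\<^sub>v v \<in> W" if "v \<in> W" for k v
      using that T by (auto simp: W_def mult_mat_vec[OF T] smult_smult_assoc mult.commute)
    show "\<rho> g *\<^sub>v w \<in> W" if g: "g \<in> carrier G" and w: "w \<in> W" for g w
    proof -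
      have R: "\<rho> g \<in> carrier_mat d d" using \<rho>(1) g by (simp add: matrix_rep_def)
      have w': "w \<in> carrier_vec d" "T *\<^sub>v w = c \<cdot>\<^sub>v w" using w by (auto simp: W_def)
      have "T *\<^sub>v (\<rho> g *\<^sub>v w) = (T * \<rho> g) *\<^sub>v w" using T R w' by simp
      also have "\<dots> = \<rho> g *\<^sub>v (T *\<^sub>v w)" using T R w' by (simp add: comm[OF g])
      also have "\<dots> = c \<cdot>\<^sub>v (\<rho> g *\<^sub>v w)" using R w' by (simp add: mult_mat_vec[OF R])
      finally show ?thesis using R w' by (auto simp: W_def)
    qed
  qed
  then have "T = c \<cdot>\<^sub>m 1\<^sub>m d"
    by (intro mat_eqI_vec[OF T]) (auto simp: W_def smult_one_mult_vec)
  then show thesis by (rule that)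
qed

section \<open>Matrices of finite order and adapted bases\<close>

lemma inverse_matrix_exists:
  fixes A :: "complex mat"
  assumes "A \<in> carrier_mat d d" "det A \<noteq> 0"
  obtains B where "B \<in> carrier_mat d d" "A * B = 1\<^sub>m d" "B * A = 1\<^sub>m d"
  using det_non_zero_imp_unit[OF assms, of "()"] by (auto simp: Units_def ring_mat_simps)

lemma upper_triangular_mult:
  fixes A B :: "complex mat"
  assumes "A \<in> carrier_mat d d" "B \<in> carrier_mat d d" "upper_triangular A" "upper_triangular B"
  shows "upper_triangular (A * B)" "i < d \<Longrightarrow> (A * B) $$ (i, i) = A $$ (i, i) * B $$ (i, i)"
proof -
  have A0: "A $$ (i, j) = 0" if "j < i" "i < d" for i j using assms that by auto
  have B0: "B $$ (i, j) = 0" if "j < i" "i < d" for i j using assms that by auto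
  show "upper_triangular (A * B)"
  proof (rule upper_triangularI)
    fix i j assume ji: "j < i" and "i < dim_row (A * B)"
    then have i: "i < d" "j < d" using assms by auto
    have "(A * B) $$ (i, j) = (\<Sum>l<d. A $$ (i, l) * B $$ (l, j))"
      using assms i by (intro mult_mat_index) auto
    also have "\<dots> = 0"
    proof (rule sum.neutral, intro ballI)
      fix l assume l: "l \<in> {..<d}"
      show "A $$ (i, l) * B $$ (l, j) = 0"
      proof (cases "l < i")
        case True then show ?thesis using A0 i by simp
      next
        case False then have "j < l" using ji by simp
        then show ?thesis using B0 l by simp
      qed
    qed
    finally show "(A * B) $$ (i, j) = 0" .
  qed
  assume i: "i < d"
  have "(A * B) $$ (i, i) = (\<Sum>l<d. A $$ (i, l) * B $$ (l, i))"
    using assms i by (intro mult_mat_index) auto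
  also have "\<dots> = (\<Sum>l\<in>{i}. A $$ (i, l) * B $$ (l, i))"
  proof (rule sum.mono_neutral_right)
    show "\<forall>l\<in>{..<d} - {i}. A $$ (i, l) * B $$ (l, i) = 0"
    proof
      fix l assume l: "l \<in> {..<d} - {i}"
      show "A $$ (i, l) * B $$ (l, i) = 0"
      proof (cases "l < i")
        case True then show ?thesis using A0 i by simp
      next
        case False then have "i < l" using l by simp
        then show ?thesis using B0 l by simp
      qed
    qed
  qed (use i in auto)
  finally show "(A * B) $$ (i, i) = A $$ (i, i) * B $$ (i, i)" by simp
qed

lemma upper_triangular_pow:
  fixes A :: "complex mat"
  assumes A: "A \<in> carrier_mat d d" "upper_triangular A"
  shows "upper_triangular (A ^\<^sub>m k) \<and> (\<forall>i<d. (A ^\<^sub>m k) $$ (i, i) = (A $$ (i, i)) ^ k)"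
proof (induction k)
  case 0
  then show ?case using A by auto
next
  case (Suc k)
  have c: "A ^\<^sub>m k \<in> carrier_mat d d" using A by simp
  show ?case
    using upper_triangular_mult[OF c A(1)] A Suc.IH by (auto simp: mult.commute simp del: index_mult_mat(1))
qed

text \<open>Equality case of the triangle inequality: after rotating the sum to the positive real axis,
  every summand must have real part 1.\<close>
lemma unit_sum_maximal:
  fixes b :: "'i \<Rightarrow> complex"
  assumes fin: "finite I" and ne: "I \<noteq> {}" and unit: "\<And>i. i \<in> I \<Longrightarrow> cmod (b i) = 1"
    and max: "cmod (\<Sum>i\<in>I. b i) = card I"
  obtains u where "\<And>i. i \<in> I \<Longrightarrow> b i = u"
proof -
  define s where "s = (\<Sum>i\<in>I. b i)"
  define u where "u = s / of_real (cmod s)"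
  have pos: "cmod s > 0" using max fin ne by (simp add: s_def card_gt_0_iff)
  have "cmod u = 1" using pos by (simp add: u_def norm_divide)
  have uu: "u * cnj u = 1" using \<open>cmod u = 1\<close> by (metis complex_norm_square of_real_1 one_power2)
  have "s * cnj u = of_real (cmod s)"
    using pos by (simp add: u_def complex_norm_square[symmetric] power2_eq_square)
  then have "Re (s * cnj u) = card I" using max by (simp add: s_def)
  then have sum1: "(\<Sum>i\<in>I. 1 - Re (b i * cnj u)) = 0"
    by (simp add: s_def sum_distrib_right sum_subtractf del: times_complex.sel)
  have norm1: "cmod (b i * cnj u) = 1" if "i \<in> I" for i
    using unit[OF that] \<open>cmod u = 1\<close> by (simp add: norm_mult)
  have "0 \<le> 1 - Re (b i * cnj u)" if "i \<in> I" for i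
    using complex_Re_le_cmod[of "b i * cnj u"] norm1[OF that] by linarith
  then have all: "\<forall>i\<in>I. 1 - Re (b i * cnj u) = 0"
    using sum_nonneg_eq_0_iff[OF fin, of "\<lambda>i. 1 - Re (b i * cnj u)"] sum1 by blast
  have "b i = u" if i: "i \<in> I" for i
  proof -
    define z where "z = b i * cnj u"
    have "Re z = 1" using all i by (simp add: z_def)
    moreover have "(Re z)\<^sup>2 + (Im z)\<^sup>2 = 1" using norm1[OF i] by (simp add: z_def[symmetric] cmod_def)
    ultimately have "z = 1" by (simp add: complex_eq_iff)
    have "b i = z * u" using uu by (simp add: z_def mult.assoc mult.commute)
    with \<open>z = 1\<close> show ?thesis by simp
  qed
  then show thesis by (rule that)
qed

text \<open>Pass to a triangular form \<open>B\<close>. Its diagonal entries are roots of unity, so maximality of the trace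
  makes them all equal to one \<open>c\<close>. The geometric sum \<open>S = (\<Sum>j<k. (B / c)\<^sup>j)\<close> satisfies \<open>S * B = c S\<close>
  because \<open>(B / c)\<^sup>k = 1\<close>, and it is invertible because it is triangular with all diagonal entries \<open>k\<close>.
  Hence \<open>B\<close>, and with it \<open>A\<close>, is scalar.\<close>
lemma finite_order_maximal_trace_scalar:
  fixes A :: "complex mat"
  assumes A: "A \<in> carrier_mat d d" and d: "0 < d" and k: "0 < k" "A ^\<^sub>m k = 1\<^sub>m d"
    and tr: "cmod (mat_trace A) = d"
  obtains c where "A = c \<cdot>\<^sub>m 1\<^sub>m d" "c ^ k = 1"
proof -
  obtain es where es: "char_poly A = (\<Prod>e\<leftarrow>es. [:- e, 1:])" using char_poly_factorized[OF A] by blast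
  obtain B P Q where s: "schur_decomposition A es = (B, P, Q)" by (cases "schur_decomposition A es") auto
  have sw: "similar_mat_wit A B P Q" and ut: "upper_triangular B"
    using schur_decomposition[OF A es s] by auto
  note w = similar_mat_witD2[OF A sw]
  have Bk: "B ^\<^sub>m k = 1\<^sub>m d"
  proof -
    have "similar_mat_wit (1\<^sub>m d) (B ^\<^sub>m k) P Q" using similar_mat_wit_pow[OF sw, of k] k by simp
    from similar_mat_witD2[OF one_carrier_mat this]
    have q: "1\<^sub>m d = P * B ^\<^sub>m k * Q" "Q * P = 1\<^sub>m d" "B ^\<^sub>m k \<in> carrier_mat d d"
      "P \<in> carrier_mat d d" "Q \<in> carrier_mat d d" by auto
    have "1\<^sub>m d = Q * 1\<^sub>m d * P" using q(2,4,5) by simp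
    also have "\<dots> = Q * (P * B ^\<^sub>m k * Q) * P" by (simp only: q(1)[symmetric])
    also have "\<dots> = (Q * P) * B ^\<^sub>m k * (Q * P)"
      using q(3-5) by (simp add: assoc_mult_mat[of _ d d _ d _ d])
    also have "\<dots> = B ^\<^sub>m k" by (simp only: q(2) left_mult_one_mat[OF q(3)] right_mult_one_mat[OF q(3)])
    finally show ?thesis ..
  qed
  have trB: "mat_trace A = (\<Sum>i<d. B $$ (i, i))"
  proof -
    have "mat_trace A = mat_trace B"
      using mat_trace_similar[of Q d P B] w by simp
    then show ?thesis using w by (simp add: mat_trace_eq[of _ d])
  qed
  have root: "(B $$ (i, i)) ^ k = 1" if "i < d" for i
    using upper_triangular_pow[OF w(5) ut, of k] Bk that by auto
  have "cmod (B $$ (i, i)) = 1" if "i < d" for i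
    using power_eq_1_iff[OF root[OF that]] k(1) by auto
  then obtain c where c: "\<And>i. i < d \<Longrightarrow> B $$ (i, i) = c"
    using unit_sum_maximal[of "{..<d}" "\<lambda>i. B $$ (i, i)"] tr trB d by auto
  have ck: "c ^ k = 1" using root[OF d] c[OF d] by simp
  have c0: "c \<noteq> 0" using ck k(1) by (metis power_eq_0_iff zero_neq_one power_0_left)
  define S where "S = msum d {..<k} (\<lambda>j. inverse c ^ j \<cdot>\<^sub>m B ^\<^sub>m j)"
  have S: "S \<in> carrier_mat d d" by (simp add: S_def)
  have Bj: "B ^\<^sub>m j \<in> carrier_mat d d" for j using w by simp
  have S_ij: "S $$ (a, b) = (\<Sum>j<k. inverse c ^ j * (B ^\<^sub>m j) $$ (a, b))" if "a < d" "b < d" for a b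
    using that carrier_matD[OF w(5)] by (simp add: S_def msum_index)
  have "S * B = c \<cdot>\<^sub>m S"
  proof (rule eq_matI)
    fix a b assume "a < dim_row (c \<cdot>\<^sub>m S)" "b < dim_col (c \<cdot>\<^sub>m S)"
    then have ab: "a < d" "b < d" using S by auto
    define f where "f = (\<lambda>j. inverse c ^ j * (B ^\<^sub>m j) $$ (a, b))"
    have "S * B = msum d {..<k} (\<lambda>j. (inverse c ^ j \<cdot>\<^sub>m B ^\<^sub>m j) * B)"
      unfolding S_def using w Bj by (intro msum_mult) auto
    also have "\<dots> = msum d {..<k} (\<lambda>j. inverse c ^ j \<cdot>\<^sub>m B ^\<^sub>m Suc j)"
      using w Bj by (intro msum_cong) (simp add: mult_smult_assoc_mat[of _ d d _ d])
    finally have "(S * B) $$ (a, b) = (\<Sum>j<k. inverse c ^ j * (B ^\<^sub>m Suc j) $$ (a, b))"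
      using ab carrier_matD[OF w(5)] by (simp add: msum_index del: index_mult_mat(1) pow_mat.simps)
    also have "\<dots> = (\<Sum>j<k. c * f (Suc j))"
    proof (rule sum.cong[OF refl])
      fix j
      have "c * (inverse c ^ Suc j * z) = inverse c ^ j * z" for z :: complex
        using c0 by (simp flip: mult.assoc)
      then show "inverse c ^ j * (B ^\<^sub>m Suc j) $$ (a, b) = c * f (Suc j)" by (simp only: f_def)
    qed
    also have "\<dots> = c * (\<Sum>j<k. f (Suc j))" by (simp add: sum_distrib_left)
    also have "(\<Sum>j<k. f (Suc j)) = (\<Sum>j<k. f j)"
    proof -
      have "f 0 = f k" using Bk ck w by (simp add: f_def power_inverse)
      moreover have "(\<Sum>j<k. f (Suc j)) + f 0 = (\<Sum>j<k. f j) + f k"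
        by (metis sum.lessThan_Suc sum.lessThan_Suc_shift add.commute)
      ultimately show ?thesis by simp
    qed
    finally show "(S * B) $$ (a, b) = (c \<cdot>\<^sub>m S) $$ (a, b)" using S_ij ab S by (simp add: f_def)
  qed (use S w in auto)
  moreover obtain R where R: "R \<in> carrier_mat d d" "R * S = 1\<^sub>m d"
  proof -
    have utS: "upper_triangular S"
    proof (rule upper_triangularI)
      fix i j assume "j < i" "i < dim_row S"
      then have ij: "j < i" "i < d" "j < d" using S by auto
      have "(B ^\<^sub>m l) $$ (i, j) = 0" for l
        using upper_triangular_pow[OF w(5) ut, of l] ij Bj[of l] by (auto dest!: upper_triangularD)
      then show "S $$ (i, j) = 0" using S_ij ij by simp
    qed
    have "S $$ (i, i) = of_nat k" if "i < d" for i
    proof -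
      have "(B ^\<^sub>m j) $$ (i, i) = c ^ j" for j
        using upper_triangular_pow[OF w(5) ut, of j] that c by simp
      then show ?thesis using S_ij that c0 by (simp add: power_inverse)
    qed
    then have "det S \<noteq> 0"
      using det_upper_triangular[OF utS S] S k(1) by (auto simp: diag_mat_def prod_list_zero_iff)
    then show thesis using inverse_matrix_exists[OF S] that by blast
  qed
  ultimately have "B = c \<cdot>\<^sub>m 1\<^sub>m d"
  proof -
    have "B = (R * S) * B" by (simp only: R(2) left_mult_one_mat[OF w(5)])
    also have "\<dots> = R * (S * B)" by (rule assoc_mult_mat[OF R(1) S w(5)])
    also have "\<dots> = c \<cdot>\<^sub>m (R * S)" by (simp only: \<open>S * B = _\<close> mult_smult_distrib[OF R(1) S])
    finally show ?thesis by (simp only: R(2))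
  qed
  then have "A = P * (c \<cdot>\<^sub>m 1\<^sub>m d) * Q" using w by simp
  also have "\<dots> = c \<cdot>\<^sub>m (P * Q)"
    using w by (simp add: mult_smult_distrib[of _ d d _ d] mult_smult_assoc_mat[of _ d d _ d])
  finally show thesis using w ck that by simp
qed

text \<open>A basis of the whole space that contains a basis of \<open>W\<close>, as the columns of \<open>P\<close>. Take an
  invertible \<open>P\<close> with as many columns in \<open>W\<close> as possible. If some \<open>w \<in> W\<close> had a nonzero coordinate at a
  column outside \<open>W\<close>, then by Cramer's rule that column could be replaced by \<open>w\<close> without losing
  invertibility, against the maximality.\<close>
lemma adapted_basis:
  fixes W :: "complex vec set"
  assumes W: "W \<subseteq> carrier_vec d"
  obtains P Q J where "P \<in> carrier_mat d d" "Q \<in> carrier_mat d d" "P * Q = 1\<^sub>m d" "Q * P = 1\<^sub>m d"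
    "J \<subseteq> {..<d}" "\<And>j. j \<in> J \<Longrightarrow> col P j \<in> W"
    "\<And>w j. w \<in> W \<Longrightarrow> j < d \<Longrightarrow> j \<notin> J \<Longrightarrow> (Q *\<^sub>v w) $ j = 0"
proof -
  define J where "J P = {j. j < d \<and> col P j \<in> W}" for P
  have finJ: "finite (J P)" for P by (simp add: J_def)
  have "card (J P) \<le> d" for P
    using card_mono[of "{..<d}" "J P"] by (auto simp: J_def)
  then obtain P where P: "P \<in> carrier_mat d d" "det P \<noteq> 0"
    and max: "\<And>P'. P' \<in> carrier_mat d d \<Longrightarrow> det P' \<noteq> 0 \<Longrightarrow> card (J P') \<le> card (J P)"
    using ex_has_greatest_nat[of "\<lambda>P. P \<in> carrier_mat d d \<and> det P \<noteq> 0" "1\<^sub>m d" "\<lambda>P. card (J P)" "Suc d"]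
    by (auto simp: less_Suc_eq_le)
  obtain Q where Q: "Q \<in> carrier_mat d d" "P * Q = 1\<^sub>m d" "Q * P = 1\<^sub>m d"
    using inverse_matrix_exists[OF P] .
  have "(Q *\<^sub>v w) $ j = 0" if w: "w \<in> W" and j: "j < d" "j \<notin> J P" for w j
  proof (rule ccontr)
    assume nz: "(Q *\<^sub>v w) $ j \<noteq> 0"
    define P' where "P' = replace_col P w j"
    have wc: "w \<in> carrier_vec d" using w W by auto
    have PQ: "P *\<^sub>v (Q *\<^sub>v w) = w"
      using P Q wc by (metis assoc_mult_mat_vec one_mult_mat_vec)
    have "det P' = (Q *\<^sub>v w) $ j * det P"
      using cramer_lemma_mat[OF P(1), of "Q *\<^sub>v w" j] Q wc j PQ by (simp add: P'_def)
    then have "det P' \<noteq> 0" using nz P by simp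
    moreover have P': "P' \<in> carrier_mat d d" using P by (auto simp: P'_def replace_col_def)
    ultimately have le: "card (J P') \<le> card (J P)" using max by blast
    have "col P' j = w" using P wc j by (intro eq_vecI) (auto simp: P'_def replace_col_def)
    moreover have "col P' i = col P i" if "i < d" "i \<noteq> j" for i
      using P that by (intro eq_vecI) (auto simp: P'_def replace_col_def)
    moreover have "i \<in> J P'" if "i \<in> insert j (J P)" for i
    proof (cases "i = j")
      case True
      then show ?thesis using \<open>col P' j = w\<close> w j by (simp add: J_def)
    next
      case False
      then have "i < d" "col P i \<in> W" using that by (simp_all add: J_def)
      then show ?thesis using False \<open>\<And>i. i < d \<Longrightarrow> i \<noteq> j \<Longrightarrow> col P' i = col P i\<close>[of i] by (simp add: J_def)
    qed
    ultimately have "insert j (J P) \<subseteq> J P'" by blast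
    then have "card (insert j (J P)) \<le> card (J P')" using finJ card_mono by blast
    then show False using le j finJ by simp
  qed
  moreover have "J P \<subseteq> {..<d}" "\<And>j. j \<in> J P \<Longrightarrow> col P j \<in> W" by (auto simp: J_def)
  ultimately show thesis using that[OF P(1) Q] by blast
qed

lemma mult_mat_vec_in_subspace:
  fixes P :: "complex mat"
  assumes P: "P \<in> carrier_mat d d" and cols: "\<And>j. j < d \<Longrightarrow> col P j \<in> W" and W0: "0\<^sub>v d \<in> W"
    and add: "\<And>v w. v \<in> W \<Longrightarrow> w \<in> W \<Longrightarrow> v + w \<in> W" and smult: "\<And>c v. v \<in> W \<Longrightarrow> c \<cdot>\<^sub>v v \<in> W"
    and x: "x \<in> carrier_vec d"
  shows "P *\<^sub>v x \<in> W"
proof -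
  have "P *\<^sub>v vec d (\<lambda>i. if i < n then x $ i else 0) \<in> W" if "n \<le> d" for n
    using that
  proof (induction n)
    case 0
    have "P *\<^sub>v vec d (\<lambda>i. 0) = 0\<^sub>v d"
      using P by (intro eq_vecI) (auto simp: scalar_prod_def)
    then show ?case using W0 by simp
  next
    case (Suc n)
    have "P *\<^sub>v vec d (\<lambda>i. if i < Suc n then x $ i else 0)
        = P *\<^sub>v vec d (\<lambda>i. if i < n then x $ i else 0) + x $ n \<cdot>\<^sub>v col P n"
    proof (rule eq_vecI)
      fix i assume "i < dim_vec (P *\<^sub>v vec d (\<lambda>i. if i < n then x $ i else 0) + x $ n \<cdot>\<^sub>v col P n)"
      then have i: "i < d" using P by auto
      have "(\<Sum>l<d. P $$ (i, l) * (if l < Suc n then x $ l else 0))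
          = (\<Sum>l<d. P $$ (i, l) * (if l < n then x $ l else 0) + (if l = n then P $$ (i, n) * x $ n else 0))"
        by (rule sum.cong) auto
      also have "\<dots> = (\<Sum>l<d. P $$ (i, l) * (if l < n then x $ l else 0)) + x $ n * P $$ (i, n)"
        using Suc.prems by (simp add: sum.distrib)
      finally show "(P *\<^sub>v vec d (\<lambda>i. if i < Suc n then x $ i else 0)) $ i
          = (P *\<^sub>v vec d (\<lambda>i. if i < n then x $ i else 0) + x $ n \<cdot>\<^sub>v col P n) $ i"
        using i P Suc.prems by (simp add: scalar_prod_def lessThan_atLeast0)
    qed (use P in auto)
    then show ?case using Suc cols[of n] add smult by simp
  qed
  from this[of d] have "P *\<^sub>v vec d (\<lambda>i. if i < d then x $ i else 0) \<in> W" by simp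
  moreover have "vec d (\<lambda>i. if i < d then x $ i else 0) = x" using x by (intro eq_vecI) auto
  ultimately show ?thesis by simp
qed

section \<open>The regular character\<close>

lemma matrix_repD:
  assumes "matrix_rep G d \<rho>"
  shows "g \<in> carrier G \<Longrightarrow> \<rho> g \<in> carrier_mat d d" "\<rho> \<one>\<^bsub>G\<^esub> = 1\<^sub>m d"
    "g \<in> carrier G \<Longrightarrow> h \<in> carrier G \<Longrightarrow> \<rho> (g \<otimes>\<^bsub>G\<^esub> h) = \<rho> g * \<rho> h"
  using assms by (auto simp: matrix_rep_def)

lemma matrix_rep_conjugate:
  assumes r: "matrix_rep G d \<rho>" and PQ: "P \<in> carrier_mat d d" "Q \<in> carrier_mat d d" "P * Q = 1\<^sub>m d" "Q * P = 1\<^sub>m d"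
  shows "matrix_rep G d (\<lambda>g. Q * \<rho> g * P)"
  unfolding matrix_rep_def
proof (intro conjI ballI)
  show "Q * \<rho> g * P \<in> carrier_mat d d" if "g \<in> carrier G" for g using PQ matrix_repD[OF r] that by auto
  show "Q * \<rho> \<one>\<^bsub>G\<^esub> * P = 1\<^sub>m d" using PQ matrix_repD[OF r] by simp
  fix g h assume gh: "g \<in> carrier G" "h \<in> carrier G"
  note c = matrix_repD(1)[OF r gh(1)] matrix_repD(1)[OF r gh(2)]
  have "Q * \<rho> g * P * (Q * \<rho> h * P) = Q * \<rho> g * (P * Q) * \<rho> h * P"
    using PQ(1,2) c by (simp add: assoc_mult_mat[of _ d d _ d _ d])
  also have "\<dots> = Q * (\<rho> g * \<rho> h) * P" using PQ c by (simp add: assoc_mult_mat[of _ d d _ d _ d])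
  finally show "Q * \<rho> (g \<otimes>\<^bsub>G\<^esub> h) * P = Q * \<rho> g * P * (Q * \<rho> h * P)"
    using matrix_repD(3)[OF r gh] by simp
qed

text \<open>The condition \<open>zero\<close> says that entries outside the index set \<open>K\<close> do not contribute to the \<open>K\<close>-block of a
  product. It holds for both diagonal blocks of a block triangular representation.\<close>
lemma diagonal_block_rep:
  assumes r: "matrix_rep G d M" and K: "K \<subseteq> {..<d}"
    and zero: "\<And>g h i j l. \<lbrakk>g \<in> carrier G; h \<in> carrier G; i \<in> K; j \<in> K; l < d; l \<notin> K\<rbrakk>
      \<Longrightarrow> M g $$ (i, l) * M h $$ (l, j) = 0"
    and one: "\<one>\<^bsub>G\<^esub> \<in> carrier G"
  obtains \<sigma> where "matrix_rep G (card K) \<sigma>"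
    "\<And>g. g \<in> carrier G \<Longrightarrow> mat_trace (\<sigma> g) = (\<Sum>i\<in>K. M g $$ (i, i))"
proof -
  have finK: "finite K" using K finite_subset by blast
  define k where "k = card K"
  obtain e where e: "bij_betw e {..<k} K"
    using ex_bij_betw_nat_finite[OF finK] by (auto simp: k_def lessThan_atLeast0)
  have eK: "e a \<in> K" "e a < d" if "a < k" for a
    using e that K by (auto simp: bij_betw_def)
  define \<sigma> where "\<sigma> g = mat k k (\<lambda>(a, b). M g $$ (e a, e b))" for g
  have c: "\<sigma> g \<in> carrier_mat k k" for g by (simp add: \<sigma>_def)
  have "matrix_rep G k \<sigma>"
    unfolding matrix_rep_def
  proof (intro conjI ballI)
    show "\<sigma> g \<in> carrier_mat k k" for g by (rule c)
    show "\<sigma> \<one>\<^bsub>G\<^esub> = 1\<^sub>m k"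
    proof (rule eq_matI)
      fix a b assume "a < dim_row (1\<^sub>m k :: complex mat)" "b < dim_col (1\<^sub>m k :: complex mat)"
      then have ab: "a < k" "b < k" by auto
      have "e a = e b \<longleftrightarrow> a = b" using e ab by (auto simp: bij_betw_def inj_on_def)
      then show "\<sigma> \<one>\<^bsub>G\<^esub> $$ (a, b) = 1\<^sub>m k $$ (a, b)"
        using ab eK by (simp add: \<sigma>_def matrix_repD(2)[OF r])
    qed (auto simp: \<sigma>_def)
    fix g h assume gh: "g \<in> carrier G" "h \<in> carrier G"
    show "\<sigma> (g \<otimes>\<^bsub>G\<^esub> h) = \<sigma> g * \<sigma> h"
    proof (rule eq_matI)
      fix a b assume "a < dim_row (\<sigma> g * \<sigma> h)" "b < dim_col (\<sigma> g * \<sigma> h)"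
      then have ab: "a < k" "b < k" by (auto simp: \<sigma>_def)
      have "(\<sigma> g * \<sigma> h) $$ (a, b) = (\<Sum>l<k. M g $$ (e a, e l) * M h $$ (e l, e b))"
        using ab by (subst mult_mat_index[OF c c]) (auto simp: \<sigma>_def)
      also have "\<dots> = (\<Sum>l\<in>K. M g $$ (e a, l) * M h $$ (l, e b))"
        by (rule sum.reindex_bij_betw[OF e, of "\<lambda>l. M g $$ (e a, l) * M h $$ (l, e b)"])
      also have "\<dots> = (\<Sum>l<d. M g $$ (e a, l) * M h $$ (l, e b))"
        using K zero[OF gh] eK ab by (intro sum.mono_neutral_left) auto
      also have "\<dots> = (M g * M h) $$ (e a, e b)"
        using eK ab matrix_repD(1)[OF r] gh by (intro mult_mat_index[symmetric]) auto
      also have "\<dots> = \<sigma> (g \<otimes>\<^bsub>G\<^esub> h) $$ (a, b)"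
        using ab by (simp add: \<sigma>_def matrix_repD(3)[OF r gh])
      finally show "\<sigma> (g \<otimes>\<^bsub>G\<^esub> h) $$ (a, b) = (\<sigma> g * \<sigma> h) $$ (a, b)" by simp
    qed (auto simp: \<sigma>_def)
  qed
  moreover have "mat_trace (\<sigma> g) = (\<Sum>i\<in>K. M g $$ (i, i))" for g
    using sum.reindex_bij_betw[OF e, of "\<lambda>i. M g $$ (i, i)"] by (simp add: mat_trace_def \<sigma>_def)
  ultimately show thesis using that by (simp add: k_def)
qed

text \<open>In a basis adapted to an invariant subspace the representation is block triangular, and its
  trace is the sum of the traces of the two smaller diagonal blocks.\<close>
lemma (in group) trace_sum_of_irreducibles:
  assumes "matrix_rep G d \<rho>"
  shows "\<exists>L. set L \<subseteq> Irr G \<and> (\<forall>g\<in>carrier G. mat_trace (\<rho> g) = (\<Sum>\<chi>\<leftarrow>L. \<chi> g))"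
  using assms
proof (induction d arbitrary: \<rho> rule: less_induct)
  case (less d)
  note r = less.prems
  consider "d = 0" | "irreducible_rep G d \<rho>" | "0 < d" "\<not> irreducible_rep G d \<rho>" by blast
  then show ?case
  proof cases
    case 1
    then have "mat_trace (\<rho> g) = 0" if "g \<in> carrier G" for g
      using matrix_repD(1)[OF r that] by (simp add: mat_trace_def)
    then show ?thesis by (intro exI[of _ "[]"]) simp
  next
    case 2
    then have "restrict (\<lambda>g. mat_trace (\<rho> g)) (carrier G) \<in> Irr G" by (auto simp: Irr_def)
    then show ?thesis by (intro exI[of _ "[restrict (\<lambda>g. mat_trace (\<rho> g)) (carrier G)]"]) simp
  next
    case 3
    then have "\<exists>W. VectorSpace.subspace class_ring W (module_vec TYPE(complex) d) \<and>
        (\<forall>g\<in>carrier G. \<forall>w\<in>W. \<rho> g *\<^sub>v w \<in> W) \<and> W \<noteq> {0\<^sub>v d} \<and> W \<noteq> carrier_vec d"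
      using r unfolding irreducible_rep_def hom_GL_iff by simp
    then obtain W where W0: "VectorSpace.subspace class_ring W (module_vec TYPE(complex) d)"
      and inv0: "\<forall>g\<in>carrier G. \<forall>w\<in>W. \<rho> g *\<^sub>v w \<in> W" and ne: "W \<noteq> {0\<^sub>v d}" "W \<noteq> carrier_vec d"
      by blast
    have W: "W \<subseteq> carrier_vec d" "0\<^sub>v d \<in> W" "\<And>v w. v \<in> W \<Longrightarrow> w \<in> W \<Longrightarrow> v + w \<in> W"
      "\<And>c v. v \<in> W \<Longrightarrow> c \<cdot>\<^sub>v v \<in> W" and inv: "\<And>g w. g \<in> carrier G \<Longrightarrow> w \<in> W \<Longrightarrow> \<rho> g *\<^sub>v w \<in> W"
      using W0 inv0 unfolding subspace_carrier_vec_iff by simp_all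
    obtain P Q J where PQ: "P \<in> carrier_mat d d" "Q \<in> carrier_mat d d" "P * Q = 1\<^sub>m d" "Q * P = 1\<^sub>m d"
      and J: "J \<subseteq> {..<d}" and JW: "\<And>j. j \<in> J \<Longrightarrow> col P j \<in> W"
      and WJ: "\<And>w j. w \<in> W \<Longrightarrow> j < d \<Longrightarrow> j \<notin> J \<Longrightarrow> (Q *\<^sub>v w) $ j = 0"
      using adapted_basis[OF W(1)] by metis
    have PQw: "P *\<^sub>v (Q *\<^sub>v w) = w" if "w \<in> carrier_vec d" for w
      using PQ that by (metis assoc_mult_mat_vec one_mult_mat_vec)
    have "J \<noteq> {}"
    proof
      assume "J = {}"
      obtain w where w: "w \<in> W" "w \<noteq> 0\<^sub>v d" using W ne by blast
      then have wc: "w \<in> carrier_vec d" using W by auto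
      have "Q *\<^sub>v w = 0\<^sub>v d" using WJ[OF w(1)] \<open>J = {}\<close> PQ wc
        by (intro eq_vecI) (auto simp del: index_mult_mat_vec)
      then have "w = P *\<^sub>v 0\<^sub>v d" using PQw[OF wc] by simp
      also have "\<dots> = 0\<^sub>v d" using PQ by (intro eq_vecI) auto
      finally show False using w by simp
    qed
    have "J \<noteq> {..<d}"
    proof
      assume "J = {..<d}"
      then have "P *\<^sub>v x \<in> W" if "x \<in> carrier_vec d" for x
        using mult_mat_vec_in_subspace[OF PQ(1) _ W(2-4) that] JW by auto
      then have "w \<in> W" if "w \<in> carrier_vec d" for w
        using PQw[OF that] PQ that by (metis mult_mat_vec_carrier)
      then show False using W ne by blast
    qed
    define K where "K = {..<d} - J"
    have finJ: "finite J" using J finite_subset by blast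
    have cards: "card J < d" "card K < d"
      using psubset_card_mono[of "{..<d}" J] psubset_card_mono[of "{..<d}" K] J \<open>J \<noteq> {..<d}\<close> \<open>J \<noteq> {}\<close>
      by (auto simp: K_def)
    define M where "M g = Q * \<rho> g * P" for g
    have rM: "matrix_rep G d M" unfolding M_def by (rule matrix_rep_conjugate[OF r PQ])
    have M0: "M g $$ (i, j) = 0" if g: "g \<in> carrier G" and ij: "i < d" "i \<notin> J" "j \<in> J" for g i j
    proof -
      have jd: "j < d" using ij J by auto
      note c = matrix_repD(1)[OF r g]
      have "M g = Q * (\<rho> g * P)" using PQ c by (simp add: M_def assoc_mult_mat[of _ d d _ d _ d])
      then have "col (M g) j = Q *\<^sub>v (\<rho> g *\<^sub>v col P j)"
        using col_mult2[OF PQ(2) mult_carrier_mat[OF c PQ(1)] jd] col_mult2[OF c PQ(1) jd] by simp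
      moreover have "M g $$ (i, j) = col (M g) j $ i"
        using ij jd matrix_repD(1)[OF rM g] by simp
      ultimately show ?thesis using WJ[OF inv[OF g JW[OF ij(3)]] ij(1,2)] by simp
    qed
    obtain \<sigma> where \<sigma>: "matrix_rep G (card J) \<sigma>"
      "\<And>g. g \<in> carrier G \<Longrightarrow> mat_trace (\<sigma> g) = (\<Sum>i\<in>J. M g $$ (i, i))"
    proof (rule diagonal_block_rep[OF rM J])
      show "M g $$ (i, l) * M h $$ (l, j) = 0"
        if "g \<in> carrier G" "h \<in> carrier G" "i \<in> J" "j \<in> J" "l < d" "l \<notin> J" for g h i j l
        using M0[of h l j] that by simp
    qed (use that in auto)
    obtain \<tau> where \<tau>: "matrix_rep G (card K) \<tau>"
      "\<And>g. g \<in> carrier G \<Longrightarrow> mat_trace (\<tau> g) = (\<Sum>i\<in>K. M g $$ (i, i))"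
    proof (rule diagonal_block_rep[OF rM, of K])
      show "K \<subseteq> {..<d}" by (auto simp: K_def)
      show "M g $$ (i, l) * M h $$ (l, j) = 0"
        if "g \<in> carrier G" "h \<in> carrier G" "i \<in> K" "j \<in> K" "l < d" "l \<notin> K" for g h i j l
        using M0[of g i l] that by (auto simp: K_def)
    qed (use that in auto)
    obtain L1 where L1: "set L1 \<subseteq> Irr G" "\<forall>g\<in>carrier G. mat_trace (\<sigma> g) = (\<Sum>\<chi>\<leftarrow>L1. \<chi> g)"
      using less.IH[OF cards(1) \<sigma>(1)] by blast
    obtain L2 where L2: "set L2 \<subseteq> Irr G" "\<forall>g\<in>carrier G. mat_trace (\<tau> g) = (\<Sum>\<chi>\<leftarrow>L2. \<chi> g)"
      using less.IH[OF cards(2) \<tau>(1)] by blast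
    have "mat_trace (\<rho> g) = (\<Sum>\<chi>\<leftarrow>L1 @ L2. \<chi> g)" if g: "g \<in> carrier G" for g
    proof -
      have "mat_trace (\<rho> g) = mat_trace (M g)"
        using mat_trace_similar[OF PQ(1,2) matrix_repD(1)[OF r g] PQ(3)] by (simp add: M_def)
      also have "\<dots> = (\<Sum>i<d. M g $$ (i, i))" by (rule mat_trace_eq[OF matrix_repD(1)[OF rM g]])
      also have "\<dots> = (\<Sum>i\<in>J. M g $$ (i, i)) + (\<Sum>i\<in>K. M g $$ (i, i))"
        using J by (simp add: K_def sum.subset_diff[of J "{..<d}"] add.commute)
      finally show ?thesis using \<sigma>(2)[OF g] \<tau>(2)[OF g] L1 L2 g by simp
    qed
    then show ?thesis using L1 L2 by (intro exI[of _ "L1 @ L2"]) auto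
  qed
qed

text \<open>The trace of left translation by \<open>g\<close> on functions on the group counts the fixed points, and
  \<open>g \<otimes> x = x\<close> only for \<open>g = \<one>\<close>.\<close>
lemma (in group) regular_character:
  assumes fin: "finite (carrier G)"
  obtains L where "set L \<subseteq> Irr G"
    "\<And>g. g \<in> carrier G \<Longrightarrow> (\<Sum>\<chi>\<leftarrow>L. \<chi> g) = (if g = \<one> then of_nat (card (carrier G)) else 0)"
proof -
  define N where "N = card (carrier G)"
  obtain e where e: "bij_betw e {..<N} (carrier G)"
    using ex_bij_betw_nat_finite[OF fin] by (auto simp: N_def lessThan_atLeast0)
  have ec: "e a \<in> carrier G" if "a < N" for a using e that by (auto simp: bij_betw_def)
  have einj: "e a = e b \<longleftrightarrow> a = b" if "a < N" "b < N" for a b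
    using e that by (auto simp: bij_betw_def inj_on_def)
  define \<rho> where "\<rho> g = mat N N (\<lambda>(i, j). if e i = g \<otimes> e j then 1 else 0 :: complex)" for g
  have c: "\<rho> g \<in> carrier_mat N N" for g by (simp add: \<rho>_def)
  have "matrix_rep G N \<rho>"
    unfolding matrix_rep_def
  proof (intro conjI ballI)
    show "\<rho> g \<in> carrier_mat N N" for g by (rule c)
    show "\<rho> \<one> = 1\<^sub>m N" by (rule eq_matI) (auto simp: \<rho>_def ec einj)
    fix g h assume gh: "g \<in> carrier G" "h \<in> carrier G"
    show "\<rho> (g \<otimes> h) = \<rho> g * \<rho> h"
    proof (rule eq_matI)
      fix i j assume "i < dim_row (\<rho> g * \<rho> h)" "j < dim_col (\<rho> g * \<rho> h)"
      then have ij: "i < N" "j < N" by (auto simp: \<rho>_def)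
      have "(\<rho> g * \<rho> h) $$ (i, j)
          = (\<Sum>l<N. (if e i = g \<otimes> e l then 1 else 0) * (if e l = h \<otimes> e j then 1 else 0))"
        using ij by (subst mult_mat_index[OF c c]) (auto simp: \<rho>_def)
      also have "\<dots> = (\<Sum>y\<in>carrier G. (if e i = g \<otimes> y then 1 else 0) * (if y = h \<otimes> e j then 1 else 0))"
        by (rule sum.reindex_bij_betw[OF e,
              of "\<lambda>y. (if e i = g \<otimes> y then 1 else 0) * (if y = h \<otimes> e j then 1 else 0)"])
      also have "\<dots> = (\<Sum>y\<in>carrier G. if y = h \<otimes> e j then (if e i = g \<otimes> y then 1 else 0) else 0)"
        by (rule sum.cong) auto
      also have "\<dots> = \<rho> (g \<otimes> h) $$ (i, j)"
        using fin gh ij ec by (simp add: \<rho>_def m_assoc)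
      finally show "\<rho> (g \<otimes> h) $$ (i, j) = (\<rho> g * \<rho> h) $$ (i, j)" by simp
    qed (auto simp: \<rho>_def)
  qed
  then obtain L where L: "set L \<subseteq> Irr G" "\<forall>g\<in>carrier G. mat_trace (\<rho> g) = (\<Sum>\<chi>\<leftarrow>L. \<chi> g)"
    using trace_sum_of_irreducibles by blast
  have "mat_trace (\<rho> g) = (if g = \<one> then of_nat N else 0)" if g: "g \<in> carrier G" for g
  proof -
    have "mat_trace (\<rho> g) = (\<Sum>i<N. if e i = g \<otimes> e i then 1 else 0)"
      by (simp add: mat_trace_def \<rho>_def)
    also have "\<dots> = (\<Sum>i<N. if g = \<one> then 1 else 0)"
      using ec g by (intro sum.cong refl) (metis lessThan_iff r_cancel_one')
    finally show ?thesis by simp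
  qed
  then have "(\<Sum>\<chi>\<leftarrow>L. \<chi> g) = (if g = \<one> then of_nat (card (carrier G)) else 0)" if "g \<in> carrier G" for g
    using L(2) that unfolding N_def by metis
  with L(1) show thesis by (rule that)
qed

text \<open>The form in which the regular character is applied: a formal combination of group elements that
  every irreducible character sends to zero has coefficient zero at the identity.\<close>
lemma (in group) Irr_separate:
  assumes fin: "finite (carrier G)" and I: "finite I" and y: "\<And>i. i \<in> I \<Longrightarrow> y i \<in> carrier G"
    and zero: "\<And>\<chi>. \<chi> \<in> Irr G \<Longrightarrow> (\<Sum>i\<in>I. c i * \<chi> (y i)) = 0"
  shows "(\<Sum>i\<in>I. if y i = \<one> then c i else 0) = 0"
proof -
  obtain L where L: "set L \<subseteq> Irr G"
    "\<And>g. g \<in> carrier G \<Longrightarrow> (\<Sum>\<chi>\<leftarrow>L. \<chi> g) = (if g = \<one> then of_nat (card (carrier G)) else 0)"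
    using regular_character[OF fin] by blast
  have swap: "(\<Sum>i\<in>I. c i * (\<Sum>\<chi>\<leftarrow>L'. \<chi> (y i))) = (\<Sum>\<chi>\<leftarrow>L'. \<Sum>i\<in>I. c i * \<chi> (y i))" for L'
    by (induction L') (auto simp: distrib_left sum.distrib)
  have "(\<Sum>i\<in>I. c i * (\<Sum>\<chi>\<leftarrow>L. \<chi> (y i))) = (\<Sum>\<chi>\<leftarrow>L. 0)"
    unfolding swap using L(1) zero by (intro arg_cong[of _ _ sum_list] map_cong) auto
  then have "(\<Sum>i\<in>I. of_nat (card (carrier G)) * (if y i = \<one> then c i else 0)) = 0"
    using L(2) y by (simp add: if_distrib mult.commute cong: if_cong)
  then show ?thesis using fin by (simp flip: sum_distrib_left) (metis card_0_eq empty_iff one_closed)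
qed

section \<open>Commutators and conjugacy\<close>

abbreviation element_commutators :: "('a, 'b) monoid_scheme \<Rightarrow> 'a \<Rightarrow> 'a set" where
  "element_commutators G g \<equiv> commutator_subgroup G {g} (carrier G)"

definition conj_in :: "('a, 'b) monoid_scheme \<Rightarrow> 'a \<Rightarrow> 'a \<Rightarrow> bool" where
  "conj_in G g h \<longleftrightarrow> (\<exists>x\<in>carrier G. x \<otimes>\<^bsub>G\<^esub> g \<otimes>\<^bsub>G\<^esub> inv\<^bsub>G\<^esub> x = h)"

definition class_absorbs :: "('a, 'b) monoid_scheme \<Rightarrow> 'a \<Rightarrow> 'a set \<Rightarrow> bool" where
  "class_absorbs G g N \<longleftrightarrow> (\<forall>n\<in>N. conj_in G g (g \<otimes>\<^bsub>G\<^esub> n))"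

context group
begin

lemma cancel_left:
  "x \<in> carrier G \<Longrightarrow> y \<in> carrier G \<Longrightarrow> inv x \<otimes> (x \<otimes> y) = y"
  "x \<in> carrier G \<Longrightarrow> y \<in> carrier G \<Longrightarrow> x \<otimes> (inv x \<otimes> y) = y"
  by (simp_all flip: m_assoc)

lemmas group_normalize = m_assoc inv_mult_group cancel_left

lemma normal_conj_closed: "N \<lhd> G \<Longrightarrow> x \<in> carrier G \<Longrightarrow> n \<in> N \<Longrightarrow> x \<otimes> n \<otimes> inv x \<in> N"
  "N \<lhd> G \<Longrightarrow> x \<in> carrier G \<Longrightarrow> n \<in> N \<Longrightarrow> inv x \<otimes> n \<otimes> x \<in> N"
  by (simp_all add: normal.inv_op_closed1 normal.inv_op_closed2)

lemma normal_carrier: "N \<lhd> G \<Longrightarrow> n \<in> N \<Longrightarrow> n \<in> carrier G"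
  by (rule subgroup.mem_carrier[OF normal_imp_subgroup])

lemma conj_in_refl: "g \<in> carrier G \<Longrightarrow> conj_in G g g"
  unfolding conj_in_def by (rule bexI[of _ \<one>]) auto

lemma conj_in_sym: "g \<in> carrier G \<Longrightarrow> conj_in G g h \<Longrightarrow> conj_in G h g"
  unfolding conj_in_def
proof (elim bexE)
  fix x assume "g \<in> carrier G" "x \<in> carrier G" "x \<otimes> g \<otimes> inv x = h"
  then have "inv x \<otimes> h \<otimes> inv (inv x) = g" by (auto simp: group_normalize)
  then show "\<exists>x\<in>carrier G. x \<otimes> h \<otimes> inv x = g" using \<open>x \<in> carrier G\<close> by blast
qed

lemma conj_in_trans:
  assumes "g \<in> carrier G" "conj_in G g h" "conj_in G h k"
  shows "conj_in G g k"
proof -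
  obtain x y where xy: "x \<in> carrier G" "y \<in> carrier G" "h = x \<otimes> g \<otimes> inv x" "k = y \<otimes> h \<otimes> inv y"
    using assms(2,3) unfolding conj_in_def by blast
  then have "(y \<otimes> x) \<otimes> g \<otimes> inv (y \<otimes> x) = k" using assms(1) by (simp add: group_normalize)
  then show ?thesis unfolding conj_in_def using xy by blast
qed

lemma conj_in_closed: "g \<in> carrier G \<Longrightarrow> conj_in G g h \<Longrightarrow> h \<in> carrier G"
  by (auto simp: conj_in_def)

lemma conj_in_one: "g \<in> carrier G \<Longrightarrow> conj_in G g \<one> \<Longrightarrow> g = \<one>"
  by (drule conj_in_sym) (auto simp: conj_in_def)

lemma commutator_subgroup_subset_iff:
  assumes "subgroup M G"
  shows "commutator_subgroup G A B \<subseteq> M \<longleftrightarrow> (\<forall>a\<in>A. \<forall>b\<in>B. a \<otimes> b \<otimes> inv a \<otimes> inv b \<in> M)" (is "?L \<longleftrightarrow> ?R")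
proof
  assume ?R
  then show ?L unfolding commutator_subgroup_def by (intro generate_subgroup_incl assms) auto
qed (auto simp: commutator_subgroup_def intro: generate.incl)

lemma commutator_subgroup_is_subgroup:
  "A \<subseteq> carrier G \<Longrightarrow> B \<subseteq> carrier G \<Longrightarrow> subgroup (commutator_subgroup G A B) G"
  unfolding commutator_subgroup_def by (intro generate_is_subgroup) (auto simp: subset_iff)

lemma commutator_in:
  "a \<in> A \<Longrightarrow> b \<in> B \<Longrightarrow> a \<otimes> b \<otimes> inv a \<otimes> inv b \<in> commutator_subgroup G A B"
  unfolding commutator_subgroup_def by (intro generate.incl) auto

lemma commutator_subgroup_commute:
  assumes A: "A \<subseteq> carrier G" and B: "B \<subseteq> carrier G"
  shows "commutator_subgroup G A B = commutator_subgroup G B A"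
proof -
  have "commutator_subgroup G A B \<subseteq> commutator_subgroup G B A"
    if A: "A \<subseteq> carrier G" and B: "B \<subseteq> carrier G" for A B
    unfolding commutator_subgroup_subset_iff[OF commutator_subgroup_is_subgroup[OF B A]]
  proof (intro ballI)
    fix a b assume ab: "a \<in> A" "b \<in> B"
    then have c: "a \<in> carrier G" "b \<in> carrier G" using A B by auto
    have "inv (b \<otimes> a \<otimes> inv b \<otimes> inv a) \<in> commutator_subgroup G B A"
      by (rule subgroup.m_inv_closed[OF commutator_subgroup_is_subgroup[OF B A] commutator_in[OF ab(2,1)]])
    then show "a \<otimes> b \<otimes> inv a \<otimes> inv b \<in> commutator_subgroup G B A" using c by (simp add: group_normalize)
  qed
  then show ?thesis using A B by blast
qed

text \<open>The identity \<open>y [a, x] y\<inverse> = [a, y]\<inverse> [a, y x]\<close> expresses a conjugate of a commutator by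
  commutators with the same left entry \<open>a\<close>.\<close>
lemma commutator_subgroup_normal:
  assumes A: "A \<subseteq> carrier G"
  shows "commutator_subgroup G A (carrier G) \<lhd> G"
proof -
  let ?C = "commutator_subgroup G A (carrier G)"
  have sub: "subgroup ?C G" using A by (intro commutator_subgroup_is_subgroup) auto
  have "y \<otimes> c \<otimes> inv y \<in> ?C" if y: "y \<in> carrier G" and c: "c \<in> ?C" for y c
  proof -
    have "subgroup {c \<in> carrier G. y \<otimes> c \<otimes> inv y \<in> ?C} G"
    proof (rule subgroupI)
      show "{c \<in> carrier G. y \<otimes> c \<otimes> inv y \<in> ?C} \<noteq> {}"
        using y subgroup.one_closed[OF sub] by (auto intro!: exI[of _ \<one>])
      show "inv a \<in> {c \<in> carrier G. y \<otimes> c \<otimes> inv y \<in> ?C}" if "a \<in> {c \<in> carrier G. y \<otimes> c \<otimes> inv y \<in> ?C}" for a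
      proof -
        have "inv (y \<otimes> a \<otimes> inv y) \<in> ?C" by (rule subgroup.m_inv_closed[OF sub]) (use that in simp)
        then show ?thesis using that y by (auto simp: group_normalize)
      qed
      show "a \<otimes> b \<in> {c \<in> carrier G. y \<otimes> c \<otimes> inv y \<in> ?C}"
        if "a \<in> {c \<in> carrier G. y \<otimes> c \<otimes> inv y \<in> ?C}" "b \<in> {c \<in> carrier G. y \<otimes> c \<otimes> inv y \<in> ?C}" for a b
      proof -
        have "(y \<otimes> a \<otimes> inv y) \<otimes> (y \<otimes> b \<otimes> inv y) \<in> ?C"
          by (rule subgroup.m_closed[OF sub]) (use that in simp_all)
        then show ?thesis using that y by (auto simp: group_normalize)
      qed
    qed auto
    then have "?C \<subseteq> {c \<in> carrier G. y \<otimes> c \<otimes> inv y \<in> ?C}"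
    proof (subst commutator_subgroup_subset_iff, assumption, intro ballI)
      fix a x assume ax: "a \<in> A" "x \<in> carrier G"
      then have a: "a \<in> carrier G" using A by auto
      have "inv (a \<otimes> y \<otimes> inv a \<otimes> inv y) \<otimes> (a \<otimes> (y \<otimes> x) \<otimes> inv a \<otimes> inv (y \<otimes> x)) \<in> ?C"
        by (intro subgroup.m_closed[OF sub] subgroup.m_inv_closed[OF sub] commutator_in) (use ax y in auto)
      then show "a \<otimes> x \<otimes> inv a \<otimes> inv x \<in> {c \<in> carrier G. y \<otimes> c \<otimes> inv y \<in> ?C}"
        using a ax y by (simp add: group_normalize)
    qed
    then show ?thesis using c by blast
  qed
  then show ?thesis using sub by (simp add: normal_inv_iff)
qed

lemma element_commutators_normal: "g \<in> carrier G \<Longrightarrow> element_commutators G g \<lhd> G"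
  by (simp add: commutator_subgroup_normal)

lemma element_commutators_subset_iff:
  "subgroup M G \<Longrightarrow> element_commutators G g \<subseteq> M \<longleftrightarrow> (\<forall>x\<in>carrier G. g \<otimes> x \<otimes> inv g \<otimes> inv x \<in> M)"
  by (simp add: commutator_subgroup_subset_iff)

lemma commutator_subgroup_subset_iff_elements:
  "subgroup M G \<Longrightarrow> commutator_subgroup G A (carrier G) \<subseteq> M \<longleftrightarrow> (\<forall>g\<in>A. element_commutators G g \<subseteq> M)"
  by (simp add: commutator_subgroup_subset_iff)

lemma element_commutators_subset:
  "A \<subseteq> carrier G \<Longrightarrow> g \<in> A \<Longrightarrow> element_commutators G g \<subseteq> commutator_subgroup G A (carrier G)"
  using commutator_subgroup_subset_iff_elements[OF commutator_subgroup_is_subgroup, of A "carrier G" A] by simp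

lemma conj_in_mult_in_commutators:
  assumes g: "g \<in> carrier G" and m: "m \<in> carrier G" and c: "conj_in G g (g \<otimes> m)"
  shows "m \<in> element_commutators G g"
proof -
  note N = element_commutators_normal[OF g]
  obtain x where x: "x \<in> carrier G" "x \<otimes> g \<otimes> inv x = g \<otimes> m" using c by (auto simp: conj_in_def)
  have "inv (g \<otimes> x \<otimes> inv g \<otimes> inv x) \<in> element_commutators G g"
    by (rule subgroup.m_inv_closed[OF normal_imp_subgroup[OF N] commutator_in]) (use x in auto)
  then have "inv g \<otimes> inv (g \<otimes> x \<otimes> inv g \<otimes> inv x) \<otimes> g \<in> element_commutators G g"
    by (rule normal_conj_closed(2)[OF N g])
  also have "inv g \<otimes> inv (g \<otimes> x \<otimes> inv g \<otimes> inv x) \<otimes> g = inv g \<otimes> (x \<otimes> g \<otimes> inv x)"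
    using g x(1) by (simp add: group_normalize)
  also have "\<dots> = m" using g m x by (simp add: cancel_left)
  finally show ?thesis .
qed

text \<open>The preimage of the centre of \<open>G / M\<close>.\<close>
lemma elements_with_commutators_in_subgroup:
  assumes M: "M \<lhd> G"
  shows "subgroup {g \<in> carrier G. element_commutators G g \<subseteq> M} G"
proof -
  have sub: "subgroup M G" by (rule normal_imp_subgroup[OF M])
  note iff = element_commutators_subset_iff[OF sub]
  show ?thesis
  proof (rule subgroupI)
    have "\<one> \<in> {g \<in> carrier G. element_commutators G g \<subseteq> M}"
      using subgroup.one_closed[OF sub] by (auto simp: iff)
    then show "{g \<in> carrier G. element_commutators G g \<subseteq> M} \<noteq> {}" by blast
    show "inv a \<in> {g \<in> carrier G. element_commutators G g \<subseteq> M}"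
      if "a \<in> {g \<in> carrier G. element_commutators G g \<subseteq> M}" for a
    proof -
      have a: "a \<in> carrier G" using that by simp
      have "inv a \<otimes> x \<otimes> inv (inv a) \<otimes> inv x \<in> M" if x: "x \<in> carrier G" for x
      proof -
        have "a \<otimes> x \<otimes> inv a \<otimes> inv x \<in> M" using \<open>a \<in> {g \<in> carrier G. _}\<close> x by (simp add: iff)
        then have "inv a \<otimes> inv (a \<otimes> x \<otimes> inv a \<otimes> inv x) \<otimes> a \<in> M"
          by (intro normal_conj_closed(2)[OF M a] subgroup.m_inv_closed[OF sub])
        then show ?thesis using a x by (simp add: group_normalize)
      qed
      then show ?thesis using a by (simp add: iff)
    qed
    show "a \<otimes> b \<in> {g \<in> carrier G. element_commutators G g \<subseteq> M}"
      if "a \<in> {g \<in> carrier G. element_commutators G g \<subseteq> M}" "b \<in> {g \<in> carrier G. element_commutators G g \<subseteq> M}" for a b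
    proof -
      have ab: "a \<in> carrier G" "b \<in> carrier G" using that by auto
      have "(a \<otimes> b) \<otimes> x \<otimes> inv (a \<otimes> b) \<otimes> inv x \<in> M" if x: "x \<in> carrier G" for x
      proof -
        have h: "a \<otimes> x \<otimes> inv a \<otimes> inv x \<in> M" "b \<otimes> x \<otimes> inv b \<otimes> inv x \<in> M"
          using \<open>a \<in> {g \<in> carrier G. _}\<close> \<open>b \<in> {g \<in> carrier G. _}\<close> x by (simp_all add: iff)
        have "(a \<otimes> (b \<otimes> x \<otimes> inv b \<otimes> inv x) \<otimes> inv a) \<otimes> (a \<otimes> x \<otimes> inv a \<otimes> inv x) \<in> M"
          by (rule subgroup.m_closed[OF sub normal_conj_closed(1)[OF M ab(1) h(2)] h(1)])
        then show ?thesis using ab x by (simp add: group_normalize)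
      qed
      then show ?thesis using ab by (simp add: iff)
    qed
  qed auto
qed

lemma group_center_eq: "group_center G = {g \<in> carrier G. element_commutators G g \<subseteq> {\<one>}}"
proof -
  have "g \<otimes> x = x \<otimes> g \<longleftrightarrow> g \<otimes> x \<otimes> inv g \<otimes> inv x = \<one>" if "g \<in> carrier G" "x \<in> carrier G" for g x
  proof -
    have "g \<otimes> x = x \<otimes> g \<longleftrightarrow> (g \<otimes> x) \<otimes> inv (x \<otimes> g) = \<one>"
      using that by (metis inv_closed inv_equality inv_inv m_closed r_inv)
    then show ?thesis using that by (simp add: group_normalize)
  qed
  then show ?thesis
    unfolding group_center_def using element_commutators_subset_iff[OF triv_subgroup] by auto
qed

lemma group_center_subgroup: "subgroup (group_center G) G"
  unfolding group_center_eq by (rule elements_with_commutators_in_subgroup[OF one_is_normal])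

lemma group_center_conj_in:
  assumes "g \<in> group_center G" "conj_in G g h"
  shows "h = g"
proof -
  obtain x where "x \<in> carrier G" "h = x \<otimes> g \<otimes> inv x" using assms by (auto simp: conj_in_def)
  then show ?thesis using assms(1) unfolding group_center_def
    by (auto simp: m_assoc) (metis r_inv r_one m_assoc inv_closed)
qed

end

section \<open>Kernels and centres of characters\<close>

context group
begin

lemma mult_zero_vec: "A \<in> carrier_mat d d \<Longrightarrow> A *\<^sub>v 0\<^sub>v d = (0\<^sub>v d :: complex vec)"
  by (intro eq_vecI) auto

lemma IrrE:
  assumes "\<chi> \<in> Irr G"
  obtains d \<rho> where "irreducible_rep G d \<rho>" "\<And>g. g \<in> carrier G \<Longrightarrow> \<chi> g = mat_trace (\<rho> g)"
  using assms unfolding Irr_def by auto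

lemma rep_inv:
  assumes r: "matrix_rep G d \<rho>" and g: "g \<in> carrier G"
  shows "\<rho> g * \<rho> (inv g) = 1\<^sub>m d" "\<rho> (inv g) * \<rho> g = 1\<^sub>m d"
  using matrix_repD(3)[OF r g, of "inv g"] matrix_repD(3)[OF r, of "inv g" g] matrix_repD(2)[OF r] g by auto

lemma rep_pow:
  assumes r: "matrix_rep G d \<rho>" and g: "g \<in> carrier G"
  shows "\<rho> (g [^] (k :: nat)) = \<rho> g ^\<^sub>m k"
proof (induction k)
  case 0
  show ?case using matrix_repD(1)[OF r g] matrix_repD(2)[OF r] by simp
next
  case (Suc k)
  then show ?case using matrix_repD(3)[OF r nat_pow_closed[OF g, of k] g] by simp
qed

lemma rep_trace_maximal:
  assumes fin: "finite (carrier G)" and r: "matrix_rep G d \<rho>" and d: "0 < d" and g: "g \<in> carrier G"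
  shows "cmod (mat_trace (\<rho> g)) = d \<longleftrightarrow> (\<exists>c. cmod c = 1 \<and> \<rho> g = c \<cdot>\<^sub>m 1\<^sub>m d)"
proof
  have k: "0 < Coset.order G" using fin order_gt_0_iff_finite by blast
  have "\<rho> g ^\<^sub>m Coset.order G = 1\<^sub>m d"
    using rep_pow[OF r g, of "Coset.order G"] pow_order_eq_1[OF g] matrix_repD(2)[OF r] by simp
  moreover assume "cmod (mat_trace (\<rho> g)) = d"
  ultimately obtain c where c: "\<rho> g = c \<cdot>\<^sub>m 1\<^sub>m d" "c ^ Coset.order G = 1"
    using finite_order_maximal_trace_scalar[OF matrix_repD(1)[OF r g] d k] by blast
  then have "cmod c = 1" using power_eq_1_iff[OF c(2)] k by auto
  with c show "\<exists>c. cmod c = 1 \<and> \<rho> g = c \<cdot>\<^sub>m 1\<^sub>m d" by blast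
next
  assume "\<exists>c. cmod c = 1 \<and> \<rho> g = c \<cdot>\<^sub>m 1\<^sub>m d"
  then show "cmod (mat_trace (\<rho> g)) = d" by (auto simp: norm_mult)
qed

lemma rep_trace_eq_degree:
  assumes fin: "finite (carrier G)" and r: "matrix_rep G d \<rho>" and d: "0 < d" and g: "g \<in> carrier G"
  shows "mat_trace (\<rho> g) = of_nat d \<longleftrightarrow> \<rho> g = 1\<^sub>m d"
proof
  assume t: "mat_trace (\<rho> g) = of_nat d"
  then obtain c where c: "\<rho> g = c \<cdot>\<^sub>m 1\<^sub>m d" using rep_trace_maximal[OF fin r d g] by auto
  then have "c = 1" using t d by simp
  then show "\<rho> g = 1\<^sub>m d" using c by (auto intro!: eq_matI)
qed simp

lemma rep_eq_iff:
  assumes r: "matrix_rep G d \<rho>" and ab: "a \<in> carrier G" "b \<in> carrier G"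
  shows "\<rho> a = \<rho> b \<longleftrightarrow> \<rho> (a \<otimes> inv b) = 1\<^sub>m d"
proof
  assume "\<rho> a = \<rho> b"
  then show "\<rho> (a \<otimes> inv b) = 1\<^sub>m d" using matrix_repD(3)[OF r] rep_inv[OF r] ab by simp
next
  assume e: "\<rho> (a \<otimes> inv b) = 1\<^sub>m d"
  have "\<rho> a = \<rho> (a \<otimes> inv b \<otimes> b)" using ab by (simp add: m_assoc)
  also have "\<dots> = \<rho> (a \<otimes> inv b) * \<rho> b" using ab matrix_repD(3)[OF r] by simp
  also have "\<dots> = \<rho> b" unfolding e by (rule left_mult_one_mat[OF matrix_repD(1)[OF r ab(2)]])
  finally show "\<rho> a = \<rho> b" .
qed

lemma character_of_rep:
  assumes fin: "finite (carrier G)" and irr: "irreducible_rep G d \<rho>"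
    and \<chi>: "\<And>g. g \<in> carrier G \<Longrightarrow> \<chi> g = mat_trace (\<rho> g)"
  shows "\<chi> \<one> = of_nat d" "char_ker G \<chi> = {g \<in> carrier G. \<rho> g = 1\<^sub>m d}"
    "char_center G \<chi> = {g \<in> carrier G. \<exists>c. cmod c = 1 \<and> \<rho> g = c \<cdot>\<^sub>m 1\<^sub>m d}"
proof -
  note r = irreducible_repD(1,2)[OF irr]
  show 1: "\<chi> \<one> = of_nat d" using \<chi> matrix_repD(2)[OF r(1)] by simp
  show "char_ker G \<chi> = {g \<in> carrier G. \<rho> g = 1\<^sub>m d}"
    unfolding char_ker_def 1 using \<chi> rep_trace_eq_degree[OF fin r] by auto
  have iff: "complex_of_real (cmod z) = of_nat d \<longleftrightarrow> cmod z = d" for z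
    by (metis of_real_eq_iff of_real_of_nat_eq)
  then show "char_center G \<chi> = {g \<in> carrier G. \<exists>c. cmod c = 1 \<and> \<rho> g = c \<cdot>\<^sub>m 1\<^sub>m d}"
    unfolding char_center_def 1 by (simp add: iff \<chi> rep_trace_maximal[OF fin r] cong: conj_cong)
qed

lemma char_ker_normal:
  assumes fin: "finite (carrier G)" and "\<chi> \<in> Irr G"
  shows "char_ker G \<chi> \<lhd> G"
proof -
  obtain d \<rho> where irr: "irreducible_rep G d \<rho>" and \<chi>: "\<And>g. g \<in> carrier G \<Longrightarrow> \<chi> g = mat_trace (\<rho> g)"
    using IrrE[OF assms(2)] by blast
  note r = irreducible_repD(1)[OF irr]
  have m: "\<rho> (a \<otimes> b) = 1\<^sub>m d" if "a \<in> carrier G" "b \<in> carrier G" "\<rho> a = 1\<^sub>m d" "\<rho> b = 1\<^sub>m d" for a b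
    using that matrix_repD(3)[OF r] by simp
  have i: "\<rho> (inv a) = 1\<^sub>m d" if "a \<in> carrier G" "\<rho> a = 1\<^sub>m d" for a
    using rep_eq_iff[OF r one_closed that(1)] that matrix_repD(2)[OF r] by simp
  have c: "\<rho> (x \<otimes> a \<otimes> inv x) = 1\<^sub>m d" if "x \<in> carrier G" "a \<in> carrier G" "\<rho> a = 1\<^sub>m d" for x a
  proof -
    have "\<rho> (x \<otimes> a) = \<rho> x"
      using that matrix_repD(3)[OF r] right_mult_one_mat[OF matrix_repD(1)[OF r that(1)]] by simp
    then show ?thesis using rep_eq_iff[OF r _ that(1), of "x \<otimes> a"] that by simp
  qed
  have "subgroup {g \<in> carrier G. \<rho> g = 1\<^sub>m d} G"
    using matrix_repD(2)[OF r] m i by (intro subgroupI) auto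
  moreover have ker: "char_ker G \<chi> = {g \<in> carrier G. \<rho> g = 1\<^sub>m d}"
    by (rule character_of_rep(2)[where \<chi> = \<chi>, OF fin irr \<chi>])
  ultimately show ?thesis unfolding ker normal_inv_iff using c by auto
qed

text \<open>\<open>Z(\<chi>) / ker \<chi>\<close> is the centre of \<open>G / ker \<chi>\<close>.\<close>
lemma char_center_iff:
  assumes fin: "finite (carrier G)" and \<chi>I: "\<chi> \<in> Irr G"
  shows "char_center G \<chi> = {g \<in> carrier G. element_commutators G g \<subseteq> char_ker G \<chi>}"
proof -
  obtain d \<rho> where irr: "irreducible_rep G d \<rho>" and \<chi>: "\<And>g. g \<in> carrier G \<Longrightarrow> \<chi> g = mat_trace (\<rho> g)"
    using IrrE[OF \<chi>I] by blast
  note r = irreducible_repD(1)[OF irr]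
  have comm: "\<rho> g * \<rho> x = \<rho> x * \<rho> g \<longleftrightarrow> g \<otimes> x \<otimes> inv g \<otimes> inv x \<in> char_ker G \<chi>"
    if gx: "g \<in> carrier G" "x \<in> carrier G" for g x
  proof -
    have "\<rho> g * \<rho> x = \<rho> x * \<rho> g \<longleftrightarrow> \<rho> (g \<otimes> x) = \<rho> (x \<otimes> g)" using matrix_repD(3)[OF r] gx by simp
    also have "\<dots> \<longleftrightarrow> \<rho> ((g \<otimes> x) \<otimes> inv (x \<otimes> g)) = 1\<^sub>m d" using gx by (intro rep_eq_iff[OF r]) auto
    also have "(g \<otimes> x) \<otimes> inv (x \<otimes> g) = g \<otimes> x \<otimes> inv g \<otimes> inv x" using gx by (simp add: group_normalize)
    finally show ?thesis using gx by (simp add: character_of_rep(2)[where \<chi> = \<chi>, OF fin irr \<chi>])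
  qed
  have "(\<exists>c. cmod c = 1 \<and> \<rho> g = c \<cdot>\<^sub>m 1\<^sub>m d) \<longleftrightarrow> (\<forall>x\<in>carrier G. \<rho> g * \<rho> x = \<rho> x * \<rho> g)"
    if g: "g \<in> carrier G" for g
  proof
    assume "\<exists>c. cmod c = 1 \<and> \<rho> g = c \<cdot>\<^sub>m 1\<^sub>m d"
    then obtain c where c: "\<rho> g = c \<cdot>\<^sub>m 1\<^sub>m d" by blast
    show "\<forall>x\<in>carrier G. \<rho> g * \<rho> x = \<rho> x * \<rho> g"
    proof
      fix x assume "x \<in> carrier G"
      then have x: "\<rho> x \<in> carrier_mat d d" by (rule matrix_repD(1)[OF r])
      show "\<rho> g * \<rho> x = \<rho> x * \<rho> g"
        unfolding c mult_smult_assoc_mat[OF one_carrier_mat x] mult_smult_distrib[OF x one_carrier_mat]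
        by (simp only: left_mult_one_mat[OF x] right_mult_one_mat[OF x])
    qed
  next
    assume "\<forall>x\<in>carrier G. \<rho> g * \<rho> x = \<rho> x * \<rho> g"
    then obtain c where c: "\<rho> g = c \<cdot>\<^sub>m 1\<^sub>m d"
      using schur_lemma[OF irr matrix_repD(1)[OF r g]] by blast
    have d: "0 < d" by (rule irreducible_repD(2)[OF irr])
    have k: "0 < Coset.order G" using fin order_gt_0_iff_finite by blast
    have scal: "(c \<cdot>\<^sub>m 1\<^sub>m d) ^\<^sub>m k = (c ^ k) \<cdot>\<^sub>m 1\<^sub>m d" for k
    proof (induction k)
      case (Suc k)
      have "(c \<cdot>\<^sub>m 1\<^sub>m d) ^\<^sub>m Suc k = ((c ^ k) \<cdot>\<^sub>m 1\<^sub>m d) * (c \<cdot>\<^sub>m 1\<^sub>m d)" by (simp only: pow_mat.simps Suc)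
      also have "\<dots> = c ^ Suc k \<cdot>\<^sub>m 1\<^sub>m d"
        by (rule eq_matI) (auto simp: scalar_prod_def sum.If_cases if_distrib cong: if_cong)
      finally show ?case .
    qed (auto intro!: eq_matI)
    have "\<rho> g ^\<^sub>m Coset.order G = 1\<^sub>m d"
      using rep_pow[OF r g, of "Coset.order G"] pow_order_eq_1[OF g] matrix_repD(2)[OF r] by simp
    then have "(c ^ Coset.order G) \<cdot>\<^sub>m 1\<^sub>m d = 1\<^sub>m d" by (simp only: c scal)
    then have "((c ^ Coset.order G) \<cdot>\<^sub>m 1\<^sub>m d) $$ (0, 0) = (1\<^sub>m d :: complex mat) $$ (0, 0)" by simp
    then have "c ^ Coset.order G = 1" using d by simp
    from power_eq_1_iff[OF this] have "cmod c = 1" using k by auto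
    with c show "\<exists>c. cmod c = 1 \<and> \<rho> g = c \<cdot>\<^sub>m 1\<^sub>m d" by blast
  qed
  moreover have center: "char_center G \<chi> = {g \<in> carrier G. \<exists>c. cmod c = 1 \<and> \<rho> g = c \<cdot>\<^sub>m 1\<^sub>m d}"
    by (rule character_of_rep(3)[where \<chi> = \<chi>, OF fin irr \<chi>])
  ultimately show ?thesis
    unfolding center
    using comm element_commutators_subset_iff[OF normal_imp_subgroup[OF char_ker_normal[OF fin \<chi>I]]]
    by auto
qed

text \<open>The image of \<open>\<Sum>N\<close> consists of vectors fixed by \<open>N\<close>, and these form an
  invariant subspace because \<open>N\<close> is normal.\<close>
lemma normal_sum_zero_or_trivial:
  assumes irr: "irreducible_rep G d \<rho>" and N: "N \<lhd> G"
  shows "msum d N \<rho> = 0\<^sub>m d d \<or> (\<forall>n\<in>N. \<rho> n = 1\<^sub>m d)"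
proof (rule disjCI)
  note r = irreducible_repD(1)[OF irr]
  have Nc: "n \<in> carrier G" if "n \<in> N" for n by (rule normal_carrier[OF N that])
  have c: "\<rho> n \<in> carrier_mat d d" if "n \<in> N" for n using matrix_repD(1)[OF r Nc[OF that]] .
  assume nontriv: "\<not> (\<forall>n\<in>N. \<rho> n = 1\<^sub>m d)"
  define W where "W = {v \<in> carrier_vec d. \<forall>n\<in>N. \<rho> n *\<^sub>v v = v}"
  have W0: "v = 0\<^sub>v d" if v: "v \<in> W" for v
  proof (rule ccontr)
    assume "v \<noteq> 0\<^sub>v d"
    have "W = carrier_vec d"
    proof (rule irreducible_repD(3)[OF irr])
      show "W \<subseteq> carrier_vec d" "0\<^sub>v d \<in> W" "v \<in> W" "v \<noteq> 0\<^sub>v d" using v \<open>v \<noteq> 0\<^sub>v d\<close> c by (auto simp: W_def mult_zero_vec)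
      show "v + w \<in> W" if "v \<in> W" "w \<in> W" for v w
        using that c by (auto simp: W_def mult_add_distrib_mat_vec[OF c])
      show "k \<cdot>\<^sub>v v \<in> W" if "v \<in> W" for k v
        using that c by (auto simp: W_def mult_mat_vec[OF c])
      show "\<rho> g *\<^sub>v w \<in> W" if g: "g \<in> carrier G" and w: "w \<in> W" for g w
      proof -
        have w': "w \<in> carrier_vec d" using w by (simp add: W_def)
        note cg = matrix_repD(1)[OF r g]
        have "\<rho> n *\<^sub>v (\<rho> g *\<^sub>v w) = \<rho> g *\<^sub>v w" if n: "n \<in> N" for n
        proof -
          have n': "inv g \<otimes> n \<otimes> g \<in> N" by (rule normal_conj_closed(2)[OF N g n])
          have "\<rho> n *\<^sub>v (\<rho> g *\<^sub>v w) = (\<rho> n * \<rho> g) *\<^sub>v w"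
            by (rule assoc_mult_mat_vec[OF c[OF n] cg w', symmetric])
          also have "\<rho> n * \<rho> g = \<rho> (n \<otimes> g)" by (rule matrix_repD(3)[OF r Nc[OF n] g, symmetric])
          also have "n \<otimes> g = g \<otimes> (inv g \<otimes> n \<otimes> g)" using Nc[OF n] g by (simp add: group_normalize)
          also have "\<rho> \<dots> = \<rho> g * \<rho> (inv g \<otimes> n \<otimes> g)" by (rule matrix_repD(3)[OF r g Nc[OF n']])
          also have "\<dots> *\<^sub>v w = \<rho> g *\<^sub>v (\<rho> (inv g \<otimes> n \<otimes> g) *\<^sub>v w)"
            by (rule assoc_mult_mat_vec[OF cg c[OF n'] w'])
          also have "\<rho> (inv g \<otimes> n \<otimes> g) *\<^sub>v w = w" using w n' by (simp add: W_def)
          finally show ?thesis .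
        qed
        then show ?thesis using cg w' by (simp add: W_def)
      qed
    qed
    then have "\<rho> n *\<^sub>v u = 1\<^sub>m d *\<^sub>v u" if "n \<in> N" "u \<in> carrier_vec d" for n u
      using that by (auto simp: W_def set_eq_iff)
    then have "\<rho> n = 1\<^sub>m d" if "n \<in> N" for n
      using mat_eqI_vec[OF c[OF that] one_carrier_mat] that by blast
    then show False using nontriv by blast
  qed
  have "col (msum d N \<rho>) j \<in> W" if j: "j < d" for j
  proof -
    have "\<rho> n *\<^sub>v col (msum d N \<rho>) j = col (msum d N \<rho>) j" if n: "n \<in> N" for n
    proof -
      have bij: "bij_betw (\<lambda>x. n \<otimes> x) N N"
      proof (rule bij_betw_byWitness[of _ "\<lambda>x. inv n \<otimes> x"])
        show "\<forall>x\<in>N. inv n \<otimes> (n \<otimes> x) = x" "\<forall>x\<in>N. n \<otimes> (inv n \<otimes> x) = x"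
          using Nc n by (auto simp: cancel_left)
        note sub = normal_imp_subgroup[OF N]
        show "(\<lambda>x. n \<otimes> x) ` N \<subseteq> N" "(\<lambda>x. inv n \<otimes> x) ` N \<subseteq> N"
          using subgroup.m_closed[OF sub n] subgroup.m_closed[OF sub subgroup.m_inv_closed[OF sub n]] by auto
      qed
      have "\<rho> n * msum d N \<rho> = msum d N (\<lambda>x. \<rho> n * \<rho> x)" by (rule mult_msum[OF c[OF n] c])
      also have "\<dots> = msum d N (\<lambda>x. \<rho> (n \<otimes> x))"
        using matrix_repD(3)[OF r Nc[OF n] Nc] by (intro msum_cong) simp
      also have "\<dots> = msum d N \<rho>" by (rule msum_reindex[OF bij, symmetric])
      finally show ?thesis using col_mult2[OF c[OF n] msum_carrier[of d N \<rho>] j] by simp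
    qed
    then show ?thesis by (simp add: W_def) (metis carrier_vec_dim_vec dim_col msum_dim(1))
  qed
  then have "col (msum d N \<rho>) j = 0\<^sub>v d" if "j < d" for j using W0 that by blast
  then have "msum d N \<rho> $$ (i, j) = 0" if "i < d" "j < d" for i j
    using that by (metis index_col index_zero_vec(1) msum_dim)
  then show "msum d N \<rho> = 0\<^sub>m d d" by (intro eq_matI) auto
qed

lemma character_class_function:
  assumes "matrix_rep G d \<rho>" "g \<in> carrier G" "x \<in> carrier G"
  shows "mat_trace (\<rho> (x \<otimes> g \<otimes> inv x)) = mat_trace (\<rho> g)"
proof -
  note c = matrix_repD(1)[OF assms(1)]
  have "mat_trace (\<rho> (x \<otimes> g \<otimes> inv x)) = mat_trace (\<rho> (x \<otimes> g) * \<rho> (inv x))"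
    using assms by (simp add: matrix_repD(3)[OF assms(1)])
  also have "\<dots> = mat_trace (\<rho> (inv x) * \<rho> (x \<otimes> g))"
    using assms by (intro mat_trace_mult_comm[of _ d] c) auto
  also have "\<rho> (inv x) * \<rho> (x \<otimes> g) = \<rho> (inv x \<otimes> (x \<otimes> g))"
    using assms by (intro matrix_repD(3)[OF assms(1), symmetric]) auto
  also have "inv x \<otimes> (x \<otimes> g) = g" using assms by (simp add: cancel_left)
  finally show ?thesis .
qed

end

section \<open>Vanishing of characters and absorption of normal subgroups\<close>

context group
begin

lemma Irr_repE:
  assumes fin: "finite (carrier G)" and "\<chi> \<in> Irr G"
  obtains d \<rho> where "irreducible_rep G d \<rho>" "\<And>g. g \<in> carrier G \<Longrightarrow> \<chi> g = mat_trace (\<rho> g)"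
    "char_ker G \<chi> = {g \<in> carrier G. \<rho> g = 1\<^sub>m d}"
proof -
  obtain d \<rho> where irr: "irreducible_rep G d \<rho>" and \<chi>: "\<And>g. g \<in> carrier G \<Longrightarrow> \<chi> g = mat_trace (\<rho> g)"
    using IrrE[OF assms(2)] by blast
  show thesis by (rule that[OF irr \<chi> character_of_rep(2)[where \<chi> = \<chi>, OF fin irr \<chi>]])
qed

lemma normal_sum_zero:
  assumes "irreducible_rep G d \<rho>" and N: "N \<lhd> G" and "\<not> N \<subseteq> {g \<in> carrier G. \<rho> g = 1\<^sub>m d}"
  shows "msum d N \<rho> = 0\<^sub>m d d"
  using normal_sum_zero_or_trivial[OF assms(1) N] assms(3) normal_carrier[OF N] by auto

lemma sum_characters_coset:
  assumes r: "matrix_rep G d \<rho>" and N: "N \<lhd> G" and g: "g \<in> carrier G"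
  shows "(\<Sum>n\<in>N. mat_trace (\<rho> (g \<otimes> n))) = mat_trace (\<rho> g * msum d N \<rho>)"
proof -
  note c = matrix_repD(1)[OF r]
  have Nc: "n \<in> carrier G" if "n \<in> N" for n by (rule normal_carrier[OF N that])
  have "\<rho> g * msum d N \<rho> = msum d N (\<lambda>n. \<rho> g * \<rho> n)" by (rule mult_msum[OF c[OF g] c[OF Nc]])
  also have "\<dots> = msum d N (\<lambda>n. \<rho> (g \<otimes> n))"
    using matrix_repD(3)[OF r g Nc] by (intro msum_cong) simp
  also have "mat_trace \<dots> = (\<Sum>n\<in>N. mat_trace (\<rho> (g \<otimes> n)))"
    using c Nc g by (intro mat_trace_msum) simp
  finally show ?thesis by simp
qed

text \<open>If \<open>gN\<close> lies in the class of \<open>g\<close>, then \<open>|N| \<chi> g\<close> is the sum of \<open>\<chi>\<close> over \<open>gN\<close>, which is the trace of a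
  matrix product with the factor \<open>\<Sum>n\<in>N. \<rho> n = 0\<close>.\<close>
lemma Irr_over_vanishes_if_absorbs:
  assumes fin: "finite (carrier G)" and N: "N \<lhd> G" and g: "g \<in> carrier G"
    and abs: "class_absorbs G g N" and \<chi>: "\<chi> \<in> Irr_over G N"
  shows "\<chi> g = 0"
proof -
  have \<chi>I: "\<chi> \<in> Irr G" and nk: "\<not> N \<subseteq> char_ker G \<chi>" using \<chi> by (auto simp: Irr_over_def)
  obtain d \<rho> where irr: "irreducible_rep G d \<rho>" and \<chi>: "\<And>g. g \<in> carrier G \<Longrightarrow> \<chi> g = mat_trace (\<rho> g)"
    and ker: "char_ker G \<chi> = {g \<in> carrier G. \<rho> g = 1\<^sub>m d}"
    using Irr_repE[OF fin \<chi>I] by blast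
  note r = irreducible_repD(1)[OF irr]
  have eq: "mat_trace (\<rho> (g \<otimes> n)) = mat_trace (\<rho> g)" if n: "n \<in> N" for n
  proof -
    obtain x where "x \<in> carrier G" "x \<otimes> g \<otimes> inv x = g \<otimes> n"
      using abs n by (auto simp: class_absorbs_def conj_in_def)
    then show ?thesis using character_class_function[OF r g] by metis
  qed
  have "of_nat (card N) * mat_trace (\<rho> g) = (\<Sum>n\<in>N. mat_trace (\<rho> (g \<otimes> n)))" by (simp add: eq)
  also have "\<dots> = mat_trace (\<rho> g * msum d N \<rho>)" by (rule sum_characters_coset[OF r N g])
  also have "\<dots> = 0"
    unfolding normal_sum_zero[OF irr N nk[unfolded ker]] using matrix_repD(1)[OF r g] by (simp add: mat_trace_def)
  finally have "of_nat (card N) * mat_trace (\<rho> g) = 0" .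
  moreover have "card N \<noteq> 0"
  proof -
    have "finite N" by (rule finite_subset[OF _ fin]) (use normal_carrier[OF N] in auto)
    then show ?thesis using subgroup.one_closed[OF normal_imp_subgroup[OF N]] by auto
  qed
  ultimately show ?thesis using \<chi>[OF g] by simp
qed

text \<open>By Schur's lemma the sum of all conjugates of \<open>g\<close> acts as a scalar, and this scalar is proportional
  to \<open>\<chi> g\<close>; so it acts as zero wherever \<open>\<chi> g\<close> vanishes.\<close>
lemma sum_over_class_translate:
  assumes fin: "finite (carrier G)" and irr: "irreducible_rep G d \<rho>" and g: "g \<in> carrier G"
    and zero: "mat_trace (\<rho> g) = 0" and y: "y \<in> carrier G"
  shows "(\<Sum>x\<in>carrier G. mat_trace (\<rho> (x \<otimes> g \<otimes> inv x \<otimes> y))) = 0"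
proof -
  note r = irreducible_repD(1)[OF irr]
  note c = matrix_repD(1)[OF r] and m = matrix_repD(3)[OF r]
  define T where "T = msum d (carrier G) (\<lambda>x. \<rho> (x \<otimes> g \<otimes> inv x))"
  have T: "T \<in> carrier_mat d d" by (simp add: T_def)
  have "T * \<rho> h = \<rho> h * T" if h: "h \<in> carrier G" for h
  proof -
    have bij: "bij_betw (\<lambda>x. h \<otimes> x) (carrier G) (carrier G)"
      using h by (intro bij_betw_byWitness[of _ "\<lambda>x. inv h \<otimes> x"]) (auto simp: cancel_left)
    have "T = msum d (carrier G) (\<lambda>x. \<rho> ((h \<otimes> x) \<otimes> g \<otimes> inv (h \<otimes> x)))"
      unfolding T_def by (rule msum_reindex[OF bij])
    then have "T * \<rho> h = msum d (carrier G) (\<lambda>x. \<rho> ((h \<otimes> x) \<otimes> g \<otimes> inv (h \<otimes> x)) * \<rho> h)"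
      using c g h by (simp add: msum_mult)
    also have "\<dots> = msum d (carrier G) (\<lambda>x. \<rho> h * \<rho> (x \<otimes> g \<otimes> inv x))"
    proof (rule msum_cong)
      fix x assume x: "x \<in> carrier G"
      have "\<rho> ((h \<otimes> x) \<otimes> g \<otimes> inv (h \<otimes> x)) * \<rho> h = \<rho> ((h \<otimes> x) \<otimes> g \<otimes> inv (h \<otimes> x) \<otimes> h)"
        using x g h by (intro m[symmetric]) auto
      also have "(h \<otimes> x) \<otimes> g \<otimes> inv (h \<otimes> x) \<otimes> h = h \<otimes> (x \<otimes> g \<otimes> inv x)"
        using x g h by (simp add: group_normalize)
      also have "\<rho> \<dots> = \<rho> h * \<rho> (x \<otimes> g \<otimes> inv x)" using x g h by (intro m) auto
      finally show "\<rho> ((h \<otimes> x) \<otimes> g \<otimes> inv (h \<otimes> x)) * \<rho> h = \<rho> h * \<rho> (x \<otimes> g \<otimes> inv x)" .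
    qed
    also have "\<dots> = \<rho> h * T" unfolding T_def using c g h by (intro mult_msum[symmetric]) auto
    finally show ?thesis .
  qed
  then obtain k where k: "T = k \<cdot>\<^sub>m 1\<^sub>m d" using schur_lemma[OF irr T] by blast
  have "mat_trace T = (\<Sum>x\<in>carrier G. mat_trace (\<rho> (x \<otimes> g \<otimes> inv x)))"
    unfolding T_def using c g by (intro mat_trace_msum) auto
  also have "\<dots> = 0" using character_class_function[OF r g] zero by simp
  finally have "k = 0" using irreducible_repD(2)[OF irr] by (simp add: k)
  then have "T * \<rho> y = 0\<^sub>m d d" using c[OF y] unfolding k by (intro eq_matI) (auto simp: scalar_prod_def)
  moreover have "T * \<rho> y = msum d (carrier G) (\<lambda>x. \<rho> (x \<otimes> g \<otimes> inv x) * \<rho> y)"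
    unfolding T_def using c g y by (intro msum_mult) auto
  moreover have "\<dots> = msum d (carrier G) (\<lambda>x. \<rho> (x \<otimes> g \<otimes> inv x \<otimes> y))"
    using m g y by (intro msum_cong) auto
  moreover have "mat_trace \<dots> = (\<Sum>x\<in>carrier G. mat_trace (\<rho> (x \<otimes> g \<otimes> inv x \<otimes> y)))"
    using c g y by (intro mat_trace_msum) auto
  ultimately show ?thesis by (simp add: mat_trace_def)
qed

text \<open>Let \<open>K\<close> be the sum of \<open>x g x\<inverse>\<close> over all group elements \<open>x\<close> and \<open>\<Sigma>\<close> the sum of the elements of \<open>N\<close>, in the group
  algebra. The element \<open>K (|N| - \<Sigma>)\<close> acts as zero in every irreducible representation: if
  \<open>N\<close> is in the kernel, the second factor vanishes, and otherwise \<open>\<chi> g = 0\<close> makes the first factor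
  vanish. Hence all its coefficients vanish, so that the set of conjugates of \<open>g\<close> is closed under multiplication by \<open>N\<close>.\<close>
lemma absorbs_if_Irr_over_vanishes:
  assumes fin: "finite (carrier G)" and N: "N \<lhd> G" and g: "g \<in> carrier G"
    and vanish: "\<And>\<chi>. \<chi> \<in> Irr_over G N \<Longrightarrow> \<chi> g = 0"
  shows "class_absorbs G g N"
  unfolding class_absorbs_def
proof (intro ballI, rule ccontr)
  fix n assume n: "n \<in> N" and not: "\<not> conj_in G g (g \<otimes> n)"
  have Nc: "m \<in> carrier G" if "m \<in> N" for m by (rule normal_carrier[OF N that])
  have finN: "finite N" by (rule finite_subset[OF _ fin]) (use Nc in auto)
  have oneN: "\<one> \<in> N" by (rule subgroup.one_closed[OF normal_imp_subgroup[OF N]])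
  define h where "h = g \<otimes> n"
  have h: "h \<in> carrier G" using g Nc n by (simp add: h_def)
  \<comment> \<open>The coefficients and group elements of \<open>K (|N| - \<Sigma>) h\<inverse>\<close>, whose coefficient at the identity is
    the one of \<open>K (|N| - \<Sigma>)\<close> at \<open>h\<close>.\<close>
  define c :: "'a \<times> 'a \<Rightarrow> complex" where "c = (\<lambda>(x, m). (if m = \<one> then of_nat (card N) else 0) - 1)"
  define y where "y = (\<lambda>(x, m). x \<otimes> g \<otimes> inv x \<otimes> (m \<otimes> inv h))"
  have main: "(\<Sum>i\<in>carrier G \<times> N. c i * \<chi> (y i)) = 0" if \<chi>I: "\<chi> \<in> Irr G" for \<chi>
  proof -
    obtain d \<rho> where irr: "irreducible_rep G d \<rho>" and \<chi>: "\<And>g. g \<in> carrier G \<Longrightarrow> \<chi> g = mat_trace (\<rho> g)"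
      and ker: "char_ker G \<chi> = {g \<in> carrier G. \<rho> g = 1\<^sub>m d}"
      using Irr_repE[OF fin \<chi>I] by blast
    note r = irreducible_repD(1)[OF irr]
    have yx: "(\<Sum>m\<in>N. c (x, m) * \<chi> (y (x, m))) = of_nat (card N) * \<chi> (x \<otimes> g \<otimes> inv x \<otimes> inv h)
        - (\<Sum>m\<in>N. \<chi> (x \<otimes> g \<otimes> inv x \<otimes> (m \<otimes> inv h)))" (is "?lhs = ?rhs") if x: "x \<in> carrier G" for x
    proof -
      have "?lhs = (\<Sum>m\<in>N. (if m = \<one> then of_nat (card N) * \<chi> (x \<otimes> g \<otimes> inv x \<otimes> (m \<otimes> inv h)) else 0)
          - \<chi> (x \<otimes> g \<otimes> inv x \<otimes> (m \<otimes> inv h)))"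
        by (intro sum.cong) (auto simp: c_def y_def left_diff_distrib)
      also have "\<dots> = ?rhs" using finN oneN h by (simp add: sum_subtractf)
      finally show ?thesis .
    qed
    have split: "(\<Sum>i\<in>carrier G \<times> N. c i * \<chi> (y i))
        = (\<Sum>x\<in>carrier G. of_nat (card N) * \<chi> (x \<otimes> g \<otimes> inv x \<otimes> inv h)
            - (\<Sum>m\<in>N. \<chi> (x \<otimes> g \<otimes> inv x \<otimes> (m \<otimes> inv h))))"
      using yx by (simp add: sum.cartesian_product' )
    show ?thesis
    proof (cases "N \<subseteq> char_ker G \<chi>")
      case True
      have "\<chi> (x \<otimes> g \<otimes> inv x \<otimes> (m \<otimes> inv h)) = \<chi> (x \<otimes> g \<otimes> inv x \<otimes> inv h)"
        if x: "x \<in> carrier G" and m: "m \<in> N" for x m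
      proof -
        have "\<rho> m = 1\<^sub>m d" using ker True m by auto
        then have "\<rho> (m \<otimes> inv h) = \<rho> (inv h)"
          using matrix_repD(3)[OF r Nc[OF m], of "inv h"] left_mult_one_mat[OF matrix_repD(1)[OF r, of "inv h"]] h
          by simp
        then show ?thesis
          using x g h Nc[OF m] matrix_repD(3)[OF r, of "x \<otimes> g \<otimes> inv x"] by (simp add: \<chi>)
      qed
      then show ?thesis unfolding split by simp
    next
      case False
      then have "\<chi> g = 0" using vanish \<chi>I by (simp add: Irr_over_def)
      then have z: "mat_trace (\<rho> g) = 0" using \<chi> g by simp
      have 0: "(\<Sum>x\<in>carrier G. \<chi> (x \<otimes> g \<otimes> inv x \<otimes> u)) = 0" if u: "u \<in> carrier G" for u
        using sum_over_class_translate[OF fin irr g z u] g u by (simp add: \<chi>)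
      have "(\<Sum>x\<in>carrier G. \<Sum>m\<in>N. \<chi> (x \<otimes> g \<otimes> inv x \<otimes> (m \<otimes> inv h))) = 0"
        using 0 h Nc by (subst sum.swap) simp
      then show ?thesis
        unfolding split using 0[of "inv h"] h by (simp add: sum_subtractf flip: sum_distrib_left)
    qed
  qed
  have yc: "y i \<in> carrier G" if "i \<in> carrier G \<times> N" for i
    using that g h Nc by (auto simp: y_def)
  have sum0: "(\<Sum>i\<in>carrier G \<times> N. if y i = \<one> then c i else 0) = 0"
    by (rule Irr_separate[where y = y and c = c, OF fin finite_cartesian_product[OF fin finN] yc main])
  \<comment> \<open>If \<open>h\<close> is no conjugate of \<open>g\<close>, only the terms from \<open>-\<Sigma>\<close> reach the identity, and these cannot cancel.\<close>
  have "(if y i = \<one> then c i else 0) = (if y i = \<one> then -1 else 0)" if i: "i \<in> carrier G \<times> N" for i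
  proof -
    obtain x m where xm: "i = (x, m)" "x \<in> carrier G" "m \<in> N" using i by auto
    have "y i \<noteq> \<one>" if "m = \<one>"
    proof
      assume "y i = \<one>"
      then have "(x \<otimes> g \<otimes> inv x) \<otimes> inv h = \<one>" using that xm h by (simp add: y_def)
      then have "x \<otimes> g \<otimes> inv x = h"
        using xm g h by (metis inv_closed inv_equality inv_inv m_closed)
      then show False using not xm by (auto simp: conj_in_def h_def)
    qed
    then show ?thesis using xm by (auto simp: c_def)
  qed
  then have "(\<Sum>i\<in>carrier G \<times> N. if y i = \<one> then c i else 0) = (\<Sum>i\<in>carrier G \<times> N. if y i = \<one> then -1 else 0)"
    by (rule sum.cong[OF refl])
  also have "\<dots> = - of_nat (card {i \<in> carrier G \<times> N. y i = \<one>})"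
    using sum.inter_filter[OF finite_cartesian_product[OF fin finN], of "\<lambda>_. -1 :: complex" "\<lambda>i. y i = \<one>"]
    by simp
  finally have "card {i \<in> carrier G \<times> N. y i = \<one>} = 0" using sum0 by simp
  moreover have "(\<one>, n) \<in> {i \<in> carrier G \<times> N. y i = \<one>}"
    using n g Nc[OF n] by (simp add: y_def h_def m_assoc[symmetric])
  moreover have "finite {i \<in> carrier G \<times> N. y i = \<one>}" using fin finN by simp
  ultimately show False by (simp only: card_0_eq) blast
qed

text \<open>The sum over \<open>N\<close> minus the sum over \<open>xN\<close> has coefficient 1 at the identity, so some irreducible
  character \<open>\<chi>\<close> does not send it to zero. Then the sum over \<open>N\<close> acts nontrivially, which puts \<open>N\<close> into the kernel, and
  \<open>x\<close> acts nontrivially.\<close>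
lemma exists_Irr_separating:
  assumes fin: "finite (carrier G)" and N: "N \<lhd> G" and x: "x \<in> carrier G" "x \<notin> N"
  obtains \<chi> where "\<chi> \<in> Irr G" "N \<subseteq> char_ker G \<chi>" "x \<notin> char_ker G \<chi>"
proof -
  have Nc: "m \<in> carrier G" if "m \<in> N" for m by (rule normal_carrier[OF N that])
  have finN: "finite N" by (rule finite_subset[OF _ fin]) (use Nc in auto)
  note sub = normal_imp_subgroup[OF N]
  have oneN: "\<one> \<in> N" by (rule subgroup.one_closed[OF sub])
  define xN where "xN = (\<lambda>n. x \<otimes> n) ` N"
  have inj: "inj_on (\<lambda>n. x \<otimes> n) N" using x Nc by (auto simp: inj_on_def)
  have disj: "N \<inter> xN = {}"
  proof -
    have "x \<otimes> n \<notin> N" if n: "n \<in> N" for n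
    proof
      assume "x \<otimes> n \<in> N"
      then have "(x \<otimes> n) \<otimes> inv n \<in> N" by (rule subgroup.m_closed[OF sub _ subgroup.m_inv_closed[OF sub n]])
      then show False using x Nc[OF n] by (simp add: m_assoc)
    qed
    then show ?thesis by (auto simp: xN_def)
  qed
  define c :: "'a \<Rightarrow> complex" where "c g = (if g \<in> N then 1 else -1)" for g
  have "(\<Sum>i\<in>N \<union> xN. if i = \<one> then c i else 0) = 1"
    using finN oneN by (simp add: xN_def c_def)
  then have "\<exists>\<chi>\<in>Irr G. (\<Sum>i\<in>N \<union> xN. c i * \<chi> i) \<noteq> 0"
    using Irr_separate[OF fin, of "N \<union> xN" "\<lambda>i. i" c] finN Nc x by (auto simp: xN_def)
  then obtain \<chi> where \<chi>I: "\<chi> \<in> Irr G" and nz: "(\<Sum>i\<in>N \<union> xN. c i * \<chi> i) \<noteq> 0" by blast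
  obtain d \<rho> where irr: "irreducible_rep G d \<rho>" and \<chi>: "\<And>g. g \<in> carrier G \<Longrightarrow> \<chi> g = mat_trace (\<rho> g)"
    and ker: "char_ker G \<chi> = {g \<in> carrier G. \<rho> g = 1\<^sub>m d}"
    using Irr_repE[OF fin \<chi>I] by blast
  note r = irreducible_repD(1)[OF irr]
  have "(\<Sum>i\<in>N \<union> xN. c i * \<chi> i) = (\<Sum>i\<in>N. c i * \<chi> i) + (\<Sum>i\<in>xN. c i * \<chi> i)"
    using finN disj by (intro sum.union_disjoint) (auto simp: xN_def)
  also have "(\<Sum>i\<in>N. c i * \<chi> i) = (\<Sum>n\<in>N. mat_trace (\<rho> (\<one> \<otimes> n)))" using Nc by (simp add: c_def \<chi>)
  also have "(\<Sum>i\<in>xN. c i * \<chi> i) = (\<Sum>i\<in>xN. - \<chi> i)"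
    using disj by (intro sum.cong) (auto simp: c_def)
  also have "\<dots> = - (\<Sum>n\<in>N. mat_trace (\<rho> (x \<otimes> n)))"
    unfolding xN_def using x Nc by (simp add: sum.reindex[OF inj] \<chi> sum_negf)
  finally have diff: "mat_trace (\<rho> \<one> * msum d N \<rho>) \<noteq> mat_trace (\<rho> x * msum d N \<rho>)"
    using nz by (simp add: sum_characters_coset[OF r N] x)
  have "N \<subseteq> char_ker G \<chi>"
  proof (rule ccontr)
    assume "\<not> N \<subseteq> char_ker G \<chi>"
    then have 0: "msum d N \<rho> = 0\<^sub>m d d" unfolding ker by (rule normal_sum_zero[OF irr N])
    show False
      using diff right_mult_zero_mat[OF matrix_repD(1)[OF r x(1)]] right_mult_zero_mat[OF matrix_repD(1)[OF r one_closed]]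
      unfolding 0 by simp
  qed
  moreover have "x \<notin> char_ker G \<chi>" using diff matrix_repD(2)[OF r] by (auto simp: ker)
  ultimately show thesis using that \<chi>I by blast
qed

end

section \<open>Degrees, GVZ-groups and nested groups\<close>

context group
begin

text \<open>Row orthogonality for a single character: by Schur's lemma the sum of
  \<open>\<rho> g * E\<^bsub>ij\<^esub> * \<rho> (inv g)\<close> over all \<open>g\<close>, with \<open>E\<^bsub>ij\<^esub>\<close> a matrix unit, is a scalar matrix, known from its trace.\<close>
lemma character_norm:
  assumes fin: "finite (carrier G)" and irr: "irreducible_rep G d \<rho>"
  shows "(\<Sum>g\<in>carrier G. mat_trace (\<rho> g) * mat_trace (\<rho> (inv g))) = of_nat (card (carrier G))"
proof -
  note r = irreducible_repD(1)[OF irr] and d = irreducible_repD(2)[OF irr]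
  note c = matrix_repD(1)[OF r] and m = matrix_repD(3)[OF r]
  define U where "U i j = mat d d (\<lambda>(a, b). if a = i \<and> b = j then 1 else 0 :: complex)" for i j
  have U: "U i j \<in> carrier_mat d d" for i j by (simp add: U_def)
  define T where "T i j = msum d (carrier G) (\<lambda>g. \<rho> g * U i j * \<rho> (inv g))" for i j
  have T: "T i j \<in> carrier_mat d d" for i j by (simp add: T_def)
  have entry: "(\<rho> g * U i j * \<rho> (inv g)) $$ (i, j) = \<rho> g $$ (i, i) * \<rho> (inv g) $$ (j, j)"
    if "i < d" "j < d" "g \<in> carrier G" for i j g
  proof -
    have row: "(\<rho> g * U i j) $$ (i, l) = (if l = j then \<rho> g $$ (i, i) else 0)" if l: "l < d" for l
    proof -
      have "(\<rho> g * U i j) $$ (i, l) = (\<Sum>k<d. \<rho> g $$ (i, k) * U i j $$ (k, l))"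
        using \<open>i < d\<close> l by (intro mult_mat_index c \<open>g \<in> carrier G\<close> U)
      also have "\<dots> = (\<Sum>k<d. if k = i then (if l = j then \<rho> g $$ (i, i) else 0) else 0)"
        using l by (intro sum.cong) (auto simp: U_def)
      finally show ?thesis using \<open>i < d\<close> by simp
    qed
    have "(\<rho> g * U i j * \<rho> (inv g)) $$ (i, j) = (\<Sum>l<d. (\<rho> g * U i j) $$ (i, l) * \<rho> (inv g) $$ (l, j))"
      using that by (intro mult_mat_index c mult_carrier_mat[OF c U]) auto
    also have "\<dots> = (\<Sum>l<d. if l = j then \<rho> g $$ (i, i) * \<rho> (inv g) $$ (j, j) else 0)"
      by (intro sum.cong refl) (simp add: row del: index_mult_mat(1))
    finally show ?thesis using that by simp
  qed
  have T_entry: "T i j $$ (i, j) = (if i = j then of_nat (card (carrier G)) / of_nat d else 0)"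
    if ij: "i < d" "j < d" for i j
  proof -
    have "T i j * \<rho> h = \<rho> h * T i j" if h: "h \<in> carrier G" for h
    proof -
      have bij: "bij_betw (\<lambda>x. h \<otimes> x) (carrier G) (carrier G)"
        using h by (intro bij_betw_byWitness[of _ "\<lambda>x. inv h \<otimes> x"]) (auto simp: cancel_left)
      have "T i j = msum d (carrier G) (\<lambda>x. \<rho> (h \<otimes> x) * U i j * \<rho> (inv (h \<otimes> x)))"
        unfolding T_def by (rule msum_reindex[OF bij])
      then have "T i j * \<rho> h = msum d (carrier G) (\<lambda>x. \<rho> (h \<otimes> x) * U i j * \<rho> (inv (h \<otimes> x)) * \<rho> h)"
        using h by (simp only:) (intro msum_mult c mult_carrier_mat[OF mult_carrier_mat[OF c U] c], auto)
      also have "\<dots> = msum d (carrier G) (\<lambda>x. \<rho> h * (\<rho> x * U i j * \<rho> (inv x)))"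
      proof (rule msum_cong)
        fix x assume x: "x \<in> carrier G"
        have inv: "inv (h \<otimes> x) \<otimes> h = inv x" using x h by (simp add: group_normalize)
        have "(\<rho> (h \<otimes> x) * U i j) * \<rho> (inv (h \<otimes> x)) * \<rho> h = \<rho> (h \<otimes> x) * U i j * (\<rho> (inv (h \<otimes> x)) * \<rho> h)"
          using x h by (intro assoc_mult_mat[of _ d d _ d _ d] c mult_carrier_mat[OF c U]) auto
        also have "\<rho> (inv (h \<otimes> x)) * \<rho> h = \<rho> (inv x)" using m[of "inv (h \<otimes> x)" h] x h inv by simp
        also have "\<rho> (h \<otimes> x) * U i j * \<rho> (inv x) = \<rho> h * (\<rho> x * U i j) * \<rho> (inv x)"
          unfolding m[OF h x] by (simp only: assoc_mult_mat[OF c[OF h] c[OF x] U])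
        also have "\<rho> h * (\<rho> x * U i j) * \<rho> (inv x) = \<rho> h * (\<rho> x * U i j * \<rho> (inv x))"
          using x by (intro assoc_mult_mat[of _ d d _ d _ d] c h mult_carrier_mat[OF c U]) auto
        finally show "\<rho> (h \<otimes> x) * U i j * \<rho> (inv (h \<otimes> x)) * \<rho> h = \<rho> h * (\<rho> x * U i j * \<rho> (inv x))" .
      qed
      also have "\<dots> = \<rho> h * T i j"
        unfolding T_def using h by (intro mult_msum[symmetric] c mult_carrier_mat[OF mult_carrier_mat[OF c U] c]) auto
      finally show ?thesis .
    qed
    then obtain k where k: "T i j = k \<cdot>\<^sub>m 1\<^sub>m d" using schur_lemma[OF irr T] by blast
    have "mat_trace (T i j) = (\<Sum>g\<in>carrier G. mat_trace (\<rho> g * U i j * \<rho> (inv g)))"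
      unfolding T_def by (intro mat_trace_msum mult_carrier_mat[OF mult_carrier_mat[OF c U] c]) auto
    also have "\<dots> = (\<Sum>g\<in>carrier G. mat_trace (U i j))"
      by (intro sum.cong refl mat_trace_similar[where d = d] c U rep_inv(2)[OF r]) auto
    also have "mat_trace (U i j) = (if i = j then 1 else 0)"
    proof -
      have "mat_trace (U i j) = (\<Sum>a<d. if a = i then (if i = j then 1 else 0) else 0)"
        unfolding mat_trace_eq[OF U] by (intro sum.cong) (auto simp: U_def)
      then show ?thesis using ij by simp
    qed
    finally have "k * of_nat d = of_nat (card (carrier G)) * (if i = j then 1 else 0)" by (simp add: k)
    then show ?thesis using ij d by (auto simp: k field_simps)
  qed
  have "(\<Sum>g\<in>carrier G. mat_trace (\<rho> g) * mat_trace (\<rho> (inv g)))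
      = (\<Sum>g\<in>carrier G. \<Sum>i<d. \<Sum>j<d. \<rho> g $$ (i, i) * \<rho> (inv g) $$ (j, j))"
    by (intro sum.cong) (simp_all add: mat_trace_eq[OF c] sum_product)
  also have "\<dots> = (\<Sum>i<d. \<Sum>g\<in>carrier G. \<Sum>j<d. \<rho> g $$ (i, i) * \<rho> (inv g) $$ (j, j))" by (rule sum.swap)
  also have "\<dots> = (\<Sum>i<d. \<Sum>j<d. \<Sum>g\<in>carrier G. \<rho> g $$ (i, i) * \<rho> (inv g) $$ (j, j))"
    by (intro sum.cong refl sum.swap)
  also have "\<dots> = (\<Sum>i<d. \<Sum>j<d. T i j $$ (i, j))"
    by (intro sum.cong refl) (simp add: T_def msum_index entry)
  also have "\<dots> = (\<Sum>i<d. \<Sum>j<d. if i = j then of_nat (card (carrier G)) / of_nat d else 0)"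
    by (intro sum.cong refl) (simp add: T_entry)
  also have "\<dots> = of_nat (card (carrier G))" using d by simp
  finally show ?thesis .
qed

text \<open>On \<open>Z(\<chi>)\<close> each term \<open>\<chi> g * \<chi> (inv g)\<close> of the norm of \<open>\<chi>\<close> equals the squared degree, and elsewhere it vanishes.\<close>
lemma degree_square_center:
  assumes fin: "finite (carrier G)" and \<chi>I: "\<chi> \<in> Irr G"
    and vanish: "\<And>g. g \<in> carrier G \<Longrightarrow> g \<notin> char_center G \<chi> \<Longrightarrow> \<chi> g = 0"
  obtains d :: nat where "\<chi> \<one> = of_nat d" "0 < d" "d\<^sup>2 * card (char_center G \<chi>) = card (carrier G)"
proof -
  obtain d \<rho> where irr: "irreducible_rep G d \<rho>" and \<chi>: "\<And>g. g \<in> carrier G \<Longrightarrow> \<chi> g = mat_trace (\<rho> g)"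
    using IrrE[OF \<chi>I] by blast
  note r = irreducible_repD(1)[OF irr]
  have center: "char_center G \<chi> = {g \<in> carrier G. \<exists>c. cmod c = 1 \<and> \<rho> g = c \<cdot>\<^sub>m 1\<^sub>m d}"
    by (rule character_of_rep(3)[where \<chi> = \<chi>, OF fin irr \<chi>])
  have one: "\<chi> \<one> = of_nat d" using \<chi> matrix_repD(2)[OF r] by simp
  have z: "mat_trace (\<rho> g) * mat_trace (\<rho> (inv g)) = (of_nat d)\<^sup>2" if g: "g \<in> char_center G \<chi>" for g
  proof -
    have gc: "g \<in> carrier G" using g center by simp
    obtain c where c: "\<rho> g = c \<cdot>\<^sub>m 1\<^sub>m d" using g center by auto
    note i = matrix_repD(1)[OF r inv_closed[OF gc]]
    have "c \<cdot>\<^sub>m \<rho> (inv g) = \<rho> g * \<rho> (inv g)"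
      unfolding c mult_smult_assoc_mat[OF one_carrier_mat i] left_mult_one_mat[OF i] ..
    then have "mat_trace (c \<cdot>\<^sub>m \<rho> (inv g)) = of_nat d" using rep_inv[OF r gc] by simp
    then have "c * mat_trace (\<rho> (inv g)) = of_nat d"
      using i by (simp add: mat_trace_eq[of _ d] sum_distrib_left)
    then show ?thesis by (simp add: c power2_eq_square mult.commute mult.left_commute)
  qed
  have "of_nat (card (carrier G)) = (\<Sum>g\<in>carrier G. mat_trace (\<rho> g) * mat_trace (\<rho> (inv g)))"
    by (rule character_norm[OF fin irr, symmetric])
  also have "\<dots> = (\<Sum>g\<in>char_center G \<chi>. mat_trace (\<rho> g) * mat_trace (\<rho> (inv g)))"
    using fin vanish \<chi> by (intro sum.mono_neutral_right) (auto simp: center)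
  also have "\<dots> = of_nat (card (char_center G \<chi>)) * (of_nat d)\<^sup>2" using z by simp
  also have "\<dots> = of_nat (d\<^sup>2 * card (char_center G \<chi>))" by simp
  finally have "d\<^sup>2 * card (char_center G \<chi>) = card (carrier G)" by (metis of_nat_eq_iff)
  then show thesis using that one irreducible_repD(2)[OF irr] by blast
qed

lemma char_van_eq_center_iff:
  assumes fin: "finite (carrier G)" and \<chi>I: "\<chi> \<in> Irr G"
  shows "char_van G \<chi> = char_center G \<chi> \<longleftrightarrow> (\<forall>g\<in>carrier G. g \<notin> char_center G \<chi> \<longrightarrow> \<chi> g = 0)"
proof
  assume e: "char_van G \<chi> = char_center G \<chi>"
  show "\<forall>g\<in>carrier G. g \<notin> char_center G \<chi> \<longrightarrow> \<chi> g = 0"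
    unfolding e[symmetric] char_van_def by (auto intro: generate.incl)
next
  assume v: "\<forall>g\<in>carrier G. g \<notin> char_center G \<chi> \<longrightarrow> \<chi> g = 0"
  have sub: "subgroup (char_center G \<chi>) G"
    unfolding char_center_iff[OF assms]
    by (rule elements_with_commutators_in_subgroup[OF char_ker_normal[OF assms]])
  obtain d where d: "\<chi> \<one> = of_nat d" "0 < d"
    using degree_square_center[OF assms] v by blast
  show "char_van G \<chi> = char_center G \<chi>"
  proof
    show "char_van G \<chi> \<subseteq> char_center G \<chi>"
      unfolding char_van_def using v by (intro generate_subgroup_incl sub) auto
    show "char_center G \<chi> \<subseteq> char_van G \<chi>"
      unfolding char_van_def using d by (auto simp: char_center_def intro!: generate.incl)
  qed
qed

text \<open>An element \<open>g\<close> is outside \<open>Z(\<chi>)\<close> iff \<open>\<chi>\<close> lies over \<open>[g, G]\<close>; so the GVZ condition at \<open>g\<close> is the vanishing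
  of \<open>Irr(G | [g, G])\<close> at \<open>g\<close>.\<close>
lemma GVZ_group_iff:
  assumes fin: "finite (carrier G)"
  shows "GVZ_group G \<longleftrightarrow> (\<forall>g\<in>carrier G. class_absorbs G g (element_commutators G g))"
proof -
  have "GVZ_group G \<longleftrightarrow> (\<forall>\<chi>\<in>Irr G. \<forall>g\<in>carrier G. \<not> element_commutators G g \<subseteq> char_ker G \<chi> \<longrightarrow> \<chi> g = 0)"
    unfolding GVZ_group_def
  proof (intro ball_cong refl)
    fix \<chi> assume \<chi>: "\<chi> \<in> Irr G"
    show "char_van G \<chi> = char_center G \<chi>
        \<longleftrightarrow> (\<forall>g\<in>carrier G. \<not> element_commutators G g \<subseteq> char_ker G \<chi> \<longrightarrow> \<chi> g = 0)"
      using char_van_eq_center_iff[OF fin \<chi>] unfolding char_center_iff[OF fin \<chi>] by auto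
  qed
  also have "\<dots> \<longleftrightarrow> (\<forall>g\<in>carrier G. \<forall>\<chi>\<in>Irr_over G (element_commutators G g). \<chi> g = 0)"
    by (auto simp: Irr_over_def)
  also have "\<dots> \<longleftrightarrow> (\<forall>g\<in>carrier G. class_absorbs G g (element_commutators G g))"
    using Irr_over_vanishes_if_absorbs[OF fin element_commutators_normal]
      absorbs_if_Irr_over_vanishes[OF fin element_commutators_normal] by (intro ball_cong refl) metis
  finally show ?thesis .
qed

text \<open>If \<open>[g, G]\<close> is not below \<open>[h, G]\<close>, a character with \<open>[h, G]\<close> but not \<open>[g, G]\<close> in its kernel has \<open>h\<close> but
  not \<open>g\<close> in its centre; so incomparable subgroups \<open>[g, G]\<close> yield incomparable centres, and conversely.\<close>
lemma nested_group_iff: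
  assumes fin: "finite (carrier G)"
  shows "nested_group G \<longleftrightarrow> (\<forall>g\<in>carrier G. \<forall>h\<in>carrier G.
    element_commutators G g \<subseteq> element_commutators G h \<or> element_commutators G h \<subseteq> element_commutators G g)"
    (is "_ \<longleftrightarrow> ?chain")
proof
  assume nested: "nested_group G"
  have sep: "\<exists>X\<in>char_centers G. h \<in> X \<and> g \<notin> X"
    if g: "g \<in> carrier G" and h: "h \<in> carrier G" and nsub: "\<not> element_commutators G g \<subseteq> element_commutators G h" for g h
  proof -
    obtain x where x: "x \<in> element_commutators G g" "x \<notin> element_commutators G h" using nsub by blast
    have xc: "x \<in> carrier G" by (rule normal_carrier[OF element_commutators_normal[OF g] x(1)])
    obtain \<chi> where \<chi>: "\<chi> \<in> Irr G" "element_commutators G h \<subseteq> char_ker G \<chi>" "x \<notin> char_ker G \<chi>"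
      using exists_Irr_separating[OF fin element_commutators_normal[OF h] xc x(2)] by blast
    then have "h \<in> char_center G \<chi>" "g \<notin> char_center G \<chi>"
      using x(1) h by (auto simp: char_center_iff[OF fin])
    then show ?thesis using \<chi>(1) by (auto simp: char_centers_def)
  qed
  show ?chain
  proof (intro ballI, rule ccontr)
    fix g h assume gh: "g \<in> carrier G" "h \<in> carrier G"
      and not: "\<not> (element_commutators G g \<subseteq> element_commutators G h \<or> element_commutators G h \<subseteq> element_commutators G g)"
    obtain X Y where "X \<in> char_centers G" "h \<in> X" "g \<notin> X" "Y \<in> char_centers G" "g \<in> Y" "h \<notin> Y"
      using sep[OF gh] sep[OF gh(2,1)] not by blast
    then show False using nested unfolding nested_group_def chain_subset_def by blast
  qed
next
  assume chain: ?chain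
  have "char_center G \<chi> \<subseteq> char_center G \<psi> \<or> char_center G \<psi> \<subseteq> char_center G \<chi>"
    if "\<chi> \<in> Irr G" "\<psi> \<in> Irr G" for \<chi> \<psi>
  proof (rule ccontr)
    assume "\<not> ?thesis"
    then obtain g h where "g \<in> char_center G \<chi>" "g \<notin> char_center G \<psi>" "h \<in> char_center G \<psi>" "h \<notin> char_center G \<chi>"
      by blast
    then have "g \<in> carrier G" "h \<in> carrier G" "element_commutators G g \<subseteq> char_ker G \<chi>"
      "\<not> element_commutators G g \<subseteq> char_ker G \<psi>" "element_commutators G h \<subseteq> char_ker G \<psi>"
      "\<not> element_commutators G h \<subseteq> char_ker G \<chi>"
      unfolding char_center_iff[OF fin that(1)] char_center_iff[OF fin that(2)] by auto
    then show False using chain by blast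
  qed
  then show "nested_group G" unfolding nested_group_def chain_subset_def char_centers_def by blast
qed

lemma V_sub_eq:
  assumes fin: "finite (carrier G)" and N: "N \<lhd> G"
  shows "V_sub G N = generate G {g \<in> carrier G. \<not> class_absorbs G g N}"
proof -
  have "(\<exists>\<chi>\<in>Irr_over G N. \<chi> g \<noteq> 0) \<longleftrightarrow> \<not> class_absorbs G g N" if "g \<in> carrier G" for g
    using Irr_over_vanishes_if_absorbs[OF fin N that] absorbs_if_Irr_over_vanishes[OF fin N that] by metis
  then show ?thesis unfolding V_sub_def by (metis (mono_tags, lifting) Collect_cong)
qed

end

section \<open>The ascending and the descending series\<close>

context group
begin

text \<open>An elementwise description of \<open>U(G)\<close>.\<close>
definition U_center :: "'a set" where
  "U_center = {u \<in> carrier G. \<forall>g\<in>carrier G - group_center G. conj_in G g (g \<otimes> u)}"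

text \<open>Closure under products: if \<open>g\<close> is not central, then neither is its conjugate \<open>g \<otimes> u\<close>, so
  \<open>v\<close> can be absorbed after \<open>u\<close>. Inverses are powers, as the group is finite.\<close>
lemma U_center_normal:
  assumes fin: "finite (carrier G)"
  shows "U_center \<lhd> G"
proof -
  have noncentral: "h \<in> carrier G - group_center G" if "g \<in> carrier G - group_center G" "conj_in G g h" for g h
    using that conj_in_closed conj_in_sym group_center_conj_in by (metis Diff_iff)
  have c: "u \<in> carrier G" if "u \<in> U_center" for u using that by (simp add: U_center_def)
  have m: "u \<otimes> v \<in> U_center" if u: "u \<in> U_center" and v: "v \<in> U_center" for u v
  proof -
    have "conj_in G g (g \<otimes> (u \<otimes> v))" if g: "g \<in> carrier G - group_center G" for g
    proof -
      have 1: "conj_in G g (g \<otimes> u)" using u g by (simp add: U_center_def)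
      then have "conj_in G (g \<otimes> u) (g \<otimes> u \<otimes> v)" using v noncentral[OF g] by (simp add: U_center_def)
      then show ?thesis using conj_in_trans 1 g c[OF u] c[OF v] by (simp add: m_assoc)
    qed
    then show ?thesis using c[OF u] c[OF v] by (simp add: U_center_def)
  qed
  have one: "\<one> \<in> U_center" by (simp add: U_center_def conj_in_refl)
  have i: "inv u \<in> U_center" if u: "u \<in> U_center" for u
  proof -
    have p: "u [^] (k :: nat) \<in> U_center" for k by (induction k) (auto simp: one m u)
    obtain k where k: "Coset.order G = Suc k" using fin order_gt_0_iff_finite gr0_implies_Suc by blast
    have "u [^] k \<otimes> u = \<one>" using pow_order_eq_1[OF c[OF u]] k by simp
    then have "inv u = u [^] k" using c[OF u] by (intro inv_equality) auto
    then show ?thesis using p by simp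
  qed
  have n: "y \<otimes> u \<otimes> inv y \<in> U_center" if y: "y \<in> carrier G" and u: "u \<in> U_center" for y u
  proof -
    have "conj_in G g (g \<otimes> (y \<otimes> u \<otimes> inv y))" if g: "g \<in> carrier G - group_center G" for g
    proof -
      define h where "h = inv y \<otimes> g \<otimes> y"
      have hc: "h \<in> carrier G" using y g by (simp add: h_def)
      have gh: "conj_in G g h" unfolding conj_in_def using y by (intro bexI[of _ "inv y"]) (auto simp: h_def)
      have "conj_in G h (h \<otimes> u)" using u noncentral[OF g gh] by (simp add: U_center_def)
      moreover have "conj_in G (h \<otimes> u) (g \<otimes> (y \<otimes> u \<otimes> inv y))"
        unfolding conj_in_def using y g c[OF u] by (intro bexI[of _ y]) (auto simp: h_def group_normalize)
      ultimately show ?thesis using conj_in_trans gh g hc by (metis Diff_iff)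
    qed
    then show ?thesis using y c[OF u] by (simp add: U_center_def)
  qed
  have "subgroup U_center G" using one m i c by (intro subgroupI) auto
  then show ?thesis using n by (simp add: normal_inv_iff)
qed

lemma U_sub_center_eq:
  assumes fin: "finite (carrier G)"
  shows "U_sub G (group_center G) = U_center"
proof
  have "H \<subseteq> U_center" if H: "H \<lhd> G" "V_sub G H \<subseteq> group_center G" for H
  proof
    fix u assume u: "u \<in> H"
    have "class_absorbs G g H" if g: "g \<in> carrier G - group_center G" for g
    proof (rule ccontr)
      assume "\<not> class_absorbs G g H"
      then have "g \<in> V_sub G H" unfolding V_sub_eq[OF fin H(1)] using g by (intro generate.incl) simp
      then show False using H(2) g by blast
    qed
    then show "u \<in> U_center" using u normal_carrier[OF H(1) u] by (simp add: U_center_def class_absorbs_def)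
  qed
  then show "U_sub G (group_center G) \<subseteq> U_center"
    unfolding U_sub_def by (intro generate_subgroup_incl normal_imp_subgroup[OF U_center_normal[OF fin]]) blast
  have "V_sub G U_center \<subseteq> group_center G"
    unfolding V_sub_eq[OF fin U_center_normal[OF fin]]
    by (intro generate_subgroup_incl group_center_subgroup) (auto simp: class_absorbs_def U_center_def)
  then show "U_center \<subseteq> U_sub G (group_center G)"
    unfolding U_sub_def using U_center_normal[OF fin] by (auto intro!: generate.incl)
qed

lemma coset_eq_iff:
  assumes N: "N \<lhd> G" and ab: "a \<in> carrier G" "b \<in> carrier G"
  shows "N #> a = N #> b \<longleftrightarrow> a \<otimes> inv b \<in> N"
proof -
  note sub = normal_imp_subgroup[OF N]
  have "N #> a = N #> b \<longleftrightarrow> a \<in> N #> b"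
    using rcos_self[OF ab(1) sub] repr_independence[OF _ ab(2) sub] by blast
  also have "\<dots> \<longleftrightarrow> a \<otimes> inv b \<in> N" by (rule subgroup.rcos_module[OF sub group_axioms ab(2,1)])
  finally show ?thesis .
qed

lemma quotient_hom: "N \<lhd> G \<Longrightarrow> group_hom G (G Mod N) (\<lambda>a. N #> a)"
  unfolding group_hom_def group_hom_axioms_def
  by (simp add: group_axioms normal.factorgroup_is_group normal.r_coset_hom_Mod)

lemma carrier_quotient: "carrier (G Mod N) = (\<lambda>a. N #> a) ` carrier G"
  by (auto simp: FactGroup_def RCOSETS_def)

lemma conj_in_quotient:
  assumes N: "N \<lhd> G" and gh: "g \<in> carrier G" "h \<in> carrier G"
  shows "conj_in (G Mod N) (N #> g) (N #> h) \<longleftrightarrow> (\<exists>x\<in>carrier G. \<exists>n\<in>N. x \<otimes> g \<otimes> inv x = h \<otimes> n)"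
proof -
  interpret Q: group_hom G "G Mod N" "\<lambda>a. N #> a" by (rule quotient_hom[OF N])
  have "N #> (x \<otimes> g \<otimes> inv x) = (N #> x) \<otimes>\<^bsub>G Mod N\<^esub> (N #> g) \<otimes>\<^bsub>G Mod N\<^esub> inv\<^bsub>G Mod N\<^esub> (N #> x)"
    if x: "x \<in> carrier G" for x
    using Q.hom_mult[of "x \<otimes> g" "inv x"] Q.hom_mult[of x g] Q.hom_inv[OF x] x gh by simp
  then have "conj_in (G Mod N) (N #> g) (N #> h) \<longleftrightarrow> (\<exists>x\<in>carrier G. N #> (x \<otimes> g \<otimes> inv x) = N #> h)"
    unfolding conj_in_def carrier_quotient by simp
  also have "\<dots> \<longleftrightarrow> (\<exists>x\<in>carrier G. \<exists>n\<in>N. x \<otimes> g \<otimes> inv x = h \<otimes> n)"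
  proof (rule bex_cong[OF refl])
    fix x assume x: "x \<in> carrier G"
    define k where "k = x \<otimes> g \<otimes> inv x"
    have k: "k \<in> carrier G" using x gh by (simp add: k_def)
    have "N #> k = N #> h \<longleftrightarrow> k \<otimes> inv h \<in> N" by (rule coset_eq_iff[OF N k gh(2)])
    also have "\<dots> \<longleftrightarrow> (\<exists>n\<in>N. k = h \<otimes> n)"
    proof
      assume "k \<otimes> inv h \<in> N"
      then have "inv h \<otimes> (k \<otimes> inv h) \<otimes> h \<in> N" by (rule normal_conj_closed(2)[OF N gh(2)])
      moreover have "k = h \<otimes> (inv h \<otimes> (k \<otimes> inv h) \<otimes> h)" using k gh by (simp add: group_normalize)
      ultimately show "\<exists>n\<in>N. k = h \<otimes> n" by blast
    next
      assume "\<exists>n\<in>N. k = h \<otimes> n"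
      then show "k \<otimes> inv h \<in> N" using normal_conj_closed(1)[OF N gh(2)] by auto
    qed
    finally show "N #> (x \<otimes> g \<otimes> inv x) = N #> h \<longleftrightarrow> (\<exists>n\<in>N. x \<otimes> g \<otimes> inv x = h \<otimes> n)" by (simp add: k_def)
  qed
  finally show ?thesis .
qed

lemma center_quotient:
  assumes N: "N \<lhd> G" and g: "g \<in> carrier G"
  shows "N #> g \<in> group_center (G Mod N) \<longleftrightarrow> element_commutators G g \<subseteq> N"
proof -
  interpret Q: group_hom G "G Mod N" "\<lambda>a. N #> a" by (rule quotient_hom[OF N])
  have "N #> g \<in> group_center (G Mod N) \<longleftrightarrow> (\<forall>x\<in>carrier G. N #> (g \<otimes> x) = N #> (x \<otimes> g))"
    unfolding group_center_def carrier_quotient using g by (simp add: Q.hom_mult)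
  also have "\<dots> \<longleftrightarrow> (\<forall>x\<in>carrier G. g \<otimes> x \<otimes> inv g \<otimes> inv x \<in> N)"
  proof (rule ball_cong[OF refl])
    fix x assume x: "x \<in> carrier G"
    have "g \<otimes> x \<otimes> inv (x \<otimes> g) = g \<otimes> x \<otimes> inv g \<otimes> inv x" using g x by (simp add: group_normalize)
    then show "N #> (g \<otimes> x) = N #> (x \<otimes> g) \<longleftrightarrow> g \<otimes> x \<otimes> inv g \<otimes> inv x \<in> N"
      using coset_eq_iff[OF N, of "g \<otimes> x" "x \<otimes> g"] g x by simp
  qed
  also have "\<dots> \<longleftrightarrow> element_commutators G g \<subseteq> N"
    by (rule element_commutators_subset_iff[OF normal_imp_subgroup[OF N], symmetric])
  finally show ?thesis .
qed

text \<open>The description of \<open>U(G / \<upsilon>\<^bsub>i\<^esub>)\<close> pulled back to \<open>G\<close>: whenever \<open>g\<close> is not central modulo \<open>\<upsilon>\<^bsub>i\<^esub>\<close>, the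
  element \<open>g \<otimes> u\<close> is conjugate to \<open>g\<close> modulo \<open>\<upsilon>\<^bsub>i\<^esub>\<close>.\<close>
lemma upsilon_Suc_eq:
  assumes fin: "finite (carrier G)" and N: "upsilon G i \<lhd> G"
  shows "upsilon G (Suc i) = {u \<in> carrier G. \<forall>g\<in>carrier G. \<not> element_commutators G g \<subseteq> upsilon G i \<longrightarrow>
    (\<exists>x\<in>carrier G. \<exists>n\<in>upsilon G i. x \<otimes> g \<otimes> inv x = g \<otimes> u \<otimes> n)}" (is "_ = ?R")
    and "upsilon G (Suc i) \<lhd> G"
proof -
  define N' where "N' = upsilon G i"
  have N: "N' \<lhd> G" using N by (simp add: N'_def)
  interpret Q: group_hom G "G Mod N'" "\<lambda>a. N' #> a" by (rule quotient_hom[OF N])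
  have finQ: "finite (carrier (G Mod N'))" using fin by (simp add: carrier_quotient)
  have ups: "upsilon G (Suc i) = {u \<in> carrier G. N' #> u \<in> Q.H.U_center}"
    by (simp add: N'_def[symmetric] Q.H.U_sub_center_eq[OF finQ])
  have "N' #> u \<in> Q.H.U_center \<longleftrightarrow> (\<forall>g\<in>carrier G. \<not> element_commutators G g \<subseteq> N' \<longrightarrow>
      (\<exists>x\<in>carrier G. \<exists>n\<in>N'. x \<otimes> g \<otimes> inv x = g \<otimes> u \<otimes> n))" if u: "u \<in> carrier G" for u
  proof -
    have "N' #> u \<in> Q.H.U_center \<longleftrightarrow> (\<forall>g\<in>carrier G. N' #> g \<notin> group_center (G Mod N') \<longrightarrow>
        conj_in (G Mod N') (N' #> g) (N' #> (g \<otimes> u)))"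
      unfolding Q.H.U_center_def using u by (auto simp: carrier_quotient Q.hom_mult)
    also have "\<dots> \<longleftrightarrow> (\<forall>g\<in>carrier G. \<not> element_commutators G g \<subseteq> N' \<longrightarrow>
      (\<exists>x\<in>carrier G. \<exists>n\<in>N'. x \<otimes> g \<otimes> inv x = g \<otimes> u \<otimes> n))"
      using u by (simp add: center_quotient[OF N] conj_in_quotient[OF N] del: Q.hom_mult)
    finally show ?thesis .
  qed
  then show "upsilon G (Suc i) = ?R" unfolding ups N'_def[symmetric] by auto
  note K = Q.H.U_center_normal[OF finQ]
  note Ks = normal_imp_subgroup[OF K]
  show "upsilon G (Suc i) \<lhd> G"
    unfolding ups normal_inv_iff
  proof (intro conjI ballI subgroupI)
    show "{u \<in> carrier G. N' #> u \<in> Q.H.U_center} \<noteq> {}"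
      using Q.hom_one subgroup.one_closed[OF Ks] by (metis (mono_tags, lifting) empty_iff mem_Collect_eq one_closed)
    show "inv a \<in> {u \<in> carrier G. N' #> u \<in> Q.H.U_center}" if "a \<in> {u \<in> carrier G. N' #> u \<in> Q.H.U_center}" for a
      using that subgroup.m_inv_closed[OF Ks] by (simp add: Q.hom_inv)
    show "a \<otimes> b \<in> {u \<in> carrier G. N' #> u \<in> Q.H.U_center}"
      if "a \<in> {u \<in> carrier G. N' #> u \<in> Q.H.U_center}" "b \<in> {u \<in> carrier G. N' #> u \<in> Q.H.U_center}" for a b
      using that subgroup.m_closed[OF Ks] by (simp add: Q.hom_mult)
    show "x \<otimes> h \<otimes> inv x \<in> {u \<in> carrier G. N' #> u \<in> Q.H.U_center}"
      if "x \<in> carrier G" "h \<in> {u \<in> carrier G. N' #> u \<in> Q.H.U_center}" for x h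
      using that Q.H.normal_conj_closed(1)[OF K, of "N' #> x" "N' #> h"] by (simp add: Q.hom_mult Q.hom_inv)
  qed auto
qed

lemma upsilon_normal: "finite (carrier G) \<Longrightarrow> upsilon G i \<lhd> G"
  by (induction i) (simp add: one_is_normal, rule upsilon_Suc_eq(2))

lemma upsilon_mono_Suc:
  assumes fin: "finite (carrier G)"
  shows "upsilon G i \<subseteq> upsilon G (Suc i)"
proof
  fix n assume n: "n \<in> upsilon G i"
  note N = upsilon_normal[OF fin, of i]
  have nc: "n \<in> carrier G" by (rule normal_carrier[OF N n])
  have "\<exists>x\<in>carrier G. \<exists>k\<in>upsilon G i. x \<otimes> g \<otimes> inv x = g \<otimes> n \<otimes> k" if g: "g \<in> carrier G" for g
    using g nc subgroup.m_inv_closed[OF normal_imp_subgroup[OF N] n]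
    by (intro bexI[of _ \<one>] bexI[of _ "inv n"]) (auto simp: m_assoc)
  then show "n \<in> upsilon G (Suc i)" unfolding upsilon_Suc_eq(1)[OF fin N] using nc by blast
qed

lemma upsilon_mono: "finite (carrier G) \<Longrightarrow> i \<le> j \<Longrightarrow> upsilon G i \<subseteq> upsilon G j"
  by (rule lift_Suc_mono_le[of "upsilon G", OF upsilon_mono_Suc])

lemma epsilon_antimono_Suc: "epsilon G (Suc (Suc i)) \<subseteq> epsilon G (Suc i)"
proof (induction i)
  case 0
  have "V_sub G N \<subseteq> carrier G" for N unfolding V_sub_def by (rule generate_incl) auto
  then show ?case by simp
next
  case (Suc i)
  have cm: "commutator_subgroup G A (carrier G) \<subseteq> commutator_subgroup G B (carrier G)" if "A \<subseteq> B" for A B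
    unfolding commutator_subgroup_def using that by (intro mono_generate) blast
  have vm: "V_sub G A \<subseteq> V_sub G B" if "A \<subseteq> B" for A B
    unfolding V_sub_def using that by (intro mono_generate) (auto simp: Irr_over_def)
  have "V_sub G (commutator_subgroup G (epsilon G (Suc (Suc i))) (carrier G))
      \<subseteq> V_sub G (commutator_subgroup G (epsilon G (Suc i)) (carrier G))"
    by (rule vm[OF cm[OF Suc.IH]])
  then show ?case by simp
qed

lemma epsilon_antimono: "i \<le> j \<Longrightarrow> epsilon G (Suc j) \<subseteq> epsilon G (Suc i)"
  by (rule lift_Suc_antimono_le[of "\<lambda>i. epsilon G (Suc i)", OF epsilon_antimono_Suc])

end

section \<open>Nested GVZ-groups from the series\<close>

lemma finite_chain_enumeration:
  assumes "finite \<C>" "\<C> \<noteq> {}" "chain\<^sub>\<subseteq> \<C>"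
  shows "\<exists>C m. (\<forall>i<m. C (Suc i) \<subset> C i) \<and> C ` {..m::nat} = \<C>"
  using assms
proof (induction "card \<C>" arbitrary: \<C>)
  case 0
  then show ?case by simp
next
  case (Suc k)
  obtain X where X: "X \<in> \<C>" "\<And>Y. Y \<in> \<C> \<Longrightarrow> Y \<subseteq> X \<Longrightarrow> X = Y"
    using finite_has_minimal[OF Suc.prems(1,2)] by blast
  have least: "X \<subset> Y" if "Y \<in> \<C> - {X}" for Y
    using X that Suc.prems(3) unfolding chain_subset_def by blast
  show ?case
  proof (cases "\<C> = {X}")
    case True
    have "(\<forall>i<0. (\<lambda>_. X) (Suc i) \<subset> (\<lambda>_::nat. X) i) \<and> (\<lambda>_. X) ` {..0::nat} = \<C>" using True by simp
    then show ?thesis by blast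
  next
    case False
    have "k = card (\<C> - {X})" using Suc.hyps(2) X(1) Suc.prems(1) by simp
    moreover have "finite (\<C> - {X})" using Suc.prems(1) by simp
    moreover have "\<C> - {X} \<noteq> {}" using Suc.prems(2) False by auto
    moreover have "chain\<^sub>\<subseteq> (\<C> - {X})" using Suc.prems(3) by (simp add: chain_subset_def)
    ultimately have "\<exists>C m. (\<forall>i<m. C (Suc i) \<subset> C i) \<and> C ` {..m::nat} = \<C> - {X}" by (rule Suc.hyps(1))
    then obtain C m where C: "\<forall>i<m. C (Suc i) \<subset> C i" "C ` {..m::nat} = \<C> - {X}"
      by blast
    have "C m \<in> \<C> - {X}" using C(2) by blast
    then have "\<forall>i<Suc m. (C(Suc m := X)) (Suc i) \<subset> (C(Suc m := X)) i"
      using C(1) least by (auto simp: less_Suc_eq)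
    moreover have "(C(Suc m := X)) ` {..Suc m} = \<C>"
    proof -
      have "(C(Suc m := X)) ` {..m} = C ` {..m}" by (rule image_cong) auto
      then show ?thesis unfolding atMost_Suc image_insert C(2) using X(1) by auto
    qed
    ultimately show ?thesis by (intro exI[of _ "C(Suc m := X)"] exI[of _ "Suc m"] conjI)
  qed
qed

context group
begin

text \<open>The degree of \<open>\<chi>\<close> is determined by the order of \<open>Z(\<chi>)\<close> and conversely, and members of a finite chain are
  determined by their orders.\<close>
lemma card_degrees:
  assumes fin: "finite (carrier G)" and GVZ: "nested_GVZ_group G"
  shows "card (cd G) = card (char_centers G)"
proof -
  define f where "f X = complex_of_real (sqrt (real (card (carrier G)) / real (card X)))" for X :: "'a set"
  have deg: "\<chi> \<one> = f (char_center G \<chi>) \<and> card (char_center G \<chi>) > 0" if \<chi>: "\<chi> \<in> Irr G" for \<chi>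
  proof -
    have "char_van G \<chi> = char_center G \<chi>" using GVZ \<chi> by (simp add: nested_GVZ_group_def GVZ_group_def)
    then have "\<And>g. g \<in> carrier G \<Longrightarrow> g \<notin> char_center G \<chi> \<Longrightarrow> \<chi> g = 0"
      unfolding char_van_eq_center_iff[OF fin \<chi>] by blast
    then obtain d where d: "\<chi> \<one> = of_nat d" "0 < d" "d\<^sup>2 * card (char_center G \<chi>) = card (carrier G)"
      using degree_square_center[OF fin \<chi>] by metis
    have pos: "0 < card (carrier G)" using fin by (simp add: card_gt_0_iff) blast
    then have z: "0 < card (char_center G \<chi>)" using d(3) by (metis gr0I mult_0_right)
    have "real (card (carrier G)) = (real d)\<^sup>2 * real (card (char_center G \<chi>))"
      unfolding d(3)[symmetric] by simp
    then have "sqrt (real (card (carrier G)) / real (card (char_center G \<chi>))) = real d" using z by simp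
    then show ?thesis using d(1) z by (simp add: f_def)
  qed
  have "cd G = f ` char_centers G"
    unfolding cd_def char_centers_def image_image using deg by (intro image_cong) auto
  moreover have "inj_on f (char_centers G)"
  proof (rule inj_onI)
    fix X Y assume XY: "X \<in> char_centers G" "Y \<in> char_centers G" "f X = f Y"
    have X: "X \<subseteq> carrier G" "0 < card X" and Y: "Y \<subseteq> carrier G" "0 < card Y"
      using XY deg by (auto simp: char_centers_def char_center_def)
    have "0 < card (carrier G)" using fin by (simp add: card_gt_0_iff) blast
    moreover have "real (card (carrier G)) / real (card X) = real (card (carrier G)) / real (card Y)"
      using XY(3) by (simp add: f_def del: real_sqrt_divide)
    ultimately have "card X = card Y" using X Y by (simp add: field_simps)
    moreover have "X \<subseteq> Y \<or> Y \<subseteq> X"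
      using GVZ XY unfolding nested_GVZ_group_def nested_group_def chain_subset_def by blast
    ultimately show "X = Y" using card_subset_eq finite_subset[OF X(1) fin] finite_subset[OF Y(1) fin] by metis
  qed
  ultimately show ?thesis by (simp add: card_image)
qed

text \<open>As long as \<open>g\<close> is not central modulo \<open>\<upsilon>\<^bsub>j\<^esub>\<close>, a factor from \<open>\<upsilon>\<^bsub>j+1\<^esub>\<close> can be absorbed at the cost of a
  factor from \<open>\<upsilon>\<^bsub>j\<^esub>\<close>, which the induction hypothesis absorbs.\<close>
lemma absorbs_upsilon:
  assumes fin: "finite (carrier G)" and g: "g \<in> carrier G"
    and below: "\<And>j. j < i \<Longrightarrow> \<not> element_commutators G g \<subseteq> upsilon G j"
  shows "class_absorbs G g (upsilon G i)"
  using below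
proof (induction i)
  case 0
  then show ?case using g by (simp add: class_absorbs_def conj_in_refl)
next
  case (Suc i)
  note N = upsilon_normal[OF fin, of i]
  show ?case
    unfolding class_absorbs_def
  proof
    fix u assume u: "u \<in> upsilon G (Suc i)"
    have uc: "u \<in> carrier G" by (rule normal_carrier[OF upsilon_normal[OF fin] u])
    obtain x n where x: "x \<in> carrier G" and n: "n \<in> upsilon G i" and e: "x \<otimes> g \<otimes> inv x = g \<otimes> u \<otimes> n"
      using u g Suc.prems[of i] unfolding upsilon_Suc_eq(1)[OF fin N] by blast
    have nc: "n \<in> carrier G" by (rule normal_carrier[OF N n])
    define w where "w = inv x \<otimes> inv n \<otimes> x"
    have w: "w \<in> upsilon G i"
      unfolding w_def by (intro normal_conj_closed(2)[OF N x] subgroup.m_inv_closed[OF normal_imp_subgroup[OF N] n])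
    have "conj_in G g (g \<otimes> w)" using Suc.IH Suc.prems w by (simp add: class_absorbs_def)
    moreover have "conj_in G (g \<otimes> w) (g \<otimes> u)"
    proof -
      have "x \<otimes> (g \<otimes> w) \<otimes> inv x = (x \<otimes> g \<otimes> inv x) \<otimes> inv n"
        using x g nc by (simp add: w_def group_normalize)
      also have "\<dots> = g \<otimes> u" using e g uc nc by (simp add: m_assoc)
      finally show ?thesis unfolding conj_in_def using x by blast
    qed
    ultimately show "conj_in G g (g \<otimes> u)" by (rule conj_in_trans[OF g])
  qed
qed

lemma absorbed_in_commutators:
  assumes g: "g \<in> carrier G" and N: "N \<subseteq> carrier G" "class_absorbs G g N"
  shows "N \<subseteq> element_commutators G g"
  using conj_in_mult_in_commutators[OF g] N by (auto simp: class_absorbs_def)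

lemma nested_GVZ_iff:
  assumes fin: "finite (carrier G)"
  shows "nested_GVZ_group G \<longleftrightarrow> (\<forall>g\<in>carrier G. class_absorbs G g (element_commutators G g)) \<and>
    (\<forall>g\<in>carrier G. \<forall>h\<in>carrier G.
      element_commutators G g \<subseteq> element_commutators G h \<or> element_commutators G h \<subseteq> element_commutators G g)"
  unfolding nested_GVZ_group_def nested_group_iff[OF fin] GVZ_group_iff[OF fin] by blast

text \<open>For the least \<open>i\<close> with \<open>[g, G] \<le> \<upsilon>\<^bsub>i\<^esub>\<close>, the class of \<open>g\<close> absorbs \<open>\<upsilon>\<^bsub>i\<^esub>\<close>. This forces \<open>\<upsilon>\<^bsub>i\<^esub> \<le> [g, G]\<close>, so
  every \<open>[g, G]\<close> is a member of the ascending series.\<close>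
lemma nested_GVZ_if_upsilon:
  assumes fin: "finite (carrier G)" and top: "commutator_subgroup G (carrier G) (carrier G) \<subseteq> upsilon G k"
  shows "nested_GVZ_group G"
proof -
  have ex: "\<exists>i. element_commutators G g = upsilon G i \<and> class_absorbs G g (upsilon G i)" if g: "g \<in> carrier G" for g
  proof -
    define i where "i = (LEAST i. element_commutators G g \<subseteq> upsilon G i)"
    have "element_commutators G g \<subseteq> upsilon G k"
      using top element_commutators_subset[of "carrier G" g] g by blast
    then have "element_commutators G g \<subseteq> upsilon G i" unfolding i_def by (rule LeastI)
    moreover have abs: "class_absorbs G g (upsilon G i)"
      by (rule absorbs_upsilon[OF fin g]) (auto simp: i_def dest: not_less_Least)
    moreover have "upsilon G i \<subseteq> element_commutators G g"
      using absorbed_in_commutators[OF g _ abs] normal_carrier[OF upsilon_normal[OF fin]] by blast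
    ultimately show ?thesis by blast
  qed
  have "element_commutators G g \<subseteq> element_commutators G h \<or> element_commutators G h \<subseteq> element_commutators G g"
    if gh: "g \<in> carrier G" "h \<in> carrier G" for g h
  proof -
    obtain i j where "element_commutators G g = upsilon G i" "element_commutators G h = upsilon G j"
      using ex gh by metis
    then show ?thesis using upsilon_mono[OF fin] nat_le_linear by metis
  qed
  moreover have "class_absorbs G g (element_commutators G g)" if "g \<in> carrier G" for g
    using ex[OF that] by metis
  ultimately show ?thesis unfolding nested_GVZ_iff[OF fin] by blast
qed

lemma commutator_subgroup_one: "commutator_subgroup G {\<one>} (carrier G) = {\<one>}"
proof
  show "commutator_subgroup G {\<one>} (carrier G) \<subseteq> {\<one>}" by (subst commutator_subgroup_subset_iff[OF triv_subgroup]) auto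
  show "{\<one>} \<subseteq> commutator_subgroup G {\<one>} (carrier G)"
    unfolding commutator_subgroup_def by (auto intro: generate.one)
qed

lemma epsilon_carrier: "epsilon G (Suc i) \<subseteq> carrier G"
  using epsilon_antimono[of 0 i] by simp

text \<open>If \<open>g\<close> leaves the series at the step from \<open>\<epsilon>\<^bsub>i\<^esub>\<close> to \<open>\<epsilon>\<^bsub>i+1\<^esub> = V(G | [\<epsilon>\<^bsub>i\<^esub>, G])\<close>, then its class absorbs
  \<open>[\<epsilon>\<^bsub>i\<^esub>, G]\<close>; since \<open>g \<in> \<epsilon>\<^bsub>i\<^esub>\<close>, this subgroup equals \<open>[g, G]\<close>. So every \<open>[g, G]\<close> with \<open>g \<noteq> \<one>\<close> occurs in
  the descending chain of the subgroups \<open>[\<epsilon>\<^bsub>i\<^esub>, G]\<close>.\<close>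
lemma nested_GVZ_if_epsilon:
  assumes fin: "finite (carrier G)" and bot: "epsilon G (Suc k) \<subseteq> {\<one>}"
  shows "nested_GVZ_group G"
proof -
  have ex: "\<exists>i. element_commutators G g = commutator_subgroup G (epsilon G (Suc i)) (carrier G)
      \<and> class_absorbs G g (element_commutators G g)" if g: "g \<in> carrier G" "g \<noteq> \<one>" for g
  proof -
    define j where "j = (LEAST j. g \<notin> epsilon G (Suc j))"
    have "g \<notin> epsilon G (Suc k)" using bot g by blast
    then have j: "g \<notin> epsilon G (Suc j)" unfolding j_def by (rule LeastI)
    then obtain i where i: "j = Suc i" using g by (cases j) auto
    have gi: "g \<in> epsilon G (Suc i)" using not_less_Least[of i "\<lambda>j. g \<notin> epsilon G (Suc j)"] i by (simp add: j_def)
    define N where "N = commutator_subgroup G (epsilon G (Suc i)) (carrier G)"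
    have N: "N \<lhd> G" unfolding N_def by (rule commutator_subgroup_normal[OF epsilon_carrier])
    have abs: "class_absorbs G g N"
    proof (rule ccontr)
      assume "\<not> class_absorbs G g N"
      then have "g \<in> V_sub G N" unfolding V_sub_eq[OF fin N] using g by (intro generate.incl) simp
      then show False using j by (simp add: i N_def)
    qed
    have "N \<subseteq> element_commutators G g"
      using absorbed_in_commutators[OF g(1) _ abs] normal_carrier[OF N] by blast
    moreover have "element_commutators G g \<subseteq> N"
      unfolding N_def by (rule element_commutators_subset[OF epsilon_carrier gi])
    ultimately have "element_commutators G g = N" by simp
    then show ?thesis using abs by (intro exI[of _ i]) (simp add: N_def)
  qed
  have mono: "commutator_subgroup G (epsilon G (Suc j)) (carrier G) \<subseteq> commutator_subgroup G (epsilon G (Suc i)) (carrier G)"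
    if "i \<le> j" for i j
    unfolding commutator_subgroup_def using epsilon_antimono[OF that] by (intro mono_generate) blast
  have triv: "element_commutators G \<one> \<subseteq> element_commutators G g" if "g \<in> carrier G" for g
    unfolding commutator_subgroup_one
    using subgroup.one_closed[OF normal_imp_subgroup[OF element_commutators_normal[OF that]]] by simp
  have "element_commutators G g \<subseteq> element_commutators G h \<or> element_commutators G h \<subseteq> element_commutators G g"
    if gh: "g \<in> carrier G" "h \<in> carrier G" for g h
  proof (cases "g = \<one> \<or> h = \<one>")
    case True
    then show ?thesis using triv gh by blast
  next
    case False
    obtain i j where "element_commutators G g = commutator_subgroup G (epsilon G (Suc i)) (carrier G)"
      "element_commutators G h = commutator_subgroup G (epsilon G (Suc j)) (carrier G)"
      using ex gh False by metis
    then show ?thesis using mono nat_le_linear by metis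
  qed
  moreover have "class_absorbs G g (element_commutators G g)" if g: "g \<in> carrier G" for g
  proof (cases "g = \<one>")
    case True
    then show ?thesis by (simp add: commutator_subgroup_one class_absorbs_def conj_in_refl)
  next
    case False
    then show ?thesis using ex[OF g] by blast
  qed
  ultimately show ?thesis unfolding nested_GVZ_iff[OF fin] by blast
qed

end

section \<open>The series of a nested GVZ-group\<close>

text \<open>The nontrivial nested GVZ-groups, described by conjugacy classes and commutators only.\<close>
locale nested_absorbing_group = group G for G (structure) +
  assumes fin: "finite (carrier G)"
    and nontrivial: "carrier G \<noteq> {\<one>}"
    and absorbs: "g \<in> carrier G \<Longrightarrow> class_absorbs G g (element_commutators G g)"
    and comparable: "g \<in> carrier G \<Longrightarrow> h \<in> carrier G \<Longrightarrow>
      element_commutators G g \<subseteq> element_commutators G h \<or> element_commutators G h \<subseteq> element_commutators G g"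
begin

lemma absorbs_iff:
  assumes "g \<in> carrier G" "N \<subseteq> carrier G"
  shows "class_absorbs G g N \<longleftrightarrow> N \<subseteq> element_commutators G g"
  using absorbed_in_commutators[OF assms] absorbs[OF assms(1)] by (auto simp: class_absorbs_def)

text \<open>Otherwise the class of \<open>g\<close> would contain \<open>g \<otimes> inv g = \<one>\<close>. This is what makes \<open>[G, G]\<close>
  proper and the centre nontrivial below.\<close>
lemma inv_not_in_commutators:
  assumes "g \<in> carrier G" "g \<noteq> \<one>"
  shows "inv g \<notin> element_commutators G g"
proof
  assume "inv g \<in> element_commutators G g"
  then have "conj_in G g (g \<otimes> inv g)" using absorbs[OF assms(1)] by (simp add: class_absorbs_def)
  then show False using conj_in_one[OF assms(1)] assms by simp
qed

lemma element_commutators_proper: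
  assumes g: "g \<in> carrier G"
  shows "element_commutators G g \<noteq> carrier G"
  using inv_not_in_commutators[OF g] g nontrivial commutator_subgroup_one by (metis inv_closed)

lemma largest_commutators:
  assumes A: "A \<subseteq> carrier G" "A \<noteq> {}"
  obtains g where "g \<in> A" "commutator_subgroup G A (carrier G) = element_commutators G g"
proof -
  have "finite (element_commutators G ` A)" "element_commutators G ` A \<noteq> {}"
    using A fin finite_subset by auto
  from finite_has_maximal[OF this] obtain M where "M \<in> element_commutators G ` A"
    and "\<forall>B\<in>element_commutators G ` A. M \<subseteq> B \<longrightarrow> M = B" by (elim bexE)
  then obtain g where g: "g \<in> A" and max: "\<And>h. h \<in> A \<Longrightarrow> element_commutators G g \<subseteq> element_commutators G h
      \<Longrightarrow> element_commutators G g = element_commutators G h" by auto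
  have "element_commutators G h \<subseteq> element_commutators G g" if "h \<in> A" for h
    using comparable[of g h] max[OF that] that g A by blast
  then have "commutator_subgroup G A (carrier G) \<subseteq> element_commutators G g"
    using commutator_subgroup_subset_iff_elements[OF normal_imp_subgroup[OF element_commutators_normal]] g A by blast
  then show thesis using that[OF g] element_commutators_subset[OF A(1) g] by blast
qed

text \<open>Choose \<open>x\<close> outside \<open>[h, G]\<close> but in the next larger \<open>[k, G]\<close> (anywhere outside, if \<open>[h, G]\<close> is the largest one).
  A character with \<open>[h, G]\<close> but not \<open>x\<close> in its kernel has the required centre.\<close>
lemma commutators_below_in_centers:
  assumes h: "h \<in> carrier G"
  shows "{g \<in> carrier G. element_commutators G g \<subseteq> element_commutators G h} \<in> char_centers G"
proof -
  define X where "X = {g \<in> carrier G. element_commutators G g \<subseteq> element_commutators G h}"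
  have "\<exists>x\<in>carrier G - element_commutators G h. \<forall>g\<in>carrier G - X. x \<in> element_commutators G g"
  proof (cases "X = carrier G")
    case True
    then show ?thesis
      using element_commutators_proper[OF h] normal_carrier[OF element_commutators_normal[OF h]] by blast
  next
    case False
    have "finite (element_commutators G ` (carrier G - X))" "element_commutators G ` (carrier G - X) \<noteq> {}"
      using False fin by (auto simp: X_def)
    from finite_has_minimal[OF this] obtain M where "M \<in> element_commutators G ` (carrier G - X)"
      and "\<forall>B\<in>element_commutators G ` (carrier G - X). B \<subseteq> M \<longrightarrow> M = B" by (elim bexE)
    then obtain k where k: "k \<in> carrier G - X" and min: "\<And>g. g \<in> carrier G - X \<Longrightarrow> element_commutators G g \<subseteq> element_commutators G k
        \<Longrightarrow> element_commutators G k = element_commutators G g" by auto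
    then obtain x where x: "x \<in> element_commutators G k" "x \<notin> element_commutators G h" by (auto simp: X_def)
    have "x \<in> element_commutators G g" if g: "g \<in> carrier G - X" for g
      using comparable[of g k] min[OF g] g k x by blast
    moreover have "x \<in> carrier G" using normal_carrier[OF element_commutators_normal x(1)] k by blast
    ultimately show ?thesis using x(2) by blast
  qed
  then obtain x where x: "x \<in> carrier G" "x \<notin> element_commutators G h"
    "\<And>g. g \<in> carrier G - X \<Longrightarrow> x \<in> element_commutators G g" by blast
  obtain \<chi> where \<chi>: "\<chi> \<in> Irr G" "element_commutators G h \<subseteq> char_ker G \<chi>" "x \<notin> char_ker G \<chi>"
    using exists_Irr_separating[OF fin element_commutators_normal[OF h] x(1,2)] by blast
  have "char_center G \<chi> = X"
    unfolding char_center_iff[OF fin \<chi>(1)] using \<chi>(2,3) x(3) by (auto simp: X_def)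
  then show ?thesis using \<chi>(1) by (auto simp: char_centers_def X_def)
qed

lemma char_centers_finite: "finite (char_centers G)"
  by (rule finite_subset[of _ "Pow (carrier G)"]) (auto simp: char_centers_def char_center_def fin)

lemma carrier_in_char_centers: "carrier G \<in> char_centers G"
proof -
  obtain h where h: "h \<in> carrier G" "commutator_subgroup G (carrier G) (carrier G) = element_commutators G h"
    using largest_commutators[of "carrier G"] one_closed by blast
  then have "{g \<in> carrier G. element_commutators G g \<subseteq> element_commutators G h} = carrier G"
    using element_commutators_subset[of "carrier G"] by blast
  then show ?thesis using commutators_below_in_centers[OF h(1)] by simp
qed

lemma nested_GVZ: "nested_GVZ_group G"
  unfolding nested_GVZ_iff[OF fin] using absorbs comparable by blast

lemma chain_of_centers_exists: "\<exists>C m. chain_of_centers G C m"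
proof -
  have "chain\<^sub>\<subseteq> (char_centers G)" using nested_GVZ by (simp add: nested_GVZ_group_def nested_group_def)
  then obtain C m where C: "\<forall>i<m. C (Suc i) \<subset> C i" "C ` {..m::nat} = char_centers G"
    using finite_chain_enumeration[OF char_centers_finite] carrier_in_char_centers by blast
  have mono: "C i \<subseteq> C 0" if "i \<le> m" for i
    using that by (induction i) (use C(1) in \<open>auto simp: Suc_le_eq\<close>)
  obtain i where "i \<le> m" "C i = carrier G" using carrier_in_char_centers C(2) by (metis atMost_iff imageE)
  moreover have "C 0 \<subseteq> carrier G"
  proof -
    have "C 0 \<in> char_centers G" using C(2) by blast
    then show ?thesis by (auto simp: char_centers_def char_center_def)
  qed
  ultimately have "C 0 = carrier G" using mono by blast
  then show ?thesis using C unfolding chain_of_centers_def by blast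
qed

end

locale nested_absorbing_chain = nested_absorbing_group +
  fixes C :: "nat \<Rightarrow> 'a set" and m :: nat
  assumes chain: "chain_of_centers G C m"
begin

text \<open>The distinct subgroups \<open>[g, G]\<close> in increasing order, from \<open>D 0 = {\<one>}\<close> to \<open>D m = [G, G]\<close>.\<close>
definition D :: "nat \<Rightarrow> 'a set" where
  "D j = commutator_subgroup G (carrier G) (C (m - j))"

lemma C_center: "i \<le> m \<Longrightarrow> C i \<in> char_centers G"
  and C_0: "C 0 = carrier G"
  and C_Suc: "i < m \<Longrightarrow> C (Suc i) \<subset> C i"
  using chain by (auto simp: chain_of_centers_def)

lemma centerE: "X \<in> char_centers G \<Longrightarrow> \<exists>i\<le>m. X = C i"
proof -
  assume "X \<in> char_centers G"
  then have "X \<in> C ` {..m}" using chain by (simp add: chain_of_centers_def)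
  then show ?thesis by auto
qed

lemma C_carrier: "i \<le> m \<Longrightarrow> C i \<subseteq> carrier G"
  using C_center by (auto simp: char_centers_def char_center_def)

lemma C_strict: "i < j \<Longrightarrow> j \<le> m \<Longrightarrow> C j \<subset> C i"
proof (induction j)
  case (Suc j)
  then show ?case using C_Suc[of j] by (cases "i = j") auto
qed simp

lemma D_eq: "D j = commutator_subgroup G (C (m - j)) (carrier G)"
  unfolding D_def by (rule commutator_subgroup_commute[OF subset_refl C_carrier]) simp

lemma D_normal: "D j \<lhd> G"
  unfolding D_eq by (rule commutator_subgroup_normal[OF C_carrier]) simp

lemma D_carrier: "D j \<subseteq> carrier G"
  using normal_carrier[OF D_normal] by blast

text \<open>\<open>C (m - j)\<close> is the centre of some \<open>\<chi>\<close>, and \<open>D j\<close> is contained in \<open>ker \<chi>\<close>; so commutators in \<open>D j\<close> are trivial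
  modulo \<open>ker \<chi>\<close>.\<close>
lemma C_eq: "C (m - j) = {g \<in> carrier G. element_commutators G g \<subseteq> D j}"
proof -
  have c: "C (m - j) \<subseteq> carrier G" by (rule C_carrier) simp
  obtain \<chi> where \<chi>: "\<chi> \<in> Irr G" "C (m - j) = char_center G \<chi>"
    using C_center[of "m - j"] by (auto simp: char_centers_def)
  have X: "C (m - j) = {g \<in> carrier G. element_commutators G g \<subseteq> char_ker G \<chi>}"
    unfolding \<chi>(2) by (rule char_center_iff[OF fin \<chi>(1)])
  have "D j \<subseteq> char_ker G \<chi>"
    unfolding D_eq
    by (rule iffD2[OF commutator_subgroup_subset_iff_elements[OF normal_imp_subgroup[OF char_ker_normal[OF fin \<chi>(1)]]]])
      (simp add: X)
  then have "g \<in> C (m - j)" if "g \<in> carrier G" "element_commutators G g \<subseteq> D j" for g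
    using that by (simp add: X)
  moreover have "element_commutators G g \<subseteq> D j" if "g \<in> C (m - j)" for g
    unfolding D_eq by (rule element_commutators_subset[OF c that])
  ultimately show ?thesis using c by (intro equalityI subsetI) auto
qed

lemma D_strict: "i < j \<Longrightarrow> j \<le> m \<Longrightarrow> D i \<subset> D j"
proof -
  assume ij: "i < j" "j \<le> m"
  then have "C (m - i) \<subset> C (m - j)" by (intro C_strict) auto
  moreover from this have "D i \<subseteq> D j" unfolding D_eq commutator_subgroup_def by (intro mono_generate) blast
  moreover have "D i \<noteq> D j" using \<open>C (m - i) \<subset> C (m - j)\<close> C_eq[of i] C_eq[of j] by auto
  ultimately show ?thesis by blast
qed

lemma D_subset_iff: "i \<le> m \<Longrightarrow> j \<le> m \<Longrightarrow> D i \<subseteq> D j \<longleftrightarrow> i \<le> j"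
  using D_strict[of i j] D_strict[of j i] by (cases i j rule: linorder_cases) auto

lemma element_commutators_D: "g \<in> carrier G \<Longrightarrow> \<exists>j\<le>m. element_commutators G g = D j"
proof -
  assume g: "g \<in> carrier G"
  obtain i where i: "i \<le> m" "{h \<in> carrier G. element_commutators G h \<subseteq> element_commutators G g} = C i"
    using centerE[OF commutators_below_in_centers[OF g]] by blast
  then have mi: "C (m - (m - i)) = {h \<in> carrier G. element_commutators G h \<subseteq> element_commutators G g}" by simp
  have "element_commutators G g \<subseteq> D (m - i)"
    unfolding D_eq mi using g by (intro element_commutators_subset) auto
  moreover have "D (m - i) \<subseteq> element_commutators G g"
    unfolding D_eq mi
    by (subst commutator_subgroup_subset_iff_elements[OF normal_imp_subgroup[OF element_commutators_normal[OF g]]]) auto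
  ultimately show ?thesis by (intro exI[of _ "m - i"]) auto
qed

lemma D_element_commutators: "\<exists>g\<in>carrier G. D j = element_commutators G g"
proof -
  have c: "C (m - j) \<subseteq> carrier G" by (rule C_carrier) simp
  have "\<one> \<in> C (m - j)"
    unfolding C_eq commutator_subgroup_one using subgroup.one_closed[OF normal_imp_subgroup[OF D_normal]]
    by (simp add: commutator_subgroup_one)
  then have "C (m - j) \<noteq> {}" by blast
  from largest_commutators[OF c this] obtain g where "g \<in> C (m - j)" "D j = element_commutators G g"
    unfolding D_eq .
  then show ?thesis using c by blast
qed

lemma one_in_D: "\<one> \<in> D j"
  by (rule subgroup.one_closed[OF normal_imp_subgroup[OF D_normal]])

lemma D_0: "D 0 = {\<one>}"
proof -
  obtain j where j: "j \<le> m" "element_commutators G \<one> = D j" using element_commutators_D[OF one_closed] by blast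
  have "D 0 \<subseteq> D j" using D_subset_iff[of 0 j] j by simp
  moreover have "D j = {\<one>}" using j(2) by (simp add: commutator_subgroup_one)
  ultimately show ?thesis using one_in_D[of 0] by blast
qed

lemma D_m: "D m = commutator_subgroup G (carrier G) (carrier G)"
  by (simp add: D_def C_0)

lemma D_proper: "D j \<noteq> carrier G"
  using D_element_commutators[of j] element_commutators_proper by metis

lemma C_m: "C m = group_center G"
  using C_eq[of 0] by (simp add: D_0 group_center_eq)

text \<open>With a trivial centre, every \<open>h \<noteq> \<one>\<close> satisfies \<open>D 1 \<le> [h, G]\<close>. For \<open>h\<close> in \<open>D 1\<close> itself this puts
  \<open>inv h\<close> into \<open>[h, G]\<close>.\<close>
lemma center_nontrivial: "group_center G \<noteq> {\<one>}"
proof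
  assume Z: "group_center G = {\<one>}"
  have "m \<noteq> 0" using C_m C_0 Z nontrivial by auto
  then have "D 0 \<subset> D 1" by (intro D_strict) auto
  then obtain h where h: "h \<in> D 1" "h \<noteq> \<one>" using D_0 by auto
  have hc: "h \<in> carrier G" using h D_carrier by blast
  obtain j where j: "j \<le> m" "element_commutators G h = D j" using element_commutators_D[OF hc] by blast
  have "h \<notin> group_center G" using Z h by blast
  then have "j \<noteq> 0" using hc j D_0 by (auto simp: group_center_eq)
  then have "D 1 \<subseteq> element_commutators G h" using D_subset_iff[of 1 j] j \<open>m \<noteq> 0\<close> by auto
  moreover have "inv h \<in> D 1" by (rule subgroup.m_inv_closed[OF normal_imp_subgroup[OF D_normal] h(1)])
  ultimately show False using inv_not_in_commutators[OF hc h(2)] by blast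
qed

lemma not_D_Suc_subset_iff:
  assumes g: "g \<in> carrier G" and j: "Suc j \<le> m"
  shows "\<not> D (Suc j) \<subseteq> element_commutators G g \<longleftrightarrow> element_commutators G g \<subseteq> D j"
proof -
  obtain k where k: "k \<le> m" "element_commutators G g = D k" using element_commutators_D[OF g] by blast
  show ?thesis unfolding k(2) using D_subset_iff[OF j k(1)] D_subset_iff[OF k(1), of j] j by auto
qed

text \<open>The class of \<open>g\<close> fails to absorb \<open>D (Suc j)\<close> iff \<open>[g, G]\<close> is at most \<open>D j\<close>, that is, iff \<open>g\<close> is central modulo
  \<open>D j\<close>; these elements form a subgroup already.\<close>
lemma V_sub_D_Suc: "Suc j \<le> m \<Longrightarrow> V_sub G (D (Suc j)) = C (m - j)"
proof -
  assume j: "Suc j \<le> m"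
  have "{g \<in> carrier G. \<not> class_absorbs G g (D (Suc j))} = C (m - j)"
    unfolding C_eq
  proof (rule Collect_cong, rule conj_cong[OF refl])
    fix g assume g: "g \<in> carrier G"
    show "\<not> class_absorbs G g (D (Suc j)) \<longleftrightarrow> element_commutators G g \<subseteq> D j"
      using absorbs_iff[OF g D_carrier] not_D_Suc_subset_iff[OF g j] by simp
  qed
  then have "V_sub G (D (Suc j)) = generate G (C (m - j))" by (simp add: V_sub_eq[OF fin D_normal])
  moreover have "subgroup (C (m - j)) G"
    unfolding C_eq by (rule elements_with_commutators_in_subgroup[OF D_normal])
  ultimately show ?thesis
    using generate_subgroup_incl[OF subset_refl] by (auto intro: generate.incl)
qed

lemma V_sub_triv: "V_sub G {\<one>} = {\<one>}"
proof -
  have none: "{g \<in> carrier G. \<not> class_absorbs G g {\<one>}} = {}" by (auto simp: class_absorbs_def conj_in_refl)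
  show ?thesis unfolding V_sub_eq[OF fin one_is_normal] none by (rule generate_empty)
qed

lemma epsilon_eq: "i \<le> m \<Longrightarrow> epsilon G (Suc i) = C i"
proof (induction i)
  case (Suc i)
  then have i: "m - i = Suc (m - Suc i)" by simp
  have "epsilon G (Suc (Suc i)) = V_sub G (D (m - i))" using Suc by (simp add: D_eq)
  also have "\<dots> = C (m - (m - Suc i))" unfolding i by (rule V_sub_D_Suc) (use Suc in simp)
  finally show ?case using Suc by simp
qed (simp add: C_0)

lemma epsilon_triv: "epsilon G (Suc (Suc m + k)) = {\<one>}"
proof (induction k)
  case 0
  have "epsilon G (Suc (Suc m)) = V_sub G (D 0)" using epsilon_eq[of m] by (simp add: D_eq)
  then show ?case by (simp add: D_0 V_sub_triv)
next
  case (Suc k)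
  then show ?case by (simp add: commutator_subgroup_one V_sub_triv)
qed

text \<open>The elements that are not central modulo \<open>D i\<close> are those with \<open>D (Suc i) \<le> [g, G]\<close>. They all absorb \<open>D (Suc i)\<close>,
  and one with \<open>[g, G] = D (Suc i)\<close> absorbs nothing more modulo \<open>D i\<close>.\<close>
lemma upsilon_eq: "i \<le> m \<Longrightarrow> upsilon G i = D i"
proof (induction i)
  case (Suc i)
  then have IH: "upsilon G i = D i" by simp
  note eq = upsilon_Suc_eq(1)[OF fin upsilon_normal[OF fin], of i, unfolded IH]
  show ?case
  proof
    show "D (Suc i) \<subseteq> upsilon G (Suc i)"
    proof
      fix u assume u: "u \<in> D (Suc i)"
      then have uc: "u \<in> carrier G" using D_carrier by blast
      have "\<exists>x\<in>carrier G. \<exists>n\<in>D i. x \<otimes> g \<otimes> inv x = g \<otimes> u \<otimes> n"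
        if g: "g \<in> carrier G" and "\<not> element_commutators G g \<subseteq> D i" for g
      proof -
        have "D (Suc i) \<subseteq> element_commutators G g" using not_D_Suc_subset_iff[OF g Suc.prems] that by blast
        then have "conj_in G g (g \<otimes> u)" using absorbs[OF g] u by (auto simp: class_absorbs_def)
        then obtain x where "x \<in> carrier G" "x \<otimes> g \<otimes> inv x = g \<otimes> u" by (auto simp: conj_in_def)
        then show ?thesis using one_in_D[of i] g uc by (metis m_closed r_one)
      qed
      then show "u \<in> upsilon G (Suc i)" unfolding eq using uc by blast
    qed
    show "upsilon G (Suc i) \<subseteq> D (Suc i)"
    proof
      fix u assume u: "u \<in> upsilon G (Suc i)"
      then have uc: "u \<in> carrier G" unfolding eq by blast
      obtain g where g: "g \<in> carrier G" "D (Suc i) = element_commutators G g"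
        using D_element_commutators by blast
      have "\<not> element_commutators G g \<subseteq> D i" using D_subset_iff[of "Suc i" i] Suc.prems g by auto
      then obtain x n where x: "x \<in> carrier G" and n: "n \<in> D i" and e: "x \<otimes> g \<otimes> inv x = g \<otimes> u \<otimes> n"
        using u g unfolding eq by blast
      have nc: "n \<in> carrier G" using n D_carrier by blast
      have "conj_in G g (g \<otimes> (u \<otimes> n))"
        unfolding conj_in_def using x e g uc nc by (auto simp: m_assoc)
      then have un: "u \<otimes> n \<in> D (Suc i)"
        unfolding g(2) using g uc nc by (intro conj_in_mult_in_commutators) auto
      have n': "n \<in> D (Suc i)" using n D_subset_iff[of i "Suc i"] Suc.prems by auto
      note sub = normal_imp_subgroup[OF D_normal[of "Suc i"]]
      have "(u \<otimes> n) \<otimes> inv n \<in> D (Suc i)"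
        by (rule subgroup.m_closed[OF sub un subgroup.m_inv_closed[OF sub n']])
      then show "u \<in> D (Suc i)" using uc nc by (simp add: m_assoc)
    qed
  qed
qed (simp add: D_0)

lemma upsilon_top: "upsilon G (Suc m + k) = carrier G"
proof -
  have sub: "element_commutators G g \<subseteq> D m" if "g \<in> carrier G" for g
    unfolding D_m by (rule element_commutators_subset) (use that in auto)
  have "upsilon G (Suc m) = carrier G"
    unfolding upsilon_Suc_eq(1)[OF fin upsilon_normal[OF fin]] upsilon_eq[OF order_refl] using sub by auto
  moreover have "upsilon G (Suc m) \<subseteq> upsilon G (Suc m + k)" by (rule upsilon_mono[OF fin]) simp
  moreover have "upsilon G (Suc m + k) \<subseteq> carrier G" using normal_carrier[OF upsilon_normal[OF fin]] by blast
  ultimately show ?thesis by blast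
qed

lemma card_centers: "card (char_centers G) = Suc m"
proof -
  have "inj_on C {..m}"
    by (rule linorder_inj_onI) (use C_strict in auto)
  moreover have "C ` {..m} = char_centers G" using chain by (simp add: chain_of_centers_def)
  ultimately show ?thesis using card_image by fastforce
qed

lemma card_cd: "card (cd G) = Suc m"
  using card_degrees[OF fin nested_GVZ] card_centers by simp

text \<open>The ascending series is \<open>D 0 < \<dots> < D m = [G, G] < G\<close> and then constant, so \<open>[G, G]\<close> occurs at index \<open>m\<close>
  only; likewise the centre occurs in the descending series at a single index.\<close>
lemma upsilon_criterion:
  assumes "n \<ge> 1"
  shows "card (cd G) = n \<longleftrightarrow> upsilon G n = carrier G \<and>
    upsilon G (n - 1) = commutator_subgroup G (carrier G) (carrier G)"
proof -
  consider "n - 1 < m" | "n - 1 = m" | "n - 1 > m" by linarith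
  then show ?thesis
  proof cases
    case 1
    then have "upsilon G (n - 1) \<subset> D m" using upsilon_eq[of "n - 1"] D_strict[of "n - 1" m] by simp
    then show ?thesis using 1 card_cd by (auto simp: D_m)
  next
    case 2
    then show ?thesis
      using assms card_cd upsilon_eq[of m] upsilon_top[of 0] by (cases n) (auto simp: D_m)
  next
    case 3
    then obtain k where "n - 1 = Suc m + k" using less_imp_Suc_add by auto
    then have "upsilon G (n - 1) = carrier G" using upsilon_top[of k] by simp
    then show ?thesis using 3 card_cd D_proper[of m] by (auto simp: D_m)
  qed
qed

lemma epsilon_criterion:
  assumes "n \<ge> 1"
  shows "card (cd G) = n \<longleftrightarrow> epsilon G (n + 1) = {\<one>} \<and> epsilon G n = group_center G"
proof -
  obtain l where l: "n = Suc l" using assms by (cases n) auto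
  consider "l < m" | "l = m" | "l > m" by linarith
  then show ?thesis
  proof cases
    case 1
    then have "epsilon G n \<noteq> group_center G" using epsilon_eq[of l] C_strict[of l m] C_m l by auto
    then show ?thesis using 1 l card_cd by auto
  next
    case 2
    then show ?thesis using l card_cd epsilon_eq[of m] epsilon_triv[of 0] C_m by simp
  next
    case 3
    then obtain k where "l = Suc m + k" using less_imp_Suc_add by auto
    then have "epsilon G n = {\<one>}" using epsilon_triv[of k] l by simp
    then show ?thesis using 3 l card_cd center_nontrivial by auto
  qed
qed

end


section \<open>The equivalences\<close>

theorem theorem5:
  fixes G :: "('a, 'b) monoid_scheme" and p n :: nat
  assumes "prime p"
    and "finite_p_group p G"
    and "carrier G \<noteq> {\<one>\<^bsub>G\<^esub>}"
    and "n \<ge> 1"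
  shows "((nested_GVZ_group G \<and> card (cd G) = n) \<longleftrightarrow>
            (upsilon G n = carrier G \<and>
             upsilon G (n - 1) = commutator_subgroup G (carrier G) (carrier G))) \<and>
         ((nested_GVZ_group G \<and> card (cd G) = n) \<longleftrightarrow>
            (epsilon G (n + 1) = {\<one>\<^bsub>G\<^esub>} \<and> epsilon G n = group_center G)) \<and>
         (\<forall>C m. nested_GVZ_group G \<and> chain_of_centers G C m \<and> {\<one>\<^bsub>G\<^esub>} \<subset> C m \<longrightarrow>
            (\<forall>i\<in>{1..m}.
               upsilon G i = commutator_subgroup G (carrier G) (C (m - i)) \<and>
               epsilon G (i + 1) = C i))"
proof -
  interpret group G using assms(2) by (simp add: finite_p_group_def)
  have fin: "finite (carrier G)" using assms(2) by (simp add: finite_p_group_def)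
  have nag: "nested_absorbing_group G" if "nested_GVZ_group G"
    using that fin assms(3) unfolding nested_GVZ_iff[OF fin] by unfold_locales auto
  have chain: "nested_absorbing_chain G C m" if "nested_GVZ_group G" "chain_of_centers G C m" for C m
    using nag[OF that(1)] that(2) by (simp add: nested_absorbing_chain_def nested_absorbing_chain_axioms_def)
  have ex: "\<exists>C m. nested_absorbing_chain G C m" if "nested_GVZ_group G"
    using nested_absorbing_group.chain_of_centers_exists[OF nag[OF that]] chain[OF that] by blast
  have ups: "nested_GVZ_group G"
    if "upsilon G (n - 1) = commutator_subgroup G (carrier G) (carrier G)"
    by (rule nested_GVZ_if_upsilon[OF fin equalityD2[OF that]])
  have eps: "nested_GVZ_group G" if "epsilon G (n + 1) = {\<one>\<^bsub>G\<^esub>}"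
    by (rule nested_GVZ_if_epsilon[OF fin, of n]) (use that in simp)
  have crit: "card (cd G) = n \<longleftrightarrow> upsilon G n = carrier G \<and>
      upsilon G (n - 1) = commutator_subgroup G (carrier G) (carrier G)"
    "card (cd G) = n \<longleftrightarrow> epsilon G (n + 1) = {\<one>\<^bsub>G\<^esub>} \<and> epsilon G n = group_center G"
    if "nested_GVZ_group G"
    using ex[OF that] nested_absorbing_chain.upsilon_criterion[OF _ assms(4)]
      nested_absorbing_chain.epsilon_criterion[OF _ assms(4)] by metis+
  have "upsilon G i = commutator_subgroup G (carrier G) (C (m - i)) \<and> epsilon G (i + 1) = C i"
    if "nested_GVZ_group G" "chain_of_centers G C m" "i \<in> {1..m}" for C m i
    using nested_absorbing_chain.upsilon_eq[OF chain[OF that(1,2)], of i]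
      nested_absorbing_chain.epsilon_eq[OF chain[OF that(1,2)], of i] that(3)
    by (simp add: nested_absorbing_chain.D_def[OF chain[OF that(1,2)]])
  then show ?thesis using crit ups eps by blast
qed

end
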